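(* Let $n\ge 1$ and let $A$ and $B$ be two $n\times n$ $0$-$1$ circulants of weight at most $3$. Then the following are equivalent: (1) There exist $u,v\in\mathbb{Z}/n\mathbb{Z}$ with $\gcd(u,n)=1$ such that $S_A=uS_B+v$. (2) There are $n\times n$ permutation matrices $P,Q$ such that $A=PBQ$. (3) There is an $n\times n$ permutation matrix $P$ such that $AA^T=PBB^TP^{-1}$. (4) The complex matrices $AA^T$ and $BB^T$ are similar.
   Context: Rows and columns of $n\times n$ matrices are indexed by $0,1,\dots,n-1$. A circulant is an $n\times n$ matrix $(a_{i,j})$ in which $a_{i,j}$ depends only on $i-j \bmod n$ (equivalently, each row is the right circular shift of the previous one). A $0$-$1$ circulant is a circulant with all entries in $\{0,1\}$; its weight is the number of entries equal to $1$ in each row. For a $0$-$1$ circulant $A$, $S_A\subseteq \mathbb{Z}/n\mathbb{Z}$ is the set of column indices $j$ (the leftmost column being $0$) such that the top row of $A$ has entry $1$ in column $j$; thus $A_{i,j}=1$ iff $j-i \bmod n\in S_A$. $A^T$ denotes the transpose. *)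

theory Defs
  imports "Jordan_Normal_Form.Matrix" "HOL-Combinatorics.Permutations"
begin

definition circulant :: "nat \<Rightarrow> 'a mat \<Rightarrow> bool" where
  "circulant n A \<longleftrightarrow> A \<in> carrier_mat n n \<and>
     (\<forall>i<n. \<forall>j<n. \<forall>i'<n. \<forall>j'<n.
        (int i - int j) mod int n = (int i' - int j') mod int n \<longrightarrow> A $$ (i, j) = A $$ (i', j'))"

definition zero_one_circulant :: "nat \<Rightarrow> 'a::zero_neq_one mat \<Rightarrow> bool" where
  "zero_one_circulant n A \<longleftrightarrow> circulant n A \<and> elements_mat A \<subseteq> {0, 1}"

text \<open>The residues modulo \<open>n\<close> are represented by the naturals below \<open>n\<close>.\<close>

definition circulant_support :: "'a::one mat \<Rightarrow> nat set" where
  "circulant_support A = {j. j < dim_col A \<and> A $$ (0, j) = 1}"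

text \<open>The weight is read off the top row; by \<open>card_row_circulant\<close> below, every row of a
  circulant gives the same number.\<close>

definition circulant_weight :: "'a::one mat \<Rightarrow> nat" where
  "circulant_weight A = card {j. j < dim_col A \<and> A $$ (0, j) = 1}"

definition permutation_mat :: "nat \<Rightarrow> 'a::zero_neq_one mat \<Rightarrow> bool" where
  "permutation_mat n P \<longleftrightarrow>
     (\<exists>p. p permutes {..<n} \<and> P = mat n n (\<lambda>(i, j). if j = p i then 1 else 0))"

definition affine_image :: "nat \<Rightarrow> nat \<Rightarrow> nat \<Rightarrow> nat set \<Rightarrow> nat set" where
  "affine_image n u v S = (\<lambda>s. (u * s + v) mod n) ` S"

lemma circulant_entry:
  assumes "circulant n A" "i < n" "j < n"
  shows "A $$ (i, j) = A $$ (0, nat ((int j - int i) mod int n))"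
proof -
  let ?k = "nat ((int j - int i) mod int n)"
  have n: "0 < n" using assms by simp
  then have k: "int ?k = (int j - int i) mod int n" by simp
  then have "?k < n" using n by (metis of_nat_0_less_iff of_nat_less_iff pos_mod_bound)
  moreover have "(int i - int j) mod int n = (int 0 - int ?k) mod int n"
    unfolding k by (simp add: mod_minus_eq)
  ultimately show ?thesis using assms n unfolding circulant_def by blast
qed

lemma circulant_entry_eq_1_iff:
  assumes "circulant n A" "i < n" "j < n"
  shows "A $$ (i, j) = 1 \<longleftrightarrow> nat ((int j - int i) mod int n) \<in> circulant_support A"
proof -
  have "nat ((int j - int i) mod int n) < dim_col A"
    using assms by (auto simp: circulant_def nat_less_iff)
  then show ?thesis
    using circulant_entry[OF assms] by (simp add: circulant_support_def)
qed

lemma card_row_circulant: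
  assumes "circulant n A" "i < n"
  shows "card {j. j < n \<and> A $$ (i, j) = 1} = circulant_weight A"
proof -
  have dim: "dim_col A = n" using assms(1) by (auto simp: circulant_def)
  have n: "0 < n" using assms by simp
  let ?f = "\<lambda>j. nat ((int j - int i) mod int n)"
  let ?g = "\<lambda>k. nat ((int k + int i) mod int n)"
  have lt: "?f j < n" "?g j < n" for j using n by (auto simp: nat_less_iff)
  have fg: "?f (?g k) = k" "?g (?f k) = k" if "k < n" for k
    using that n by (auto simp: mod_simps)
  have "bij_betw ?f {j. j < n \<and> A $$ (i, j) = 1} {j. j < dim_col A \<and> A $$ (0, j) = 1}"
  proof (rule bij_betw_byWitness[where f' = ?g])
    show "?f ` {j. j < n \<and> A $$ (i, j) = 1} \<subseteq> {j. j < dim_col A \<and> A $$ (0, j) = 1}"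
      using lt circulant_entry[OF assms] dim by auto
    show "?g ` {j. j < dim_col A \<and> A $$ (0, j) = 1} \<subseteq> {j. j < n \<and> A $$ (i, j) = 1}"
    proof safe
      fix k assume "k < dim_col A" "A $$ (0, k) = 1"
      then show "A $$ (i, ?g k) = 1" "?g k < n"
        using circulant_entry[OF assms lt(2)[of k]] fg(1)[of k] lt(2)[of k] dim by simp_all
    qed
  qed (use fg dim in auto)
  then show ?thesis unfolding circulant_weight_def by (rule bij_betw_same_card)
qed

end

(*
  The only hard implication is that similarity of A A^T and B B^T gives an affine equivalence. The
  eigenvalues of A A^T are the |f(z)|^2, where z runs through the n-th roots of unity and f is the
  polynomial with exponent set S_A. For weight three,
  |f(z)|^2 = 3 + x1 + x2 + x3 + 1/x1 + 1/x2 + 1/x3, where the x_i are the quotients of the three powers of z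
  occurring in f(z), so x1 x2 x3 = 1.

  After dividing out the multiplicity of the eigenvalue 9 the x_i belonging to a primitive z generate all
  m-th roots of unity. The corresponding eigenvalue of A A^T is an eigenvalue of B B^T, which gives one
  vanishing sum of twelve roots of unity, and it suffices to show that it is trivial. It becomes trivial as
  soon as x_i = y_j or x_i = 1/y_j for some i and j, unless x_i = -1, because x1 + x2 + 1/x1 + 1/x2 =
  (1 + x3)(x1 + x2). To find a common term, let a prime p divide m and apply the Galois automorphisms
  fixing the roots of unity of order m/p: the terms split into p classes. If p^2 divides m then every class
  has sum zero, and if p divides m exactly once then, after removing the p-parts, all class sums are equal.
  This settles every m with a prime factor p > 7 or with p^2 dividing m. The prime 7 leaves one sporadic
  relation (at m = 42), which is excluded by exchanging A and B, and the exceptional triples (x_i = -1, or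
  x_i = -x_j when 4 divides m) are unique up to the choice of z and distinguished by the trace of a square.
  The remaining m divide 30 and are separated by a single power trace.
*)
theory Submission
  imports Defs "Jordan_Normal_Form.Char_Poly" "HOL-Number_Theory.Number_Theory"
begin

section \<open>Conjugation of relations between roots of unity\<close>


text \<open>Equality of spectra only matches \<open>alpha\<close> of a generating triple x with
  \<open>alpha\<close> of some power \<open>y ^ l\<close>, and nothing is known about l. So every
  relation is analysed with x generating and \<open>y ^ l\<close> arbitrary, it is used in both
  directions, and the unit exponent is recovered at the end from the fact that x generates. The
  Galois conjugations are obtained without irreducibility of cyclotomic polynomials: a Frobenius
  congruence carries a vanishing integer relation from w to \<open>w ^ q\<close> for large primes q,
  and every unit class modulo n contains a product of large primes. The threshold 7 is a count of
  classes: two triples meet at most nine classes once one of them meets the class 1, so for p at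
  least 11 some class is empty and the common class sum is 0. Without a square factor the primes 2,
  3 and 5 have too few classes for such arguments, which leaves the divisors of 30. For these the
  trace of the tenth power of the Gram matrix minus 3, taken at level 30, is a complete invariant of
  triples that avoid 1.\<close>

lemma monic_int_poly_nonzero_const:
  fixes x :: complex and p :: "int poly"
  assumes "lead_coeff p = 1" "poly (of_int_poly p) x = 0" "x \<noteq> 0"
  obtains q where "lead_coeff q = 1" "poly (of_int_poly q) x = 0" "Polynomial.coeff q 0 \<noteq> 0"
  using assms
proof (induction p arbitrary: thesis)
  case 0 then show ?case by simp
next
  case (pCons a p)
  show ?case
  proof (cases "a = 0")
    case True
    then have "p \<noteq> 0" using pCons.prems(2) by auto
    then show ?thesis using pCons True by (auto simp: of_int_hom.map_poly_pCons_hom)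
  next
    case False
    then show ?thesis using pCons.prems by (metis coeff_pCons_0)
  qed
qed

text \<open>Horner evaluation: multiplying by w moves every coefficient one place up and, by
  \<open>w ^ n = 1\<close>, the last one back to the constant term.\<close>

lemma reduce_exponents:
  fixes w :: complex and p :: "int poly"
  assumes "w ^ n = 1" "n > 0"
  obtains a where "poly (of_int_poly p) w = (\<Sum>r<n. of_int (a r) * w ^ r)"
proof -
  have "\<exists>a. poly (of_int_poly p) w = (\<Sum>r<n. of_int (a r) * w ^ r)"
  proof (induction p)
    case 0
    show ?case by (rule exI[of _ "\<lambda>_. 0"]) simp
  next
    case (pCons c p)
    then obtain a where a: "poly (of_int_poly p) w = (\<Sum>r<n. of_int (a r) * w ^ r)" by blast
    obtain m where m: "n = Suc m" using assms(2) gr0_implies_Suc by blast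
    define b where "b r = (case r of 0 \<Rightarrow> c + a m | Suc r' \<Rightarrow> a r')" for r
    have "w * (\<Sum>r<n. of_int (a r) * w ^ r) = (\<Sum>r<m. of_int (a r) * w ^ Suc r) + of_int (a m) * w ^ n"
      by (simp add: m sum_distrib_left algebra_simps)
    then have "poly (of_int_poly (pCons c p)) w = of_int c + of_int (a m) + (\<Sum>r<m. of_int (a r) * w ^ Suc r)"
      using assms(1) a by (simp add: of_int_hom.map_poly_pCons_hom)
    also have "\<dots> = (\<Sum>r<n. of_int (b r) * w ^ r)"
      unfolding m sum.lessThan_Suc_shift by (simp add: b_def)
    finally show ?case by blast
  qed
  then show ?thesis using that by blast
qed

lemma int_matrix_eigenvalue:
  fixes b :: complex and M :: "int mat"
  assumes M: "M \<in> carrier_mat n n" and v: "v \<in> carrier_vec n" "v \<noteq> 0\<^sub>v n"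
    and eq: "map_mat of_int M *\<^sub>v v = b \<cdot>\<^sub>v v"
  shows "\<exists>q :: int poly. lead_coeff q = 1 \<and> poly (of_int_poly q) b = 0"
proof -
  have "eigenvalue (map_mat of_int M :: complex mat) b"
    using assms unfolding eigenvalue_def eigenvector_def by auto
  then have "poly (char_poly (map_mat of_int M :: complex mat)) b = 0"
    using eigenvalue_root_char_poly M by (metis map_carrier_mat)
  moreover have "char_poly (map_mat of_int M :: complex mat) = of_int_poly (char_poly M)"
    using of_int_hom.char_poly_hom[OF M] by simp
  moreover have "lead_coeff (char_poly M) = 1"
    using degree_monic_char_poly[OF M] by auto
  ultimately show ?thesis by auto
qed

text \<open>Integrality of p(w) from an explicit integer matrix: after reduction of the exponents,
  the circulant built from the coefficients has the vector of powers of w as eigenvector with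
  eigenvalue p(w), which is therefore a root of a monic characteristic polynomial.\<close>

lemma root_unity_poly_monic:
  fixes w :: complex
  assumes w: "w ^ n = 1" and n: "n > 0"
  shows "\<exists>q :: int poly. lead_coeff q = 1 \<and> poly (of_int_poly q) (poly (of_int_poly p) w) = 0"
proof -
  obtain a where a: "poly (of_int_poly p) w = (\<Sum>r<n. of_int (a r) * w ^ r)"
    using reduce_exponents[OF assms] by blast
  let ?b = "poly (of_int_poly p) w"
  define M :: "int mat" where "M = mat n n (\<lambda>(i,j). a ((j + n - i) mod n))"
  define v where "v = vec n (\<lambda>i. w ^ i)"
  have w0: "w \<noteq> 0" using w n by (metis power_0_left not_gr_zero zero_neq_one)
  have wm: "w ^ (k mod n) = w ^ k" for k
    by (metis div_mult_mod_eq mult.commute mult_1 power_add power_mult power_one w)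
  have "map_mat of_int M *\<^sub>v v = ?b \<cdot>\<^sub>v v"
  proof (rule eq_vecI)
    fix i assume "i < dim_vec (?b \<cdot>\<^sub>v v)"
    then have i: "i < n" by (simp add: v_def)
    have "(map_mat of_int M *\<^sub>v v) $ i = (\<Sum>j<n. of_int (a ((j + n - i) mod n)) * w ^ j)"
      using i by (simp add: M_def v_def scalar_prod_def lessThan_atLeast0)
    also have "\<dots> = (\<Sum>r<n. of_int (a r) * w ^ ((r + i) mod n))"
    proof (rule sum.reindex_bij_witness[of _ "\<lambda>r. (r + i) mod n" "\<lambda>j. (j + n - i) mod n"])
      fix j assume j: "j \<in> {..<n}"
      have *: "((j + n - i) mod n + i) mod n = j"
        using i j by (simp add: mod_simps)
      show "((j + n - i) mod n + i) mod n = j" by (rule *)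
      show "of_int (a ((j + n - i) mod n)) * w ^ (((j + n - i) mod n + i) mod n)
          = of_int (a ((j + n - i) mod n)) * w ^ j" unfolding * ..
    next
      fix r assume r: "r \<in> {..<n}"
      have "((r + i) mod n + n - i) mod n = ((r + i) mod n + (n - i)) mod n" using i by simp
      also have "\<dots> = (r + i + (n - i)) mod n" by (simp add: mod_simps)
      also have "\<dots> = r" using i r by simp
      finally show "((r + i) mod n + n - i) mod n = r" .
    qed (use n in auto)
    also have "\<dots> = (\<Sum>r<n. of_int (a r) * w ^ r) * w ^ i"
      by (simp add: wm power_add sum_distrib_right mult.assoc)
    finally show "(map_mat of_int M *\<^sub>v v) $ i = (?b \<cdot>\<^sub>v v) $ i"
      using i a by (simp add: v_def)
  qed (simp add: M_def v_def)
  moreover have "v \<noteq> 0\<^sub>v n"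
    using n w0 by (metis index_vec index_zero_vec(1) power_not_zero v_def)
  ultimately show ?thesis
    by (intro int_matrix_eigenvalue[of M n v]) (auto simp: M_def v_def)
qed

text \<open>If x = p(w) is nonzero, it satisfies an integer equation with constant term N other than
  0, so N is x times an integer polynomial in w. When q divides x, the quotient N / q is both
  rational and an algebraic integer, hence an integer. So N bounds the integers that divide x in
  Z[w].\<close>

lemma root_unity_poly_bound:
  fixes w :: complex
  assumes w: "w ^ n = 1" and n: "n > 0" and nz: "poly (of_int_poly p) w \<noteq> 0"
  obtains N :: int where "N \<noteq> 0"
    "\<And>(q :: int) b. q > 0 \<Longrightarrow> poly (of_int_poly p) w = of_int q * poly (of_int_poly b) w \<Longrightarrow> q dvd N"
proof -
  obtain f :: "int poly" where f: "lead_coeff f = 1" "poly (of_int_poly f) (poly (of_int_poly p) w) = 0"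
    using root_unity_poly_monic[OF w n] by blast
  then obtain g :: "int poly" where g: "poly (of_int_poly g) (poly (of_int_poly p) w) = 0" "Polynomial.coeff g 0 \<noteq> 0"
    using monic_int_poly_nonzero_const nz by metis
  obtain N h where gh: "g = pCons N h" by (cases g)
  define h' where "h' = - (pcompose h p)"
  have ev: "poly (of_int_poly (pcompose h p)) w = poly (of_int_poly h) (poly (of_int_poly p) w)"
    by (simp add: of_int_hom.map_poly_pcompose poly_pcompose)
  have prod: "poly (of_int_poly p) w * poly (of_int_poly h') w = of_int N"
    using g(1) unfolding gh h'_def
    by (simp add: of_int_hom.map_poly_pCons_hom ev hom_distribs algebra_simps add_eq_0_iff poly_pcompose of_int_hom.map_poly_pcompose)
  show ?thesis
  proof (rule that)
    show "N \<noteq> 0" using g(2) gh by simp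
    fix q :: int and b
    assume q: "q > 0" and eq: "poly (of_int_poly p) w = of_int q * poly (of_int_poly b) w"
    have "of_int N = of_int q * poly (of_int_poly (b * h')) w"
      using prod eq by (simp add: hom_distribs algebra_simps)
    then have val: "poly (of_int_poly (b * h')) w = of_int N / of_int q" using q by (simp add: field_simps)
    obtain f :: "int poly" where f: "lead_coeff f = 1" "poly (of_int_poly f) (poly (of_int_poly (b * h')) w) = 0"
      using root_unity_poly_monic[OF w n] by blast
    have "algebraic_int (poly (of_int_poly (b * h')) w :: complex)"
      using f unfolding algebraic_int_altdef_ipoly by blast
    moreover have "poly (of_int_poly (b * h')) w \<in> (\<rat> :: complex set)" unfolding val by simp
    ultimately have "(of_int N / of_int q :: complex) \<in> \<int>"
      using rational_algebraic_int_is_int val by metis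
    then obtain k where "(of_int N / of_int q :: complex) = of_int k" by (auto elim: Ints_cases)
    then have "of_int N = (of_int (k * q) :: complex)" using q by (simp add: field_simps)
    then have "N = k * q" using of_int_eq_iff by blast
    then show "q dvd N" by simp
  qed
qed

section \<open>The Frobenius congruence and unit classes without small primes\<close>

lemma prime_dvd_power_add_diff:
  fixes x y :: "int poly"
  assumes "prime q"
  shows "[:int q:] dvd (x + y) ^ q - x ^ q - y ^ q"
proof -
  have q: "q \<ge> 1" using assms prime_ge_1_nat by blast
  have "(x + y) ^ q = (\<Sum>k\<le>q. of_nat (q choose k) * x ^ k * y ^ (q - k))"
    by (rule binomial_ring)
  also have "{..q} = insert 0 (insert q {1..<q})" using q by auto
  also have "(\<Sum>k\<in>\<dots>. of_nat (q choose k) * x ^ k * y ^ (q - k)) =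
     y ^ q + x ^ q + (\<Sum>k\<in>{1..<q}. of_nat (q choose k) * x ^ k * y ^ (q - k))"
    using q by simp
  finally have "(x + y) ^ q - x ^ q - y ^ q = (\<Sum>k\<in>{1..<q}. of_nat (q choose k) * x ^ k * y ^ (q - k))"
    by simp
  moreover have "[:int q:] dvd of_nat (q choose k) * x ^ k * y ^ (q - k)" if "k \<in> {1..<q}" for k
  proof -
    have "q dvd (q choose k)" using assms that by (intro dvd_choose_prime) auto
    then obtain c where "q choose k = q * c" by blast
    then have "(of_nat (q choose k) :: int poly) = [:int q:] * of_nat c"
      by (simp add: of_nat_poly)
    then show ?thesis by (metis dvd_mult2 dvd_triv_left)
  qed
  ultimately show ?thesis by (metis (no_types, lifting) dvd_sum)
qed

lemma int_prime_dvd_power_diff: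
  fixes a :: int
  assumes "prime q"
  shows "int q dvd a - a ^ q"
proof -
  have "[nat (a mod int q) ^ q = nat (a mod int q)] (mod q)"
  proof (cases "q dvd nat (a mod int q)")
    case True
    then show ?thesis using assms prime_gt_0_nat[OF assms]
      by (metis cong_0_iff cong_def dvd_power dvd_trans)
  next
    case False
    from fermat_theorem[OF assms False] have "[nat (a mod int q) ^ (q - 1) * nat (a mod int q) = 1 * nat (a mod int q)] (mod q)"
      by (rule cong_scalar_right)
    then show ?thesis using prime_gt_0_nat[OF assms]
      by (metis mult.commute mult_1 power_eq_if not_gr_zero)
  qed
  then have "[int (nat (a mod int q) ^ q) = int (nat (a mod int q))] (mod int q)"
    by (simp only: cong_int_iff)
  then have "[(a mod int q) ^ q = a mod int q] (mod int q)"
    using prime_gt_0_nat[OF assms] by simp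
  then have "[a ^ q = a] (mod int q)"
    by (simp add: cong_def mod_simps)
  then show ?thesis by (metis cong_iff_dvd_diff cong_sym)
qed

text \<open>Induction on the coefficients: \<open>pCons a p\<close> is a + X p, the binomial theorem
  splits its q-th power modulo q, and Fermat's little theorem handles a.\<close>

lemma int_poly_frobenius:
  fixes p :: "int poly"
  assumes "prime q"
  shows "[:int q:] dvd pcompose p (Polynomial.monom 1 q) - p ^ q"
proof (induction p)
  case 0
  then show ?case using prime_gt_0_nat[OF assms] by (simp add: power_0_left)
next
  case (pCons a p)
  let ?m = "Polynomial.monom 1 q :: int poly"
  have X: "[:0, 1:] ^ q = ?m" by (metis monom_altdef smult_1_left)
  have pc: "pCons a p = [:a:] + [:0, 1:] * p" by simp
  have "pcompose (pCons a p) ?m - pCons a p ^ q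
     = ([:a:] - [:a:] ^ q) + ?m * (pcompose p ?m - p ^ q)
       - ((pCons a p) ^ q - [:a:] ^ q - ([:0, 1:] * p) ^ q)"
    unfolding pcompose_pCons power_mult_distrib X by (simp add: algebra_simps)
  moreover have "[:int q:] dvd [:a:] - [:a:] ^ q"
    using int_prime_dvd_power_diff[OF assms, of a]
    by (simp add: poly_const_pow const_poly_dvd_const_poly_iff)
  moreover have "[:int q:] dvd ?m * (pcompose p ?m - p ^ q)" using pCons.IH by simp
  moreover have "[:int q:] dvd (pCons a p) ^ q - [:a:] ^ q - ([:0, 1:] * p) ^ q"
    unfolding pc by (rule prime_dvd_power_add_diff[OF assms])
  ultimately show ?case by (metis dvd_add dvd_diff)
qed

text \<open>A substitute for Dirichlet's theorem. Take t to be the product of the primes up to B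
  that do not divide c; then a prime up to B divides exactly one of c and n * t, and so not their
  sum.\<close>

lemma coprime_lift:
  fixes c n B :: nat
  assumes "coprime c n"
  obtains t where "\<And>r. prime r \<Longrightarrow> r dvd c + n * t \<Longrightarrow> r > B"
proof -
  define R where "R = {r. prime r \<and> r \<le> B \<and> \<not> r dvd c}"
  define t where "t = \<Prod>R"
  have fin: "finite R" unfolding R_def by simp
  show ?thesis
  proof (rule that[of t], rule ccontr)
    fix r assume r: "prime r" "r dvd c + n * t" "\<not> r > B"
    show False
    proof (cases "r dvd c")
      case True
      then have "r dvd n * t" using r(2) by (simp add: dvd_add_right_iff)
      moreover have "\<not> r dvd n" using True r(1) assms
        using coprime_common_divisor_nat not_prime_1 by blast
      ultimately have "r dvd t" using r(1) prime_dvd_mult_iff by blast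
      then obtain s where "s \<in> R" "r dvd s"
        unfolding t_def using prime_dvd_prod_iff[OF fin r(1), of "\<lambda>x. x"] by auto
      then show False using True r(1) primes_dvd_imp_eq unfolding R_def by blast
    next
      case False
      then have "r \<in> R" using r unfolding R_def by simp
      then have "r dvd t" unfolding t_def using fin dvd_prodI by blast
      then show False using r(2) False by (metis dvd_add_left_iff dvd_mult)
    qed
  qed
qed

text \<open>The conjugates of a fixed integer polynomial value are finitely many, so for a large prime \<open>q\<close> none of
  them other than 0 is divisible by \<open>q\<close>; hence the Frobenius congruence forces a zero at \<open>w ^ q\<close>, and \<open>c\<close> is
  congruent modulo \<open>n\<close> to a product of large primes.\<close>

lemma root_unity_conjugate:
  fixes w :: complex
  assumes w: "w ^ n = 1" and n: "n > 0" and c: "coprime c n"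
    and p: "poly (of_int_poly p) w = 0"
  shows "poly (of_int_poly p) (w ^ c) = 0"
proof -
  define P where "P k = poly (of_int_poly p) (w ^ k)" for k
  have wk: "(w ^ k) ^ n = 1" for k using w by (metis mult.commute power_mult power_one)
  have "\<exists>N::int. N \<noteq> 0 \<and> (P k \<noteq> 0 \<longrightarrow>
      (\<forall>q::int>0. \<forall>b. P k = of_int q * poly (of_int_poly b) (w ^ k) \<longrightarrow> q dvd N))" for k
  proof (cases "P k = 0")
    case True then show ?thesis by (intro exI[of _ 1]) auto
  next
    case False
    then show ?thesis using root_unity_poly_bound[OF wk n] unfolding P_def by metis
  qed
  then obtain N :: "nat \<Rightarrow> int" where N: "\<And>k. N k \<noteq> 0"
    "\<And>k (q::int) b. P k \<noteq> 0 \<Longrightarrow> q > 0 \<Longrightarrow> P k = of_int q * poly (of_int_poly b) (w ^ k) \<Longrightarrow> q dvd N k"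
    by metis
  \<comment> \<open>The summand n makes q invertible modulo n, and the sum exceeds every single
    bound, so that q divides none of the \<open>N j\<close> with j < n.\<close>
  define B where "B = n + nat (\<Sum>k<n. \<bar>N k\<bar>)"
  have wmod: "w ^ (k mod n) = w ^ k" for k
    by (metis div_mult_mod_eq mult.commute mult_1 power_add power_mult power_one w)
  have step: "P (k * q) = 0" if q: "prime q" "q > B" and k: "P k = 0" for k q
  proof (rule ccontr)
    assume nz: "P (k * q) \<noteq> 0"
    \<comment> \<open>The exponent is reduced because only the bounds \<open>N k\<close> with k < n
      enter B.\<close>
    define j where "j = (k * q) mod n"
    have Pj: "P j = P (k * q)" unfolding P_def j_def wmod ..
    obtain r where r: "pcompose p (Polynomial.monom 1 q) - p ^ q = [:int q:] * r"
      using int_poly_frobenius[OF q(1), of p] by (elim dvdE)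
    define r' where "r' = pcompose r (Polynomial.monom 1 1)"
    have "poly (of_int_poly (pcompose p (Polynomial.monom 1 q))) (w ^ k) = P (k * q)"
      unfolding P_def by (simp add: of_int_hom.map_poly_pcompose poly_pcompose poly_monom power_mult)
    moreover have "poly (of_int_poly (p ^ q)) (w ^ k) = 0"
      using k prime_gt_0_nat[OF q(1)] unfolding P_def by (simp add: hom_distribs power_0_left)
    ultimately have Pq: "P (k * q) = of_int (int q) * poly (of_int_poly r) (w ^ k)"
      using arg_cong[OF r, of "\<lambda>f. poly (of_int_poly f) (w ^ k)"]
      using k prime_gt_0_nat[OF q(1)] by (simp add: hom_distribs power_0_left)
    \<comment> \<open>The quotient r is evaluated at \<open>w ^ k\<close>, whereas the bound
      \<open>N j\<close> speaks of integer polynomials in \<open>w ^ j\<close>. As q is invertible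
      modulo n, the former is a power of the latter.\<close>
    obtain i where i: "w ^ k = (w ^ j) ^ i"
    proof -
      have "q > n" using q(2) unfolding B_def by simp
      then have "\<not> q dvd n" using n dvd_imp_le leD by blast
      then have "coprime q n" using q(1) prime_imp_coprime by blast
      then obtain q' where q': "[q * q' = 1] (mod n)" using cong_solve_coprime_nat by auto
      then have "[k * q * q' = k] (mod n)"
        using cong_scalar_left[OF q', of k] by (simp add: mult.assoc)
      then have "w ^ (k * q * q') = w ^ k" by (metis cong_def wmod)
      then have "w ^ k = (w ^ j) ^ q'" unfolding j_def wmod by (simp add: power_mult)
      then show ?thesis by (rule that)
    qed
    have "P j = of_int (int q) * poly (of_int_poly (pcompose r (Polynomial.monom 1 i))) (w ^ j)"
      unfolding Pj Pq by (simp add: of_int_hom.map_poly_pcompose poly_pcompose poly_monom i)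
    then have "int q dvd N j" using N(2)[of j "int q"] nz Pj prime_gt_0_nat[OF q(1)] by auto
    then have "int q \<le> \<bar>N j\<bar>" using N(1) by (simp add: zdvd_imp_le)
    also have "\<dots> \<le> (\<Sum>k<n. \<bar>N k\<bar>)"
      using n unfolding j_def by (intro member_le_sum) auto
    finally show False using q(2) unfolding B_def by linarith
  qed
  obtain t where t: "\<And>r. prime r \<Longrightarrow> r dvd c + n * t \<Longrightarrow> r > B"
    using coprime_lift[OF c, of B] by blast
  have all: "P (k * d) = 0" if "P k = 0" "d > 0" "\<And>r. prime r \<Longrightarrow> r dvd d \<Longrightarrow> r > B" for k d
    using that
  proof (induction d arbitrary: k rule: prime_divisors_induct)
    case (factor q d)
    then have "P (k * q) = 0" using step by auto
    then have "P (k * q * d) = 0" using factor by auto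
    then show ?case by (simp add: mult.assoc)
  qed (auto simp: )
  show ?thesis
  proof (cases "c + n * t = 0")
    \<comment> \<open>Then c = 0, and coprimality with n leaves n = 1 and w = 1.\<close>
    case True
    then show ?thesis using n c p w by auto
  next
    case False
    have "P (1 * (c + n * t)) = 0"
      by (rule all) (use p False t in \<open>auto simp: P_def\<close>)
    then show ?thesis unfolding P_def
      using w by (simp add: power_add power_mult)
  qed
qed


section \<open>Relations as lists of terms, and their class sums\<close>

lemma root_unity_generator:
  assumes "n > 0" "z ^ n = (1 :: complex)"
  obtains k where "z = cis (2 * pi / real n) ^ k" "k < n"
proof -
  have "z \<in> (\<lambda>k. cis (2 * pi * real k / real n)) ` {..<n}"
    using bij_betw_roots_unity[OF assms(1)] assms(2) unfolding bij_betw_def by auto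
  then obtain k where "k < n" "z = cis (2 * pi * real k / real n)" by auto
  moreover have "cis (2 * pi * real k / real n) = cis (2 * pi / real n) ^ k"
    by (simp add: DeMoivre mult.commute)
  ultimately show ?thesis using that by auto
qed

lemma cis_power_eq_1_iff:
  assumes "n > 0"
  shows "cis (2 * pi / real n) ^ k = 1 \<longleftrightarrow> n dvd k"
proof -
  have *: "cis (2 * pi / real n) ^ n = 1" using assms by (simp add: DeMoivre)
  have "cis (2 * pi / real n) ^ k = cis (2 * pi / real n) ^ (k mod n)"
    by (metis * div_mult_mod_eq mult.commute mult_1 power_add power_mult power_one)
  moreover have "cis (2 * pi / real n) ^ j = 1 \<longleftrightarrow> j = 0" if "j < n" for j
  proof -
    have inj: "inj_on (\<lambda>k. cis (2 * pi * real k / real n)) {..<n}"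
      using bij_betw_roots_unity[OF assms] unfolding bij_betw_def by blast
    have e: "cis (2 * pi / real n) ^ j = cis (2 * pi * real j / real n)" for j
      by (simp add: DeMoivre mult.commute)
    show ?thesis unfolding e using inj_onD[OF inj, of j 0] that assms by auto
  qed
  ultimately show ?thesis using assms by (simp add: dvd_eq_mod_eq_0)
qed

text \<open>All terms are powers of one root w, so the list is the value at w of a single integer
  polynomial, whose value at \<open>w ^ t\<close> is the list with every term raised to t.\<close>

lemma root_unity_relation_conjugate:
  fixes L :: "(int \<times> complex) list"
  assumes n: "n > 0" and L: "\<And>a z. (a, z) \<in> set L \<Longrightarrow> z ^ n = 1" and c: "coprime c n"
    and eq: "(\<Sum>(a,z)\<leftarrow>L. of_int a * z) = 0"
  shows "(\<Sum>(a,z)\<leftarrow>L. of_int a * z ^ c) = 0"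
proof -
  define w where "w = cis (2 * pi / real n)"
  have w: "w ^ n = 1" using n by (simp add: cis_power_eq_1_iff w_def)
  have "\<exists>p :: int poly. \<forall>t. poly (of_int_poly p) (w ^ t) = (\<Sum>(a,z)\<leftarrow>L. of_int a * z ^ t)"
    using L
  proof (induction L)
    case Nil
    show ?case by (rule exI[of _ 0]) simp
  next
    case (Cons az L)
    obtain a z where az: "az = (a, z)" by (cases az)
    have "\<exists>p :: int poly. \<forall>t. poly (of_int_poly p) (w ^ t) = (\<Sum>(a,z)\<leftarrow>L. of_int a * z ^ t)"
      by (rule Cons.IH) (use Cons.prems in auto)
    then obtain p :: "int poly" where p: "\<And>t. poly (of_int_poly p) (w ^ t) = (\<Sum>(a,z)\<leftarrow>L. of_int a * z ^ t)"
      by blast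
    have "z ^ n = 1" using Cons.prems az by auto
    then obtain k where k: "z = w ^ k" using root_unity_generator[OF n] unfolding w_def by metis
    have "poly (of_int_poly (p + Polynomial.monom a k)) (w ^ t) = (\<Sum>(a,z)\<leftarrow>az # L. of_int a * z ^ t)" for t
      by (simp add: az p hom_distribs poly_monom k power_mult[symmetric] mult.commute)
    then show ?case by blast
  qed
  then obtain p :: "int poly" where p: "\<And>t. poly (of_int_poly p) (w ^ t) = (\<Sum>(a,z)\<leftarrow>L. of_int a * z ^ t)"
    by blast
  have "poly (of_int_poly p) w = 0" using p[of 1] eq by simp
  from root_unity_conjugate[OF w n c this] show ?thesis using p by simp
qed

lemma sum_root_unity_powers:
  fixes z :: complex
  assumes "z ^ p = 1"
  shows "(\<Sum>t<p. z ^ t) = (if z = 1 then of_nat p else 0)"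
proof (cases "z = 1")
  case False
  then show ?thesis using assms by (simp add: geometric_sum)
qed simp

text \<open>Discrete Fourier inversion on the p-th roots of unity: weighting the twisted sums with
  powers of 1/\<eta> keeps exactly the terms with \<open>g x\<close> equal to \<eta>.\<close>

lemma sum_list_fourier:
  fixes L :: "('b \<times> complex) list" and f g :: "'b \<times> complex \<Rightarrow> complex"
  assumes p: "p > 0" and g: "\<And>x. x \<in> set L \<Longrightarrow> g x ^ p = 1" and eta: "\<eta> ^ p = 1"
  shows "of_nat p * (\<Sum>x\<leftarrow>L. if g x = \<eta> then f x else 0)
    = (\<Sum>t<p. inverse \<eta> ^ t * (\<Sum>x\<leftarrow>L. f x * g x ^ t))"
proof -
  have e0: "\<eta> \<noteq> 0" using eta p by (metis power_0_left not_gr_zero zero_neq_one)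
  show ?thesis using g
  proof (induction L)
    case Nil
    then show ?case by simp
  next
    case (Cons x L)
    have "(inverse \<eta> * g x) ^ p = 1" using Cons.prems eta by (simp add: power_mult_distrib power_inverse)
    note sum_root_unity_powers[OF this]
    moreover have "inverse \<eta> * g x = 1 \<longleftrightarrow> g x = \<eta>" using e0 by (auto simp: field_simps)
    moreover have "(\<Sum>t<p. inverse \<eta> ^ t * (f x * g x ^ t)) = f x * (\<Sum>t<p. (inverse \<eta> * g x) ^ t)"
      by (simp only: sum_distrib_left power_mult_distrib mult_ac)
    ultimately have "(\<Sum>t<p. inverse \<eta> ^ t * (f x * g x ^ t)) = f x * (if g x = \<eta> then of_nat p else 0)"
      by simp
    then show ?case using Cons by (simp add: algebra_simps sum.distrib split: if_splits)
  qed
qed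

text \<open>With N = n / p, raising a term to the power 1 + t N multiplies it by
  \<open>(z ^ N) ^ t\<close>. Every prime divisor of n divides N, since p does, so all these
  exponents are units modulo n and all p twisted sums vanish.\<close>

lemma class_sum_square:
  fixes L :: "(int \<times> complex) list"
  assumes p: "prime p" "p ^ 2 dvd n" and n: "n > 0"
    and L: "\<And>a z. (a, z) \<in> set L \<Longrightarrow> z ^ n = 1"
    and eq: "(\<Sum>(a,z)\<leftarrow>L. of_int a * z) = 0"
  shows "(\<Sum>(a,z)\<leftarrow>L. if z ^ (n div p) = \<eta> then of_int a * z else 0) = 0"
proof (cases "\<eta> ^ p = 1")
  case eta: True
  obtain N where N: "n = p * N" "p dvd N" using p(2) n
    by (metis dvd_def mult.assoc power2_eq_square dvd_triv_left)
  have p0: "p > 0" using p(1) prime_gt_0_nat by blast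
  have np: "n div p = N" using N p0 by simp
  have *: "(\<Sum>(a,z)\<leftarrow>L. of_int a * z * (z ^ N) ^ t) = 0" for t
  proof -
    have "coprime (1 + t * N) n"
    proof (rule ccontr)
      assume "\<not> coprime (1 + t * N) n"
      then have "gcd (1 + t * N) n \<noteq> 1" using coprime_iff_gcd_eq_1 by blast
      from prime_factor_nat[OF this] obtain q where q: "prime q" "q dvd gcd (1 + t * N) n" by blast
      from q(2) have q2: "q dvd 1 + t * N" "q dvd n" by (simp_all only: gcd_greatest_iff)
      from q2(2) have "q dvd p \<or> q dvd N" unfolding N(1) using q(1) prime_dvd_mult_iff by blast
      then have "q dvd N" using N(2) by auto
      then have "q dvd 1" using q2(1) by (metis dvd_add_left_iff dvd_mult)
      then show False using q(1) by simp
    qed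
    from root_unity_relation_conjugate[OF n L this eq]
    show ?thesis by (simp add: power_add power_mult[symmetric] mult.assoc mult.commute[of N])
  qed
  have "of_nat p * (\<Sum>x\<leftarrow>L. if (case x of (a,z) \<Rightarrow> z ^ N) = \<eta> then (case x of (a,z) \<Rightarrow> of_int a * z) else 0)
    = (\<Sum>t<p. inverse \<eta> ^ t * (\<Sum>x\<leftarrow>L. (case x of (a,z) \<Rightarrow> of_int a * z) * (case x of (a,z) \<Rightarrow> z ^ N) ^ t))"
    using L N by (intro sum_list_fourier[OF p0 _ eta]) (auto simp: power_mult[symmetric] mult.commute)
  also have "\<dots> = 0" using * by (simp add: case_prod_unfold)
  finally show ?thesis using p0 np by (simp add: case_prod_unfold cong: if_cong)
next
  case False
  have "z ^ (n div p) \<noteq> \<eta>" if "(a, z) \<in> set L" for a z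
  proof -
    have "p dvd n" using p(2) dvd_trans[of p "p ^ 2" n] by simp
    then have "(z ^ (n div p)) ^ p = z ^ n" by (simp add: power_mult[symmetric])
    then show ?thesis using L[OF that] False by auto
  qed
  then have "map (\<lambda>(a,z). if z ^ (n div p) = \<eta> then of_int a * z else 0) L = map (\<lambda>_. 0) L"
    by auto
  then show ?thesis by (simp only: sum_list_0)
qed


text \<open>The exponent s is the idempotent that is 1 modulo p and 0 modulo N, so
  \<open>z ^ s\<close> is the p-part of z. For t from 1 to p - 1 the exponent 1 + (t - 1) s is t
  modulo p and 1 modulo N, hence a unit, and conjugation kills that Fourier coefficient. Only the
  coefficient at t = 0 survives, which makes the class sums independent of \<eta>.\<close>

lemma class_sum_coprime:
  fixes L :: "(int \<times> complex) list"
  assumes p: "prime p" and n: "n = p * N" "N > 0" and s: "[s = 1] (mod p)" "N dvd s"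
    and L: "\<And>a z. (a, z) \<in> set L \<Longrightarrow> z ^ n = 1"
    and eq: "(\<Sum>(a,z)\<leftarrow>L. of_int a * z) = 0"
  obtains c where "\<And>\<eta>. \<eta> ^ p = 1 \<Longrightarrow>
     (\<Sum>(a,z)\<leftarrow>L. if z ^ s = \<eta> then of_int a * (z * inverse (z ^ s)) else 0) = c"
proof -
  have p0: "p > 0" using p prime_gt_0_nat by blast
  then have n0: "n > 0" using n by simp
  have s0: "s > 0"
  proof (rule ccontr)
    assume "\<not> s > 0"
    then show False using s(1) p by (simp add: cong_0_1_nat' prime_gt_Suc_0_nat cong_sym_eq)
  qed
  define f :: "int \<times> complex \<Rightarrow> complex" where "f = (\<lambda>(a,z). of_int a * (z * inverse (z ^ s)))"
  define g :: "int \<times> complex \<Rightarrow> complex" where "g = (\<lambda>(a,z). z ^ s)"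
  have gp: "g x ^ p = 1" if "x \<in> set L" for x
  proof -
    obtain a z where x: "x = (a, z)" by (cases x)
    obtain k where "s * p = n * k" using s(2) n(1) by (auto simp: dvd_def)
    then show ?thesis using L[of a z] that x by (simp add: g_def power_mult[symmetric]) (simp add: power_mult)
  qed
  have zero: "(\<Sum>x\<leftarrow>L. f x * g x ^ t) = 0" if t: "t \<in> {1..<p}" for t
  proof -
    have "coprime (1 + (t - 1) * s) n"
    proof -
      have "[1 + (t - 1) * s = 1 + (t - 1) * 1] (mod p)"
        by (intro cong_add cong_mult s cong_refl)
      then have "[1 + (t - 1) * s = t] (mod p)" using t by simp
      have "\<not> p dvd t" using t by (auto dest: dvd_imp_le)
      then have "coprime t p" using prime_imp_coprime[OF p] coprime_commute by blast
      then have "coprime (1 + (t - 1) * s) p"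
        using cong_imp_coprime[OF cong_sym[OF \<open>[1 + (t - 1) * s = t] (mod p)\<close>]] by blast
      moreover have "coprime (1 + (t - 1) * s) N"
      proof -
        have "[1 + (t - 1) * s = 1 + 0] (mod N)"
          by (intro cong_add cong_refl) (use s(2) in \<open>simp add: cong_0_iff\<close>)
        from cong_imp_coprime[OF cong_sym[OF this]] show ?thesis by simp
      qed
      ultimately show ?thesis unfolding n(1) by simp
    qed
    from root_unity_relation_conjugate[OF n0 L this eq]
    have "(\<Sum>(a,z)\<leftarrow>L. of_int a * z ^ (1 + (t - 1) * s)) = 0" .
    moreover have "map (\<lambda>x. f x * g x ^ t) L = map (\<lambda>(a,z). of_int a * z ^ (1 + (t - 1) * s)) L"
    proof (rule map_cong[OF refl])
      fix x assume x: "x \<in> set L"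
      obtain a z where xa: "x = (a, z)" by (cases x)
      have "z ^ n = 1" using L x xa by auto
      then have z: "z \<noteq> 0" using n0 by (metis power_0_left not_gr_zero zero_neq_one)
      obtain r where r: "t = Suc r" using t by (cases t) auto
      show "f x * g x ^ t = (case x of (a, z) \<Rightarrow> of_int a * z ^ (1 + (t - 1) * s))"
        using z by (simp add: xa f_def g_def r power_add power_mult mult.commute[of _ s])
    qed
    ultimately show ?thesis by (simp only:)
  qed
  show ?thesis
  proof (rule that[of "(\<Sum>x\<leftarrow>L. f x) / of_nat p"])
    fix \<eta> :: complex assume eta: "\<eta> ^ p = 1"
    have "of_nat p * (\<Sum>x\<leftarrow>L. if g x = \<eta> then f x else 0)
       = (\<Sum>t<p. inverse \<eta> ^ t * (\<Sum>x\<leftarrow>L. f x * g x ^ t))"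
      by (rule sum_list_fourier[OF p0 gp eta])
    also have "{..<p} = insert 0 {1..<p}" using p0 by auto
    also have "(\<Sum>t\<in>\<dots>. inverse \<eta> ^ t * (\<Sum>x\<leftarrow>L. f x * g x ^ t)) = (\<Sum>x\<leftarrow>L. f x)"
      using zero by simp
    finally have "(\<Sum>x\<leftarrow>L. if g x = \<eta> then f x else 0) = (\<Sum>x\<leftarrow>L. f x) / of_nat p"
      using p0 by (simp add: field_simps)
    then show "(\<Sum>(a,z)\<leftarrow>L. if z ^ s = \<eta> then of_int a * (z * inverse (z ^ s)) else 0)
        = (\<Sum>x\<leftarrow>L. f x) / of_nat p"
      by (simp add: f_def g_def case_prod_unfold cong: if_cong)
  qed
qed

section \<open>Relations between two triples of roots of unity, sorted into classes\<close>


definition common_root :: "complex \<Rightarrow> complex \<Rightarrow> complex \<Rightarrow> complex \<Rightarrow> complex \<Rightarrow> complex \<Rightarrow> bool" where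
  "common_root x1 x2 x3 y1 y2 y3 \<longleftrightarrow>
     {x1, x2, x3} \<inter> {y1, y2, y3, inverse y1, inverse y2, inverse y3} \<noteq> {}"

definition matching :: "complex \<Rightarrow> complex \<Rightarrow> complex \<Rightarrow> complex \<Rightarrow> complex \<Rightarrow> complex \<Rightarrow> bool" where
  "matching x1 x2 x3 y1 y2 y3 \<longleftrightarrow> {#x1, x2, x3#} = {#y1, y2, y3#} \<or>
     {#x1, x2, x3#} = {#inverse y1, inverse y2, inverse y3#}"

text \<open>For a circulant of weight 3 the eigenvalues of the Gram matrix are \<open>3 + alpha x1 x2 x3\<close>.\<close>

definition alpha :: "complex \<Rightarrow> complex \<Rightarrow> complex \<Rightarrow> complex" where
  "alpha x1 x2 x3 = x1 + x2 + x3 + inverse x1 + inverse x2 + inverse x3"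

lemma two_roots_eq:
  fixes a b c d :: complex
  assumes "a + b = c + d" "a * b = c * d"
  shows "{#a, b#} = {#c, d#}"
proof -
  have "(a - c) * (a - d) = 0"
  proof -
    have "(a - c) * (a - d) = a * a - a * (c + d) + c * d" by (simp add: algebra_simps)
    also have "\<dots> = 0" unfolding assms[symmetric] by (simp add: algebra_simps)
    finally show ?thesis .
  qed
  then have "a = c \<or> a = d" by simp
  then show ?thesis using assms(1) by (auto simp: add_mset_commute)
qed

text \<open>The factor 1 + x3 cancels, so the relation gives the sum x1 + x2; the product is the
  inverse of x3. Together they determine the pair as the roots of a quadratic.\<close>

lemma match_third:
  assumes x: "x1 * x2 * x3 = 1" and y: "y1 * y2 * y3 = 1"
    and al: "alpha x1 x2 x3 = alpha y1 y2 y3" and e: "x3 = y3" and ne: "x3 \<noteq> -1"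
  shows "{#x1, x2#} = {#y1, y2#}"
proof -
  have fac: "alpha z1 z2 z3 - z3 - inverse z3 = (1 + z3) * (z1 + z2)" if "z1 * z2 * z3 = 1" for z1 z2 z3
  proof -
    have "inverse z1 = z2 * z3" "inverse z2 = z1 * z3"
      using that by (auto intro!: inverse_unique simp: algebra_simps)
    then show ?thesis unfolding alpha_def by (simp add: algebra_simps)
  qed
  have "1 + x3 \<noteq> 0" using ne by (simp add: add_eq_0_iff)
  moreover have "(1 + x3) * (x1 + x2) = (1 + x3) * (y1 + y2)"
    using fac[OF x] fac[OF y] al e by metis
  ultimately have "x1 + x2 = y1 + y2" by simp
  moreover have "x3 \<noteq> 0" using x by auto
  then have "x1 * x2 = y1 * y2" using x y e by (metis mult_right_cancel)
  ultimately show ?thesis by (rule two_roots_eq)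
qed

lemma alpha_perm:
  "alpha x2 x1 x3 = alpha x1 x2 x3" "alpha x1 x3 x2 = alpha x1 x2 x3"
  "alpha x3 x2 x1 = alpha x1 x2 x3"
  by (simp_all add: alpha_def)

lemma alpha_inverse: "alpha (inverse x1) (inverse x2) (inverse x3) = alpha x1 x2 x3"
  by (simp add: alpha_def)

lemma match_third':
  assumes x: "x1 * x2 * x3 = 1" and y: "y1 * y2 * y3 = 1"
    and al: "alpha x1 x2 x3 = alpha y1 y2 y3" and e: "x3 \<in> {y1, y2, y3}" and ne: "x3 \<noteq> -1"
  shows "{#x1, x2, x3#} = {#y1, y2, y3#}"
proof -
  consider "x3 = y3" | "x3 = y2" | "x3 = y1" using e by blast
  then show ?thesis
  proof cases
    case 1
    then show ?thesis using match_third[OF x y al] ne by (simp add: add_mset_commute)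
  next
    case 2
    then show ?thesis using match_third[OF x, of y1 y3 y2] y al ne
      by (simp add: alpha_perm mult_ac) (simp add: add_mset_commute)
  next
    case 3
    then show ?thesis using match_third[OF x, of y3 y2 y1] y al ne
      by (simp add: alpha_perm mult_ac) (simp add: add_mset_commute)
  qed
qed

text \<open>Replacing y by its inverses keeps \<open>alpha\<close> and the product 1, so a root
  shared with the inverses is treated like a root shared with y.\<close>

lemma matching_of_common_root:
  assumes x: "x1 * x2 * x3 = 1" and y: "y1 * y2 * y3 = 1"
    and al: "alpha x1 x2 x3 = alpha y1 y2 y3" and c: "common_root x1 x2 x3 y1 y2 y3"
    and ne: "-1 \<notin> {x1, x2, x3}"
  shows "matching x1 x2 x3 y1 y2 y3"
proof -
  have n: "x1 \<noteq> -1" "x2 \<noteq> -1" "x3 \<noteq> -1" using ne by auto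
  have main: "{#x1, x2, x3#} = {#z1, z2, z3#}"
    if z: "z1 * z2 * z3 = 1" "alpha x1 x2 x3 = alpha z1 z2 z3" "{x1, x2, x3} \<inter> {z1, z2, z3} \<noteq> {}" for z1 z2 z3
  proof -
    consider "x3 \<in> {z1, z2, z3}" | "x2 \<in> {z1, z2, z3}" | "x1 \<in> {z1, z2, z3}" using z(3) by blast
    then show ?thesis
    proof cases
      case 1
      then show ?thesis using match_third'[OF x z(1,2)] n by simp
    next
      case 2
      then show ?thesis using match_third'[of x1 x3 x2 z1 z2 z3] x z n
        by (simp add: alpha_perm mult_ac) (simp add: add_mset_commute)
    next
      case 3
      then show ?thesis using match_third'[of x3 x2 x1 z1 z2 z3] x z n
        by (simp add: alpha_perm mult_ac) (simp add: add_mset_commute)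
    qed
  qed
  have "inverse y1 * inverse y2 * inverse y3 = 1" using y by (metis inverse_1 inverse_mult_distrib)
  then show ?thesis
    using main[of y1 y2 y3] main[of "inverse y1" "inverse y2" "inverse y3"] y al c
    unfolding common_root_def matching_def alpha_inverse by blast
qed

section \<open>Class sums for primes from 5 on\<close>

text \<open>On the unit circle conjugation is inversion, so the conjugate relation reads 1/u + 1/v =
  1/w; clearing denominators gives the product.\<close>

lemma sum_two_unit:
  fixes u v w :: complex
  assumes "norm u = 1" "norm v = 1" "norm w = 1" "u + v = w"
  shows "u * v = w ^ 2"
proof -
  have c: "cnj z * z = 1" if "norm z = 1" for z :: complex
    using that by (simp add: complex_norm_square mult.commute flip: complex_norm_square)
  have "cnj u + cnj v = cnj w" using assms(4) complex_cnj_add by metis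
  then have "(cnj u + cnj v) * (u * v * w) = cnj w * (u * v * w)" by simp
  moreover have "(cnj u + cnj v) * (u * v * w) = (cnj u * u) * v * w + (cnj v * v) * u * w"
    by (simp add: algebra_simps)
  moreover have "cnj w * (u * v * w) = (cnj w * w) * (u * v)" by (simp add: algebra_simps)
  ultimately have "v * w + u * w = u * v" using c assms by simp
  then show ?thesis using assms(4) by (simp add: power2_eq_square algebra_simps flip: distrib_right)
qed

lemma norm_one_plus_sqrt_minus_one:
  fixes b :: complex
  assumes "b + inverse b = 0" "b \<noteq> 0"
  shows "norm (1 + b) = sqrt 2"
proof -
  have "b ^ 2 = -1"
    using assms by (simp add: power2_eq_square field_simps add_eq_0_iff)
  then have "b = \<i> \<or> b = -\<i>"
    by (metis i_squared power2_eq_iff power2_eq_square)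
  then show ?thesis by (auto simp: cmod_def)
qed

lemma root_unity_prime_power_eq_1:
  fixes r :: complex
  assumes "prime p" "r ^ p = 1" "r ^ k = 1" "\<not> p dvd k"
  shows "r = 1"
proof -
  have "coprime p k" using assms(1,4) prime_imp_coprime by blast
  moreover have "k \<noteq> 0" using assms(4) by (cases k) auto
  ultimately obtain a b where "k * a = Suc (p * b)"
    using coprime_commute coprime_bezout_strong[of k p] prime_gt_1_nat[OF assms(1)]
    by (metis nat_neq_iff Suc_eq_plus1)
  then have "r ^ (k * a) = r * r ^ (p * b)" by simp
  then show ?thesis using assms by (simp add: power_mult)
qed

text \<open>A term \<open>a\<close> lies in the class \<open>r\<close>, a root of unity of prime order or 1, and \<open>inverse a\<close> lies in the class
  \<open>inverse r\<close>.\<close>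

definition contrib :: "complex \<Rightarrow> complex \<Rightarrow> complex \<Rightarrow> complex" where
  "contrib \<eta> r a = (if r = \<eta> then a else 0) + (if inverse r = \<eta> then inverse a else 0)"

definition class_sum where
  "class_sum r1 r2 r3 a1 a2 a3 \<eta> = contrib \<eta> r1 a1 + contrib \<eta> r2 a2 + contrib \<eta> r3 a3"

lemma class_sum_perm:
  "class_sum r2 r1 r3 a2 a1 a3 = class_sum r1 r2 r3 a1 a2 a3"
  "class_sum r1 r3 r2 a1 a3 a2 = class_sum r1 r2 r3 a1 a2 a3"
  "class_sum r3 r2 r1 a3 a2 a1 = class_sum r1 r2 r3 a1 a2 a3"
  by (auto simp: class_sum_def fun_eq_iff)

lemma class_sum_inverse:
  "class_sum (inverse r1) (inverse r2) (inverse r3) (inverse a1) (inverse a2) (inverse a3) = class_sum r1 r2 r3 a1 a2 a3"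
  by (auto simp: class_sum_def contrib_def fun_eq_iff)


text \<open>The \<open>r\<close> are powers of three roots of unity with a common exponent. The
  \<open>a\<close> are these roots themselves or their quotients by the \<open>r\<close>; both
  readings are used.\<close>

definition class_triple :: "nat \<Rightarrow> complex \<Rightarrow> complex \<Rightarrow> complex \<Rightarrow> complex \<Rightarrow> complex \<Rightarrow> complex \<Rightarrow> bool" where
  "class_triple p r1 r2 r3 a1 a2 a3 \<longleftrightarrow> r1 ^ p = 1 \<and> r2 ^ p = 1 \<and> r3 ^ p = 1 \<and> r1 * r2 * r3 = 1 \<and>
     norm a1 = 1 \<and> norm a2 = 1 \<and> norm a3 = 1 \<and> a1 * a2 * a3 = 1"

lemma class_triple_perm:
  "class_triple p r2 r1 r3 a2 a1 a3 = class_triple p r1 r2 r3 a1 a2 a3"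
  "class_triple p r1 r3 r2 a1 a3 a2 = class_triple p r1 r2 r3 a1 a2 a3"
  "class_triple p r3 r2 r1 a3 a2 a1 = class_triple p r1 r2 r3 a1 a2 a3"
  by (auto simp: class_triple_def mult_ac)

lemma class_triple_inverse:
  "class_triple p (inverse r1) (inverse r2) (inverse r3) (inverse a1) (inverse a2) (inverse a3) = class_triple p r1 r2 r3 a1 a2 a3"
  by (simp add: class_triple_def power_inverse norm_inverse flip: inverse_mult_distrib)

lemma common_root_perm:
  "common_root x1 x2 x3 y2 y1 y3 = common_root x1 x2 x3 y1 y2 y3"
  "common_root x1 x2 x3 y1 y3 y2 = common_root x1 x2 x3 y1 y2 y3"
  "common_root x1 x2 x3 y3 y2 y1 = common_root x1 x2 x3 y1 y2 y3"
  "common_root x2 x1 x3 y1 y2 y3 = common_root x1 x2 x3 y1 y2 y3"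
  "common_root x1 x3 x2 y1 y2 y3 = common_root x1 x2 x3 y1 y2 y3"
  "common_root x3 x2 x1 y1 y2 y3 = common_root x1 x2 x3 y1 y2 y3"
  unfolding common_root_def by blast+

lemma common_root_inverse:
  "common_root x1 x2 x3 (inverse y1) (inverse y2) (inverse y3) = common_root x1 x2 x3 y1 y2 y3"
  by (auto simp: common_root_def)

lemma common_root_sym:
  "common_root x1 x2 x3 y1 y2 y3 = common_root y1 y2 y3 x1 x2 x3"
  by (auto simp: common_root_def)

text \<open>The condition excludes \<eta> = 1 and \<eta> = -1, so a term and its inverse never lie
  in the class \<eta> together.\<close>

lemma contrib_cases:
  assumes "\<eta> * \<eta> \<noteq> 1" "\<eta> \<noteq> 0"
  obtains "contrib \<eta> r a = 0" "r \<noteq> \<eta>" "inverse r \<noteq> \<eta>" | "contrib \<eta> r a = a" "r = \<eta>"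
    | "contrib \<eta> r a = inverse a" "inverse r = \<eta>"
proof -
  have n: "inverse \<eta> \<noteq> \<eta>" using assms by (metis right_inverse)
  show ?thesis
  proof (cases "r = \<eta>")
    case True
    then show ?thesis using that(2) n by (simp add: contrib_def)
  next
    case False
    then show ?thesis using that(1,3) by (cases "inverse r = \<eta>") (simp_all add: contrib_def)
  qed
qed

lemma prime_root_neq:
  assumes "prime p" "p \<ge> 5" "r ^ p = (1::complex)" "r \<noteq> 1"
  shows "r \<noteq> 0" "r * r \<noteq> 1" "r ^ 2 \<noteq> 1" "r ^ 3 \<noteq> 1" "r ^ 4 \<noteq> 1" "p \<noteq> 5 \<Longrightarrow> r ^ 5 \<noteq> 1"
proof -
  show "r \<noteq> 0" using assms by (auto simp: power_0_left)
  have *: "r ^ k \<noteq> 1" if "\<not> p dvd k" for k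
    using root_unity_prime_power_eq_1[OF assms(1,3) _ that] assms(4) by blast
  show 2: "r ^ 2 \<noteq> 1" "r ^ 3 \<noteq> 1" "r ^ 4 \<noteq> 1"
    using assms(2) by (auto intro!: * dest!: dvd_imp_le)
  then show "r * r \<noteq> 1" by (simp add: power2_eq_square)
  assume "p \<noteq> 5"
  moreover have "prime (5::nat)" by simp
  ultimately have "\<not> p dvd 5" using assms(1) primes_dvd_imp_eq by blast
  then show "r ^ 5 \<noteq> 1" by (rule *)
qed

text \<open>For p at least 5 the class \<open>r3\<close> then contains the third term alone, so the
  class sum there is a single root of unity.\<close>

definition isolated :: "complex \<Rightarrow> complex \<Rightarrow> complex \<Rightarrow> bool" where
  "isolated r1 r2 r3 \<longleftrightarrow> r3 \<noteq> 1 \<and> r3 \<notin> {r1, r2, inverse r1, inverse r2}"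

lemma isolated_simps:
  assumes p: "prime p" "p \<ge> 5" and x: "class_triple p r1 r2 r3 a1 a2 a3" and iso: "isolated r1 r2 r3"
  shows "class_sum r1 r2 r3 a1 a2 a3 r3 = a3" "class_sum r1 r2 r3 a1 a2 a3 1 = 0" "r1 \<noteq> 1" "r2 \<noteq> 1" "r3 \<noteq> 1"
proof -
  have r3: "r3 ^ p = 1" "r3 \<noteq> 1" using x iso unfolding class_triple_def isolated_def by auto
  note r = prime_root_neq[OF p r3]
  show r1: "r1 \<noteq> 1" and r2: "r2 \<noteq> 1"
    using x iso unfolding class_triple_def isolated_def by (auto dest: inverse_unique)
  show "r3 \<noteq> 1" by (rule r3)
  have "inverse r3 \<noteq> r3" using r by (metis right_inverse)
  then show "class_sum r1 r2 r3 a1 a2 a3 r3 = a3"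
    using iso unfolding isolated_def class_sum_def contrib_def by auto
  show "class_sum r1 r2 r3 a1 a2 a3 1 = 0"
    using r1 r2 r3 unfolding class_sum_def contrib_def by (auto simp: inverse_eq_1_iff)
qed

text \<open>Here s3 is the inverse of \<open>r3 ^ 2\<close>. The class r3 gives b1 + b2 = a3, hence
  \<open>b1 * b2 = a3 ^ 2\<close>. In the class s3 the term b3 must equal what a1 and a2 contribute,
  and a single contribution is a common root. If both contribute, then r1 = r2 =
  \<open>r3 ^ 2\<close>, so r3 has order 5, and 1/a1 + 1/a2 = b3 leads to \<open>a3 ^ 5 = 1\<close>,
  which \<open>quirk\<close> excludes.\<close>

lemma isolated_two_equal:
  assumes p: "prime p" "p \<ge> 5" and x: "class_triple p r1 r2 r3 a1 a2 a3" and iso: "isolated r1 r2 r3"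
    and y: "class_triple p s1 s2 s3 b1 b2 b3"
    and eq: "class_sum r1 r2 r3 a1 a2 a3 = class_sum s1 s2 s3 b1 b2 b3"
    and s: "s1 = r3" "s2 = r3" and quirk: "p = 5 \<Longrightarrow> a3 ^ 5 \<noteq> 1"
  shows "common_root a1 a2 a3 b1 b2 b3"
proof (rule ccontr)
  assume nc: "\<not> common_root a1 a2 a3 b1 b2 b3"
  have r3: "r3 ^ p = 1" "r3 \<noteq> 1" using x iso unfolding class_triple_def isolated_def by auto
  note r = prime_root_neq[OF p r3]
  have s3: "s3 = inverse (r3 ^ 2)" using y s unfolding class_triple_def
    by (metis inverse_unique power2_eq_square)
  have s3p: "s3 ^ p = 1" using y unfolding class_triple_def by simp
  have s31: "s3 \<noteq> 1" using s3 r(3) by (metis inverse_1 inverse_inverse_eq)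
  note s3n = prime_root_neq[OF p s3p s31]
  have i3: "inverse r3 \<noteq> r3" using r by (metis right_inverse)
  have n1: "s3 \<noteq> r3" using s3 r by (auto simp: field_simps power2_eq_square power3_eq_cube)
  have n2: "inverse s3 \<noteq> r3" using s3 r3(2) r(1) by (auto simp: power2_eq_square)
  have n3: "inverse r3 \<noteq> s3" using s3 r3(2) r(1) by (auto simp: power2_eq_square)
  have i4: "inverse s3 \<noteq> s3" using s3n by (metis right_inverse)
  have "class_sum s1 s2 s3 b1 b2 b3 r3 = b1 + b2"
    using s n1 n2 i3 unfolding class_sum_def contrib_def by auto
  then have a3: "b1 + b2 = a3" using isolated_simps(1)[OF p x iso] eq by metis
  then have b12: "b1 * b2 = a3 ^ 2" using x y unfolding class_triple_def by (intro sum_two_unit) auto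
  have "class_sum s1 s2 s3 b1 b2 b3 s3 = b3"
    using s n1 n3 i4 unfolding class_sum_def contrib_def by auto
  moreover have "class_sum r1 r2 r3 a1 a2 a3 s3 = contrib s3 r1 a1 + contrib s3 r2 a2"
    using n1 n3 unfolding class_sum_def contrib_def by auto
  ultimately have b3: "b3 = contrib s3 r1 a1 + contrib s3 r2 a2" using eq by simp
  have nz: "b3 \<noteq> 0" using y unfolding class_triple_def by auto
  have ni: "inverse s3 = r3 ^ 2" using s3 by simp
  have nc': "a1 \<noteq> b3" "a2 \<noteq> b3" "inverse a1 \<noteq> b3" "inverse a2 \<noteq> b3"
    using nc unfolding common_root_def by auto
  have rr: "r1 * r2 * r3 = 1" using x unfolding class_triple_def by simp
  have both: "r1 = inverse s3 \<and> r2 = inverse s3 \<and> b3 = inverse a1 + inverse a2"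
    if c1: "contrib s3 r1 a1 \<noteq> 0" and c2: "contrib s3 r2 a2 \<noteq> 0"
  proof -
    have no: "r1 * r2 \<noteq> 1" using rr r3(2) by auto
    have "\<not> (r1 = s3 \<and> r2 = s3)"
    proof
      assume "r1 = s3 \<and> r2 = s3"
      then have "inverse (r3 ^ 2) * inverse (r3 ^ 2) * r3 = 1" using rr s3 by simp
      then have "r3 = r3 ^ 4" using r(1) by (simp add: field_simps power2_eq_square power4_eq_xxxx)
      then have "r3 ^ 3 = 1" using r(1) by (simp add: power4_eq_xxxx power3_eq_cube)
      then show False using r(4) by simp
    qed
    moreover have s0: "s3 \<noteq> 0" by (rule s3n(1))
    ultimately show ?thesis using contrib_cases[OF s3n(2,1), of r1 a1] contrib_cases[OF s3n(2,1), of r2 a2]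
        c1 c2 no b3 by (metis inverse_inverse_eq left_inverse right_inverse)
  qed
  have "contrib s3 r1 a1 \<noteq> 0 \<and> contrib s3 r2 a2 \<noteq> 0"
  proof (rule ccontr)
    assume "\<not> ?thesis"
    then consider "b3 = contrib s3 r1 a1" | "b3 = contrib s3 r2 a2" using b3 by auto
    then show False
      by cases (use contrib_cases[OF s3n(2,1), of r1 a1] contrib_cases[OF s3n(2,1), of r2 a2] nz nc' in metis)+
  qed
  from both this have b: "r1 = r3 ^ 2" "r2 = r3 ^ 2" "inverse a1 + inverse a2 = b3" using ni by auto
  have "r3 ^ 5 = 1" using rr b by (simp add: power2_eq_square eval_nat_numeral mult_ac)
  then have p5: "p = 5" using r(6) by blast
  have "inverse a1 * inverse a2 = b3 ^ 2"
    using x y b(3) unfolding class_triple_def by (intro sum_two_unit) (auto simp: norm_inverse)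
  moreover have "inverse a1 * inverse a2 = a3" using x unfolding class_triple_def
    by (metis inverse_mult_distrib inverse_unique)
  ultimately have "a3 = b3 ^ 2" by simp
  moreover have "b3 * a3 ^ 2 = 1" using y b12 unfolding class_triple_def by (simp add: mult.commute)
  then have "b3 ^ 2 * (a3 ^ 2) ^ 2 = 1" by (metis power_mult_distrib power_one)
  ultimately have "a3 ^ 5 = 1" by (simp add: power2_eq_square eval_nat_numeral mult_ac)
  then show False using quirk[OF p5] by simp
qed

text \<open>Then s3 = 1, and the class 1 is empty on the side of x, so b3 is i or -i. The class r3
  gives a3 = b1 (1 + b3), whose modulus is the square root of 2 instead of 1.\<close>

lemma isolated_two_opposite:
  assumes p: "prime p" "p \<ge> 5" and x: "class_triple p r1 r2 r3 a1 a2 a3" and iso: "isolated r1 r2 r3"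
    and y: "class_triple p s1 s2 s3 b1 b2 b3"
    and eq: "class_sum r1 r2 r3 a1 a2 a3 = class_sum s1 s2 s3 b1 b2 b3"
    and s: "s1 = r3" "inverse s2 = r3"
  shows False
proof -
  have r3: "r3 ^ p = 1" "r3 \<noteq> 1" using x iso unfolding class_triple_def isolated_def by auto
  note r = prime_root_neq[OF p r3]
  have i3: "inverse r3 \<noteq> r3" using r by (metis right_inverse)
  have s2: "s2 = inverse r3" using s by auto
  have s3: "s3 = 1" using y s s2 r(1) unfolding class_triple_def by auto
  have "class_sum s1 s2 s3 b1 b2 b3 r3 = b1 + inverse b2"
    using s s2 s3 r3 i3 unfolding class_sum_def contrib_def by auto
  then have a3: "b1 + inverse b2 = a3" using isolated_simps(1)[OF p x iso] eq by metis
  have "class_sum s1 s2 s3 b1 b2 b3 1 = b3 + inverse b3"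
    using s s2 s3 r3 unfolding class_sum_def contrib_def by (auto simp: inverse_eq_1_iff)
  then have b0: "b3 + inverse b3 = 0" using isolated_simps(2)[OF p x iso] eq by metis
  have "b3 \<noteq> 0" using y unfolding class_triple_def by auto
  note sq = norm_one_plus_sqrt_minus_one[OF b0 this]
  have "inverse b2 = b1 * b3" using y unfolding class_triple_def by (intro inverse_unique) (simp add: mult_ac)
  then have "a3 = b1 * (1 + b3)" using a3 by (simp add: algebra_simps)
  then have "norm a3 = norm b1 * sqrt 2" using sq by (simp add: norm_mult)
  then show False using x y unfolding class_triple_def by simp
qed

lemma isolated_two:
  assumes p: "prime p" "p \<ge> 5" and x: "class_triple p r1 r2 r3 a1 a2 a3" and iso: "isolated r1 r2 r3"
    and y: "class_triple p s1 s2 s3 b1 b2 b3"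
    and eq: "class_sum r1 r2 r3 a1 a2 a3 = class_sum s1 s2 s3 b1 b2 b3"
    and s: "s1 = r3 \<or> inverse s1 = r3" "s2 = r3 \<or> inverse s2 = r3" and quirk: "p = 5 \<Longrightarrow> a3 ^ 5 \<noteq> 1"
  shows "common_root a1 a2 a3 b1 b2 b3"
proof -
  consider "s1 = r3" "s2 = r3" | "inverse s1 = r3" "inverse s2 = r3" | "s1 = r3" "inverse s2 = r3"
    | "s2 = r3" "inverse s1 = r3" using s by blast
  then show ?thesis
  proof cases
    case 1
    then show ?thesis using isolated_two_equal[OF p x iso y eq] quirk by blast
  next
    case 2
    have y': "class_triple p (inverse s1) (inverse s2) (inverse s3) (inverse b1) (inverse b2) (inverse b3)"
      using y by (simp only: class_triple_inverse)
    have eq': "class_sum r1 r2 r3 a1 a2 a3 =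
        class_sum (inverse s1) (inverse s2) (inverse s3) (inverse b1) (inverse b2) (inverse b3)"
      using eq by (simp only: class_sum_inverse)
    have "common_root a1 a2 a3 (inverse b1) (inverse b2) (inverse b3)"
      using isolated_two_equal[OF p x iso y' eq' 2] quirk by blast
    then show ?thesis by (simp add: common_root_inverse)
  next
    case 3
    then show ?thesis using isolated_two_opposite[OF p x iso y eq] by blast
  next
    case 4
    have "False"
      by (rule isolated_two_opposite[OF p x iso, of s2 s1 s3 b2 b1 b3])
        (use y eq 4 in \<open>simp_all add: class_triple_perm class_sum_perm\<close>)
    then show ?thesis ..
  qed
qed

text \<open>By \<open>isolated_two\<close> there is a common root as soon as two terms of y,
  inverted or not, meet the class r3. Otherwise a3, being nonzero, is the contribution of a single
  one.\<close>

lemma isolated_common_root: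
  assumes p: "prime p" "p \<ge> 5" and x: "class_triple p r1 r2 r3 a1 a2 a3" and iso: "isolated r1 r2 r3"
    and y: "class_triple p s1 s2 s3 b1 b2 b3"
    and eq: "class_sum r1 r2 r3 a1 a2 a3 = class_sum s1 s2 s3 b1 b2 b3"
    and quirk: "p = 5 \<Longrightarrow> a3 ^ 5 \<noteq> 1"
  shows "common_root a1 a2 a3 b1 b2 b3"
proof (rule ccontr)
  assume nc: "\<not> common_root a1 a2 a3 b1 b2 b3"
  have r3: "r3 ^ p = 1" "r3 \<noteq> 1" using x iso unfolding class_triple_def isolated_def by auto
  note r = prime_root_neq[OF p r3]
  have nz: "a3 \<noteq> 0" using x unfolding class_triple_def by auto
  have a3: "a3 = contrib r3 s1 b1 + contrib r3 s2 b2 + contrib r3 s3 b3"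
    using isolated_simps(1)[OF p x iso] eq unfolding class_sum_def[of s1] by metis
  have h: "contrib r3 s b = 0 \<or> contrib r3 s b \<in> {b, inverse b} \<and> (s = r3 \<or> inverse s = r3)" for s b
    by (rule contrib_cases[OF r(2,1), of s b]) auto
  have nc': "a3 \<noteq> b1" "a3 \<noteq> inverse b1" "a3 \<noteq> b2" "a3 \<noteq> inverse b2" "a3 \<noteq> b3" "a3 \<noteq> inverse b3"
    using nc unfolding common_root_def by auto
  have n12: "\<not> ((s1 = r3 \<or> inverse s1 = r3) \<and> (s2 = r3 \<or> inverse s2 = r3))"
    using isolated_two[OF p x iso y eq] quirk nc by blast
  have n13: "\<not> ((s1 = r3 \<or> inverse s1 = r3) \<and> (s3 = r3 \<or> inverse s3 = r3))"
  proof -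
    have y': "class_triple p s1 s3 s2 b1 b3 b2" using y by (simp only: class_triple_perm)
    have eq': "class_sum r1 r2 r3 a1 a2 a3 = class_sum s1 s3 s2 b1 b3 b2" using eq by (simp only: class_sum_perm)
    have nc': "\<not> common_root a1 a2 a3 b1 b3 b2" using nc unfolding common_root_def by blast
    show ?thesis using isolated_two[OF p x iso y' eq'] quirk nc' by blast
  qed
  have n23: "\<not> ((s3 = r3 \<or> inverse s3 = r3) \<and> (s2 = r3 \<or> inverse s2 = r3))"
  proof -
    have y': "class_triple p s3 s2 s1 b3 b2 b1" using y by (simp only: class_triple_perm)
    have eq': "class_sum r1 r2 r3 a1 a2 a3 = class_sum s3 s2 s1 b3 b2 b1" using eq by (simp only: class_sum_perm)
    have nc': "\<not> common_root a1 a2 a3 b3 b2 b1" using nc unfolding common_root_def by blast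
    show ?thesis using isolated_two[OF p x iso y' eq'] quirk nc' by blast
  qed
  show False
    using h[of s1 b1] h[of s2 b2] h[of s3 b3] a3 nc' n12 n13 n23 nz by auto
qed

text \<open>Two classes are never inverse to each other, because the third would be 1. So a class
  fails to be isolated only by being equal to another; if none is isolated, all three agree and r1
  is a cube root of unity, which is impossible for p at least 5.\<close>

lemma isolated_or_one:
  assumes p: "prime p" "p \<ge> 5" and x: "class_triple p r1 r2 r3 a1 a2 a3" 
    and "r1 \<noteq> 1" "r2 \<noteq> 1" "r3 \<noteq> 1"
  shows "isolated r1 r2 r3 \<or> isolated r1 r3 r2 \<or> isolated r3 r2 r1"
proof -
  have *: "inverse r \<noteq> s" "inverse s \<noteq> r" if "r * s * t = 1" "t \<noteq> 1" "r \<noteq> 0" "s \<noteq> 0" for r s t :: complex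
  proof -
    have "r * s \<noteq> 1" using that(1,2) by auto
    then show "inverse r \<noteq> s" "inverse s \<noteq> r" using that(3,4) by auto
  qed
  have rp: "r1 ^ p = 1" "r2 ^ p = 1" "r3 ^ p = 1" "r1 * r2 * r3 = 1" using x unfolding class_triple_def by auto
  note n1 = prime_root_neq[OF p rp(1) assms(4)]
  note n2 = prime_root_neq[OF p rp(2) assms(5)]
  note n3 = prime_root_neq[OF p rp(3) assms(6)]
  have inv: "inverse r1 \<noteq> r2" "inverse r2 \<noteq> r1" "inverse r1 \<noteq> r3" "inverse r3 \<noteq> r1" "inverse r2 \<noteq> r3" "inverse r3 \<noteq> r2"
    using *[of r1 r2 r3] *[of r1 r3 r2] *[of r2 r3 r1] rp(4) assms n1(1) n2(1) n3(1) by (auto simp: mult_ac)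
  have "\<not> (r1 = r2 \<and> r2 = r3)" using rp(4) n1(4) by (auto simp: power3_eq_cube)
  then show ?thesis using inv assms unfolding isolated_def by auto
qed

text \<open>With r3 = s3 = 1 the remaining classes form inverse pairs. If y meets the class r1, the
  class 1 gives a3 + 1/a3 = b3 + 1/b3. Otherwise the class r1 gives a1 + 1/a2 = a1 (1 + a3) =
  0.\<close>

lemma class_analysis_one:
  assumes r: "r3 = 1" "r1 \<noteq> 1" and rr: "r1 * r1 \<noteq> 1" and s: "s3 = 1"
    and x: "class_triple p r1 r2 r3 a1 a2 a3" and y: "class_triple p s1 s2 s3 b1 b2 b3"
    and eq: "class_sum r1 r2 r3 a1 a2 a3 = class_sum s1 s2 s3 b1 b2 b3"
  shows "common_root a1 a2 a3 b1 b2 b3 \<or> a3 = -1"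
proof -
  have rp: "r1 ^ p = 1" "r1 * r2 = 1" "s1 * s2 = 1" using x y r s unfolding class_triple_def by auto
  have r0: "r1 \<noteq> 0" using rp(2) by auto
  have r2: "r2 = inverse r1" "s2 = inverse s1" using rp(2,3) inverse_unique by metis+
  have i1: "inverse r1 \<noteq> r1" using rr r0 by (metis right_inverse)
  have x1: "class_sum r1 r2 r3 a1 a2 a3 1 = a3 + inverse a3"
    using r r2 unfolding class_sum_def contrib_def by (auto simp: inverse_eq_1_iff)
  have xr: "class_sum r1 r2 r3 a1 a2 a3 r1 = a1 + inverse a2"
    using r r2 i1 unfolding class_sum_def contrib_def by auto
  have prod: "a1 * a2 * a3 = 1" "b1 * b2 * b3 = 1" using x y unfolding class_triple_def by auto
  have ia2: "inverse a2 = a1 * a3" using prod by (intro inverse_unique) (simp add: mult_ac)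
  show ?thesis
  proof (cases "s1 = r1 \<or> inverse s1 = r1")
    case True
    then have "s1 \<noteq> 1" "s2 \<noteq> 1" using r r2 by auto
    then have "class_sum s1 s2 s3 b1 b2 b3 1 = b3 + inverse b3"
      using s unfolding class_sum_def contrib_def by (auto simp: inverse_eq_1_iff)
    then have sums: "a3 + inverse a3 = b3 + inverse b3" using x1 eq by metis
    have "a3 \<noteq> 0" "b3 \<noteq> 0" using prod by auto
    then have "{#a3, inverse a3#} = {#b3, inverse b3#}" using sums by (intro two_roots_eq) auto
    then have "a3 \<in> {b3, inverse b3}" by (metis insert_iff set_mset_add_mset_insert set_mset_empty)
    then show ?thesis unfolding common_root_def by blast
  next
    case False
    then have "class_sum s1 s2 s3 b1 b2 b3 r1 = 0"
      using s r r2 unfolding class_sum_def contrib_def by auto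
    then have "a1 + a1 * a3 = 0" using xr eq ia2 by metis
    then have "a1 * (1 + a3) = 0" by (simp add: algebra_simps)
    then have "a3 = -1" using prod(1) by (auto simp: add_eq_0_iff)
    then show ?thesis ..
  qed
qed

text \<open>A triple that avoids the class 1 has an isolated class; if both meet it,
  \<open>class_analysis_one\<close> applies after permuting the class 1 to the last place.\<close>

lemma class_analysis:
  assumes p: "prime p" "p \<ge> 5" and x: "class_triple p r1 r2 r3 a1 a2 a3" and y: "class_triple p s1 s2 s3 b1 b2 b3"
    and eq: "class_sum r1 r2 r3 a1 a2 a3 = class_sum s1 s2 s3 b1 b2 b3"
    and nt: "\<not> (r1 = 1 \<and> r2 = 1 \<and> r3 = 1)"
    and quirk: "p = 5 \<Longrightarrow> \<forall>(r, a) \<in> {(r1,a1), (r2,a2), (r3,a3), (s1,b1), (s2,b2), (s3,b3)}. r \<noteq> 1 \<longrightarrow> a ^ 5 \<noteq> 1"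
  shows "common_root a1 a2 a3 b1 b2 b3 \<or> -1 \<in> {a1, a2, a3}"
proof -
  have general: "common_root a1 a2 a3 b1 b2 b3"
    if n: "r1 \<noteq> 1" "r2 \<noteq> 1" "r3 \<noteq> 1"
      and x: "class_triple p r1 r2 r3 a1 a2 a3" and y: "class_triple p s1 s2 s3 b1 b2 b3"
      and eq: "class_sum r1 r2 r3 a1 a2 a3 = class_sum s1 s2 s3 b1 b2 b3"
      and quirk: "p = 5 \<Longrightarrow> a1 ^ 5 \<noteq> 1" "p = 5 \<Longrightarrow> a2 ^ 5 \<noteq> 1" "p = 5 \<Longrightarrow> a3 ^ 5 \<noteq> 1"
    for r1 r2 r3 a1 a2 a3 s1 s2 s3 b1 b2 b3
  proof -
    consider "isolated r1 r2 r3" | "isolated r1 r3 r2" | "isolated r3 r2 r1"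
      using isolated_or_one[OF p x n] by blast
    then show ?thesis
    proof cases
      case 1
      then show ?thesis using isolated_common_root[OF p x 1 y eq] quirk by blast
    next
      case 2
      have "common_root a1 a3 a2 b1 b2 b3"
        by (rule isolated_common_root[OF p _ 2 y]) (use x eq quirk in \<open>simp_all add: class_triple_perm class_sum_perm\<close>)
      then show ?thesis by (simp add: common_root_perm)
    next
      case 3
      have "common_root a3 a2 a1 b1 b2 b3"
        by (rule isolated_common_root[OF p _ 3 y]) (use x eq quirk in \<open>simp_all add: class_triple_perm class_sum_perm\<close>)
      then show ?thesis by (simp add: common_root_perm)
    qed
  qed
  have special: "common_root a1 a2 a3 b1 b2 b3 \<or> a3 = -1"
    if r: "r3 = 1" "r1 \<noteq> 1" and s: "s3 = 1"
      and x: "class_triple p r1 r2 r3 a1 a2 a3" and y: "class_triple p s1 s2 s3 b1 b2 b3"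
      and eq: "class_sum r1 r2 r3 a1 a2 a3 = class_sum s1 s2 s3 b1 b2 b3"
    for r1 r2 r3 a1 a2 a3 s1 s2 s3 b1 b2 b3
  proof -
    have "r1 ^ p = 1" using x unfolding class_triple_def by simp
    from prime_root_neq(2)[OF p this r(2)] show ?thesis
      using class_analysis_one[OF r _ s x y eq] by blast
  qed
  show ?thesis
  proof (cases "r1 \<noteq> 1 \<and> r2 \<noteq> 1 \<and> r3 \<noteq> 1")
    case True
    then show ?thesis using general[of r1 r2 r3 a1 a2 a3 s1 s2 s3 b1 b2 b3] x y eq quirk by auto
  next
    case r: False
    show ?thesis
    proof (cases "s1 \<noteq> 1 \<and> s2 \<noteq> 1 \<and> s3 \<noteq> 1")
      case True
      then show ?thesis using general[of s1 s2 s3 b1 b2 b3 r1 r2 r3 a1 a2 a3] x y eq quirk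
        by (auto simp: common_root_sym[of a1])
    next
      case s: False
      have stepx: "common_root a1 a2 a3 b1 b2 b3 \<or> -1 \<in> {a1, a2, a3}"
        if s: "s3 = 1" and y: "class_triple p s1 s2 s3 b1 b2 b3"
          and eq: "class_sum r1 r2 r3 a1 a2 a3 = class_sum s1 s2 s3 b1 b2 b3" for s1 s2 s3 b1 b2 b3
      proof -
        have rrr: "r1 * r2 * r3 = 1" using x unfolding class_triple_def by simp
        consider "r3 = 1" "r1 \<noteq> 1" | "r2 = 1" "r1 \<noteq> 1" | "r1 = 1" "r3 \<noteq> 1"
          using r nt rrr by (cases "r3 = 1"; cases "r1 = 1") auto
        then show ?thesis
        proof cases
          case 1
          then show ?thesis using special[OF 1 s x y eq] by blast
        next
          case 2
          have "common_root a1 a3 a2 b1 b2 b3 \<or> a2 = -1"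
            by (rule special[OF 2 s _ y]) (use x eq in \<open>simp_all add: class_triple_perm class_sum_perm\<close>)
          then show ?thesis by (auto simp: common_root_perm)
        next
          case 3
          have "common_root a3 a2 a1 b1 b2 b3 \<or> a1 = -1"
            by (rule special[OF 3 s _ y]) (use x eq in \<open>simp_all add: class_triple_perm class_sum_perm\<close>)
          then show ?thesis by (auto simp: common_root_perm)
        qed
      qed
      consider "s3 = 1" | "s2 = 1" | "s1 = 1" using s by blast
      then show ?thesis
      proof cases
        case 1
        then show ?thesis using stepx[OF 1 y eq] by blast
      next
        case 2
        then show ?thesis using stepx[OF 2, of s1 s3 b1 b3 b2] y eq
          by (simp add: class_triple_perm class_sum_perm common_root_perm)
      next
        case 3
        then show ?thesis using stepx[OF 3, of s3 s2 b3 b2 b1] y eq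
          by (simp add: class_triple_perm class_sum_perm common_root_perm)
      qed
    qed
  qed
qed

section \<open>Class sums at the primes 7, 3 and 2\<close>


lemma class_triple_one_classes:
  assumes "class_triple p r1 r2 r3 a1 a2 a3" "1 \<in> {r1, r2, r3}"
  obtains u where "{r1, r2, r3, inverse r1, inverse r2, inverse r3} \<subseteq> {1, u, inverse u}"
proof -
  have rr: "r1 * r2 * r3 = 1" using assms(1) unfolding class_triple_def by simp
  consider "r1 = 1" "r3 = inverse r2" | "r2 = 1" "r3 = inverse r1" | "r3 = 1" "r2 = inverse r1"
    using assms(2) rr inverse_unique[of r2 r3] inverse_unique[of r1 r3] inverse_unique[of r1 r2] by auto
  then show ?thesis by cases (rule that[of r2] that[of r1], auto)+
qed

lemma class_sum_eq_0:
  assumes "\<eta> \<notin> {r1, r2, r3, inverse r1, inverse r2, inverse r3}"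
  shows "class_sum r1 r2 r3 a1 a2 a3 \<eta> = 0"
  using assms by (auto simp: class_sum_def contrib_def)

text \<open>The constant is the value at any class that neither triple meets. If no term lies in the
  class 1, this is 1 itself. Otherwise one triple meets at most three classes 1, u, 1/u and the
  other at most six, and nine is less than p.\<close>

lemma class_sum_const_zero:
  assumes p: "p \<ge> 11" and x: "class_triple p r1 r2 r3 a1 a2 a3" and y: "class_triple p s1 s2 s3 b1 b2 b3"
    and c: "\<And>\<eta>. \<eta> ^ p = 1 \<Longrightarrow> class_sum r1 r2 r3 a1 a2 a3 \<eta> - class_sum s1 s2 s3 b1 b2 b3 \<eta> = c"
  shows "c = 0"
proof -
  let ?R = "{r1, r2, r3, inverse r1, inverse r2, inverse r3}"
  let ?S = "{s1, s2, s3, inverse s1, inverse s2, inverse s3}"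
  have ex: "c = 0" if "\<eta> ^ p = 1" "\<eta> \<notin> ?R \<union> ?S" for \<eta>
    using c[OF that(1)] class_sum_eq_0[of \<eta> r1 r2 r3 a1 a2 a3] class_sum_eq_0[of \<eta> s1 s2 s3 b1 b2 b3] that(2)
    by auto
  have six: "card {a, b, c, d, e, f} \<le> 6" for a b c d e f :: complex
    using card_length[of "[a, b, c, d, e, f]"] by simp
  have three: "card {a, b, c} \<le> 3" for a b c :: complex
    using card_length[of "[a, b, c]"] by simp
  show ?thesis
  proof (cases "1 \<in> ?R \<union> ?S")
    case False
    then show ?thesis using ex[of 1] by simp
  next
    case True
    then have "1 \<in> {r1, r2, r3} \<or> 1 \<in> {s1, s2, s3}" by (auto simp: inverse_eq_1_iff)
    then have "card (?R \<union> ?S) \<le> 9"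
    proof
      assume "1 \<in> {r1, r2, r3}"
      then obtain u where "?R \<subseteq> {1, u, inverse u}" using class_triple_one_classes[OF x] by metis
      then have "card ?R \<le> 3" using card_mono[of "{1, u, inverse u}" ?R] three[of 1 u "inverse u"] by simp
      then show ?thesis using six[of s1 s2 s3 "inverse s1" "inverse s2" "inverse s3"] card_Un_le[of ?R ?S] by linarith
    next
      assume "1 \<in> {s1, s2, s3}"
      then obtain u where "?S \<subseteq> {1, u, inverse u}" using class_triple_one_classes[OF y] by metis
      then have "card ?S \<le> 3" using card_mono[of "{1, u, inverse u}" ?S] three[of 1 u "inverse u"] by simp
      then show ?thesis using six[of r1 r2 r3 "inverse r1" "inverse r2" "inverse r3"] card_Un_le[of ?R ?S] by linarith
    qed
    then have lt: "card (?R \<union> ?S) < card {z::complex. z ^ p = 1}" using p card_roots_unity_eq[of p] by simp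
    have fin: "finite (?R \<union> ?S)" by simp
    have "\<not> {z::complex. z ^ p = 1} \<subseteq> ?R \<union> ?S"
    proof
      assume "{z::complex. z ^ p = 1} \<subseteq> ?R \<union> ?S"
      from card_mono[OF fin this] lt show False by linarith
    qed
    then obtain \<eta> where "\<eta> ^ p = 1" "\<eta> \<notin> ?R \<union> ?S" by blast
    then show ?thesis by (rule ex)
  qed
qed

section \<open>The prime 7\<close>

text \<open>All terms sit in known powers of r, so c can be read off class by class. The identity
  \<open>a12\<close> links the class 1 with the classes r and 1/r: it forces c = 0 when
  \<open>s2 = r ^ 4\<close> and c = -1 when \<open>s2 = r ^ 3\<close>, and the latter solution is
  the sporadic relation.\<close>

lemma sum_two_special:
  fixes r :: complex
  assumes r7: "r ^ 7 = 1" and r1: "r \<noteq> 1"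
    and a: "a1 * a2 * a3 = 1" and b: "b1 * b2 * b3 = 1"
    and c: "\<And>\<eta>. \<eta> ^ 7 = 1 \<Longrightarrow> class_sum r (inverse r) 1 a1 a2 a3 \<eta> - class_sum (r ^ 2) s2 s3 b1 b2 b3 \<eta> = c"
    and c0: "c \<noteq> 0" and s: "s2 = r ^ 3 \<or> s2 = r ^ 4" "r ^ 2 * s2 * s3 = 1"
  shows "a3 ^ 2 + a3 + 1 = 0 \<and> a1 = a3 \<and> a2 = a3 \<and> b2 = 1 \<and> b1 ^ 3 = -1"
proof -
  \<comment> \<open>Naming the classes by exponents below 7 lets \<open>eqi\<close> decide every
    equality of classes by comparing numerals.\<close>
  define \<rho> where "\<rho> k = r ^ k" for k :: nat
  have r0: "r \<noteq> 0" using r7 by auto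
  have p7: "prime (7::nat)" by simp
  have rk: "r ^ k \<noteq> 1" if "0 < k" "k < 7" for k
    using root_unity_prime_power_eq_1[OF p7 r7, of k] r1 nat_dvd_not_less[OF that] by blast
  have neq: "\<rho> i \<noteq> \<rho> j" if "i < j" "j < 7" for i j
  proof
    assume "\<rho> i = \<rho> j"
    moreover have "r ^ i * r ^ (j - i) = r ^ j" using that by (subst power_add[symmetric]) simp
    ultimately have "r ^ i * r ^ (j - i) = r ^ i * 1" unfolding \<rho>_def by simp
    then have "r ^ (j - i) = 1" using r0 by simp
    then show False using rk[of "j - i"] that by simp
  qed
  have eqi: "\<rho> i = \<rho> j \<longleftrightarrow> i = j" if "i < 7" "j < 7" for i j
    using neq[of i j] neq[of j i] that by (cases i j rule: linorder_cases) auto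
  have inv: "inverse (\<rho> k) = \<rho> (7 - k)" if "k \<le> 7" for k
  proof -
    have "\<rho> k * \<rho> (7 - k) = 1" using that r7 unfolding \<rho>_def by (simp flip: power_add)
    then show ?thesis by (rule inverse_unique)
  qed
  have invs: "inverse (\<rho> 1) = \<rho> 6" "inverse (\<rho> 2) = \<rho> 5" "inverse (\<rho> 3) = \<rho> 4" "inverse (\<rho> 4) = \<rho> 3"
    "inverse (\<rho> 5) = \<rho> 2" "inverse (\<rho> 6) = \<rho> 1" "inverse (\<rho> 0) = \<rho> 0"
    using inv[of 1] inv[of 2] inv[of 3] inv[of 4] inv[of 5] inv[of 6] by (simp_all add: \<rho>_def)
  have P: "r = \<rho> 1" "inverse r = \<rho> 6" "1 = \<rho> 0" "r ^ 2 = \<rho> 2" using invs(1) by (simp_all add: \<rho>_def)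
  have r7': "\<rho> k ^ 7 = 1" for k using r7 unfolding \<rho>_def by (metis mult.commute power_mult power_one)
  have cc: "class_sum (\<rho> 1) (\<rho> 6) (\<rho> 0) a1 a2 a3 (\<rho> k) - class_sum (\<rho> 2) s2 s3 b1 b2 b3 (\<rho> k) = c" for k
    using c[OF r7', of k] by (simp only: P[symmetric])
  have nz: "a1 \<noteq> 0" "a2 \<noteq> 0" "a3 \<noteq> 0" "b1 \<noteq> 0" "b2 \<noteq> 0" "b3 \<noteq> 0" using a b by auto
  \<comment> \<open>Expanded, the product is 2 plus a1 a2 and its inverse, and a1 a2 is the inverse
    of a3.\<close>
  have a12: "(a1 + inverse a2) * (inverse a1 + a2) = 2 + (a3 + inverse a3)"
  proof -
    have "inverse a3 = a1 * a2" using a by (intro inverse_unique) (simp add: mult_ac)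
    moreover have "a3 = inverse a1 * inverse a2" using a nz by (simp add: field_simps)
    ultimately show ?thesis using nz by (simp add: algebra_simps)
  qed
  from s(1) show ?thesis
  proof
    assume "s2 = r ^ 4"
    then have s2: "s2 = \<rho> 4" by (simp add: \<rho>_def)
    have "r ^ 2 * s2 * \<rho> 1 = r ^ 7" unfolding s2 \<rho>_def by (simp flip: power_add power_Suc2)
    then have "r ^ 2 * s2 * s3 = r ^ 2 * s2 * \<rho> 1" using s(2) r7 by simp
    moreover have "r ^ 2 * s2 \<noteq> 0" using r0 s2 by (simp add: \<rho>_def)
    ultimately have s3: "s3 = \<rho> 1" by simp
    note cs = cc[unfolded s2 s3 class_sum_def contrib_def invs]
    have e: "a3 + inverse a3 = c" "a1 + inverse a2 - b3 = c" "inverse a1 + a2 - inverse b3 = c"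
      "- b1 = c" "- inverse b1 = c" "- b2 = c"
      using cs[of 0] cs[of 1] cs[of 6] cs[of 2] cs[of 5] cs[of 4] by (simp_all add: eqi)
    have "c * c = (- b1) * (- inverse b1)" using e(4,5) by simp
    then have c2: "c * c = 1" using nz by simp
    have "(- b1) * (- b2) = 1" unfolding e(4,6) by (rule c2)
    then have "b1 * b2 = 1" by simp
    then have b3: "b3 = 1" using b by simp
    have "a1 + inverse a2 = 1 + c" "inverse a1 + a2 = 1 + c" using e(2,3) b3 by (simp_all add: algebra_simps)
    note a12[unfolded this e(1)]
    \<comment> \<open>By \<open>a12\<close> the same square is 2 + c, so c = 0.\<close>
    moreover have "(1 + c) * (1 + c) = 2 + c + c" using c2 by (simp add: distrib_left distrib_right)
    ultimately have "c = 0" by simp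
    then show ?thesis using c0 by simp
  next
    assume "s2 = r ^ 3"
    then have s2: "s2 = \<rho> 3" by (simp add: \<rho>_def)
    have "r ^ 2 * s2 * \<rho> 2 = r ^ 7" unfolding s2 \<rho>_def by (simp flip: power_add)
    then have "r ^ 2 * s2 * s3 = r ^ 2 * s2 * \<rho> 2" using s(2) r7 by simp
    moreover have "r ^ 2 * s2 \<noteq> 0" using r0 s2 by (simp add: \<rho>_def)
    ultimately have s3: "s3 = \<rho> 2" by simp
    note cs = cc[unfolded s2 s3 class_sum_def contrib_def invs]
    have e: "a3 + inverse a3 = c" "a1 + inverse a2 = c" "inverse a1 + a2 = c"
      "- b2 = c" "- inverse b2 = c" "- b1 - b3 = c"
      using cs[of 0] cs[of 1] cs[of 6] cs[of 3] cs[of 4] cs[of 2] by (simp_all add: eqi algebra_simps)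
    have "c * c = (- b2) * (- inverse b2)" using e(4,5) by simp
    then have c2: "c * c = 1" using nz by simp
    have "1 = 2 + c" using a12[unfolded e(1,2,3)] c2 by simp
    then have "c = 1 - 2" by (simp only: eq_diff_eq add.commute)
    then have c1: "c = -1" by simp
    have b2: "b2 = 1" using e(4) c1 by simp
    have b13: "b3 = 1 - b1" "b1 * b3 = 1" using e(6) c1 b b2 by (simp_all add: algebra_simps)
    then have "b1 * (1 - b1) = 1" by simp
    then have "b1 * b1 = b1 - 1" by (simp add: right_diff_distrib eq_diff_eq diff_eq_eq add.commute)
    then have "b1 * b1 * b1 = (b1 - 1) * b1" by simp
    also have "\<dots> = b1 * b1 - b1" by (simp add: left_diff_distrib)
    also have "\<dots> = -1" using \<open>b1 * b1 = b1 - 1\<close> by simp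
    finally have "b1 * b1 * b1 = -1" .
    then have b1: "b1 ^ 3 = -1" by (simp add: power3_eq_cube)
    have "a3 * a3 + 1 = - a3" using e(1) c1 nz by (simp add: field_simps)
    then have a33: "a3 ^ 2 + a3 + 1 = 0" unfolding eq_neg_iff_add_eq_0 by (simp add: power2_eq_square algebra_simps)
    have a2: "inverse a2 = a1 * a3" using a by (intro inverse_unique) (simp add: mult_ac)
    then have "a1 * (1 + a3) = -1" using e(2) c1 by (simp add: algebra_simps)
    moreover have "1 + a3 = - (a3 * a3)"
      unfolding eq_neg_iff_add_eq_0 using a33 by (simp add: power2_eq_square algebra_simps)
    ultimately have "a1 * (a3 * a3) = 1" by simp
    moreover have cube: "a3 * (a3 * a3) = 1"
    proof -
      have "a3 * (a3 * a3) = - (a3 + a3 * a3)"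
        using arg_cong[OF \<open>1 + a3 = - (a3 * a3)\<close>, of "\<lambda>z. - (a3 * z)"] by (simp add: algebra_simps)
      moreover have "a3 + a3 * a3 = -1"
        unfolding eq_neg_iff_add_eq_0 using a33 by (simp add: power2_eq_square algebra_simps)
      ultimately show ?thesis by simp
    qed
    ultimately have a13: "a1 = a3" using nz by (metis mult_right_cancel no_zero_divisors)
    have "a2 * (a3 * a3) = 1" using a a13 by (simp add: mult_ac)
    then have "a2 = a3" using cube nz by (metis mult_right_cancel no_zero_divisors)
    then show ?thesis using a33 a13 b2 b1 by simp
  qed
qed


text \<open>The relation behind it: the six terms of y are the primitive seventh roots of unity,
  with sum -1, while all terms of x lie in the class 1.\<close>

definition seven_trivial where
  "seven_trivial r1 r2 r3 a1 a2 a3 b1 b2 b3 \<longleftrightarrow>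
     {r1, r2, r3} = {1} \<and> {b1, b2, b3} = {1} \<and> alpha a1 a2 a3 = -1"

text \<open>The relation \<open>-1 - z - 1/z = z^2 + z^3 + z^4 + z^5\<close> for a seventh root of unity \<open>z\<close>, with 1 and -1
  written as sums of two sixth and two third roots of unity.\<close>

definition seven_sporadic :: "complex \<Rightarrow> complex \<Rightarrow> complex \<Rightarrow> complex \<Rightarrow> complex \<Rightarrow> complex \<Rightarrow> bool" where
  "seven_sporadic a1 a2 a3 b1 b2 b3 \<longleftrightarrow>
     (\<exists>w. w ^ 2 + w + 1 = 0 \<and> {a1, a2, a3} = {w}) \<and> 1 \<in> {b1, b2, b3} \<and> (\<exists>b\<in>{b1, b2, b3}. b ^ 3 = -1)"

text \<open>Outside the class 1 only y contributes, and c is not 0, so its six terms occupy the six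
  other classes, one each. A term and its inverse are then both -c, so \<open>c * c = 1\<close>, and
  the product 1 of the b_i fixes c = -1.\<close>

lemma seven_all_one:
  assumes x: "class_triple 7 1 1 1 a1 a2 a3" and y: "class_triple 7 s1 s2 s3 b1 b2 b3"
    and c: "\<And>\<eta>. \<eta> ^ 7 = 1 \<Longrightarrow> class_sum 1 1 1 a1 a2 a3 \<eta> - class_sum s1 s2 s3 b1 b2 b3 \<eta> = c"
    and c0: "c \<noteq> 0"
  shows "{b1, b2, b3} = {1} \<and> alpha a1 a2 a3 = -1"
proof -
  let ?S = "{s1, s2, s3, inverse s1, inverse s2, inverse s3}"
  have P0: "class_sum 1 1 1 a1 a2 a3 \<eta> = 0" if "\<eta> \<noteq> 1" for \<eta>
    using that by (simp add: class_sum_def contrib_def)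
  have Q: "class_sum s1 s2 s3 b1 b2 b3 \<eta> = - c" if "\<eta> ^ 7 = 1" "\<eta> \<noteq> 1" for \<eta>
    using c[OF that(1)] P0[OF that(2)] by (metis diff_0 minus_minus)
  have sub: "{z. z ^ 7 = 1} \<subseteq> insert 1 ?S"
  proof
    fix \<eta> :: complex assume "\<eta> \<in> {z. z ^ 7 = 1}"
    then have e7: "\<eta> ^ 7 = 1" by simp
    show "\<eta> \<in> insert 1 ?S"
    proof (rule ccontr)
      assume "\<eta> \<notin> insert 1 ?S"
      then have "\<eta> \<noteq> 1" "\<eta> \<notin> ?S" by blast+
      with Q[OF e7] class_sum_eq_0[of \<eta> s1 s2 s3 b1 b2 b3] c0 show False by (metis neg_equal_0_iff_equal)
    qed
  qed
  have c7: "card {z::complex. z ^ 7 = 1} = 7" using card_roots_unity_eq[of 7] by simp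
  have n1: "1 \<notin> {s1, s2, s3}"
  proof
    assume "1 \<in> {s1, s2, s3}"
    then obtain u where "?S \<subseteq> {1, u, inverse u}" using class_triple_one_classes[OF y] by metis
    then have "{z. z ^ 7 = 1} \<subseteq> {1, u, inverse u}" using sub by blast
    moreover have "finite {1, u, inverse u}" by simp
    ultimately have "card {z::complex. z ^ 7 = 1} \<le> card {1, u, inverse u}" by (intro card_mono)
    then have "7 \<le> card {1, u, inverse u}" unfolding c7 .
    also have "\<dots> \<le> 3" using card_length[of "[1, u, inverse u]"] by simp
    finally show False by simp
  qed
  have "card {z::complex. z ^ 7 = 1} \<le> card (insert 1 ?S)" by (intro card_mono sub) simp
  then have "7 \<le> card (insert 1 ?S)" unfolding c7 .
  also have "insert 1 ?S = set [1, s1, s2, s3, inverse s1, inverse s2, inverse s3]" by simp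
  finally have "card (set [1, s1, s2, s3, inverse s1, inverse s2, inverse s3])
      = length [1, s1, s2, s3, inverse s1, inverse s2, inverse s3]"
    using card_length[of "[1, s1, s2, s3, inverse s1, inverse s2, inverse s3]"] by simp
  then have d: "distinct [1, s1, s2, s3, inverse s1, inverse s2, inverse s3]" by (rule card_distinct)
  have cs: "class_sum s1 s2 s3 b1 b2 b3 s1 = b1" "class_sum s1 s2 s3 b1 b2 b3 s2 = b2"
    "class_sum s1 s2 s3 b1 b2 b3 s3 = b3" "class_sum s1 s2 s3 b1 b2 b3 (inverse s1) = inverse b1"
    "class_sum s1 s2 s3 b1 b2 b3 1 = 0"
    using d by (auto simp: class_sum_def contrib_def)
  have sp: "s1 ^ 7 = 1" "s2 ^ 7 = 1" "s3 ^ 7 = 1" "inverse s1 ^ 7 = 1" using y unfolding class_triple_def by (auto simp: power_inverse)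
  have b: "b1 = - c" "b2 = - c" "b3 = - c" "inverse b1 = - c"
    using Q[OF sp(1)] Q[OF sp(2)] Q[OF sp(3)] Q[OF sp(4)] cs d by auto
  have prod: "b1 * b2 * b3 = 1" using y unfolding class_triple_def by simp
  then have "b1 \<noteq> 0" by auto
  then have "(- c) * (- c) = 1" using b by (metis right_inverse)
  then have "b3 = 1" using prod unfolding b(1,2) by simp
  then have c1: "- c = 1" using b(3) by simp
  then have bb: "b1 = 1" "b2 = 1" "b3 = 1" "c = -1" using b by (simp_all, metis minus_minus)
  have "class_sum 1 1 1 a1 a2 a3 1 = alpha a1 a2 a3" by (simp add: class_sum_def contrib_def alpha_def)
  then show ?thesis using c[of 1] cs(5) bb by simp
qed

text \<open>The terms of x lie in the classes 1, r1 and 1/r1. As c is not 0, y must meet the classes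
  \<open>r1 ^ 2\<close> and \<open>r1 ^ 3\<close>, and does so with two different members. Up to a
  permutation and an inversion of y this is the situation of \<open>sum_two_special\<close>.\<close>

lemma seven_one_nontrivial:
  assumes x: "class_triple 7 r1 r2 r3 a1 a2 a3" and y: "class_triple 7 s1 s2 s3 b1 b2 b3"
    and c: "\<And>\<eta>. \<eta> ^ 7 = 1 \<Longrightarrow> class_sum r1 r2 r3 a1 a2 a3 \<eta> - class_sum s1 s2 s3 b1 b2 b3 \<eta> = c"
    and c0: "c \<noteq> 0" and r: "r3 = 1" "r1 \<noteq> 1"
  shows "seven_sporadic a1 a2 a3 b1 b2 b3"
proof -
  have rp: "r1 ^ 7 = 1" "r1 * r2 = 1" and prod: "a1 * a2 * a3 = 1" using x r unfolding class_triple_def by auto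
  have r2: "r2 = inverse r1" using rp(2) by (metis inverse_unique)
  have p7: "prime (7::nat)" "(5::nat) \<le> 7" by simp_all
  note n = prime_root_neq[OF p7 rp(1) r(2)]
  have ne: "r1 ^ 2 \<noteq> r1" "r1 ^ 2 \<noteq> inverse r1" "r1 ^ 3 \<noteq> r1" "r1 ^ 3 \<noteq> inverse r1"
    using n r(2) by (auto simp: power2_eq_square power3_eq_cube eval_nat_numeral field_simps)
  have main: "seven_sporadic a1 a2 a3 b1 b2 b3"
    if y: "class_triple 7 s1 s2 s3 b1 b2 b3"
      and c: "\<And>\<eta>. \<eta> ^ 7 = 1 \<Longrightarrow> class_sum r1 r2 r3 a1 a2 a3 \<eta> - class_sum s1 s2 s3 b1 b2 b3 \<eta> = c"
      and s: "s1 = r1 ^ 2" "s2 = r1 ^ 3 \<or> s2 = r1 ^ 4"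
    for s1 s2 s3 b1 b2 b3
  proof -
    have yy: "b1 * b2 * b3 = 1" "r1 ^ 2 * s2 * s3 = 1" using y s unfolding class_triple_def by auto
    have "a3 ^ 2 + a3 + 1 = 0 \<and> a1 = a3 \<and> a2 = a3 \<and> b2 = 1 \<and> b1 ^ 3 = -1"
      by (rule sum_two_special[OF rp(1) r(2) prod yy(1) _ c0 s(2) yy(2)]) (use c s r r2 in simp)
    then show ?thesis unfolding seven_sporadic_def by auto
  qed
  have r47: "inverse (r1 ^ 3) = r1 ^ 4" "inverse (r1 ^ 4) = r1 ^ 3"
    using rp(1) by (auto intro!: inverse_unique simp flip: power_add)
  have main2: "seven_sporadic a1 a2 a3 b1 b2 b3"
    if y: "class_triple 7 s1 s2 s3 b1 b2 b3"
      and c: "\<And>\<eta>. \<eta> ^ 7 = 1 \<Longrightarrow> class_sum r1 r2 r3 a1 a2 a3 \<eta> - class_sum s1 s2 s3 b1 b2 b3 \<eta> = c"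
      and s: "s1 = r1 ^ 2 \<or> inverse s1 = r1 ^ 2" "s2 = r1 ^ 3 \<or> inverse s2 = r1 ^ 3"
    for s1 s2 s3 b1 b2 b3
    using s(1)
  proof
    assume "s1 = r1 ^ 2"
    then show ?thesis using main[OF y c] s(2) r47 by (metis inverse_inverse_eq)
  next
    assume s1: "inverse s1 = r1 ^ 2"
    have y': "class_triple 7 (inverse s1) (inverse s2) (inverse s3) (inverse b1) (inverse b2) (inverse b3)"
      using y by (simp only: class_triple_inverse)
    have "seven_sporadic a1 a2 a3 (inverse b1) (inverse b2) (inverse b3)"
      by (rule main[OF y' _ s1]) (use c s(2) r47 in \<open>auto simp only: class_sum_inverse inverse_inverse_eq\<close>)
    moreover have "b ^ 3 = -1" if "inverse b ^ 3 = -1" for b :: complex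
      using that by (metis inverse_inverse_eq inverse_minus_eq inverse_1 power_inverse)
    ultimately show ?thesis unfolding seven_sporadic_def by (auto simp: inverse_eq_1_iff)
  qed
  have r7: "(r1 ^ k) ^ 7 = 1" for k using rp(1) by (metis mult.commute power_mult power_one)
  have hit: "\<eta> \<in> {s1, s2, s3, inverse s1, inverse s2, inverse s3}" if "\<eta> \<in> {r1 ^ 2, r1 ^ 3}" for \<eta>
  proof (rule ccontr)
    assume "\<not> ?thesis"
    then have "class_sum s1 s2 s3 b1 b2 b3 \<eta> = 0" by (rule class_sum_eq_0)
    moreover have "class_sum r1 r2 r3 a1 a2 a3 \<eta> = 0"
      using that r r2 ne n by (intro class_sum_eq_0) auto
    moreover have "\<eta> ^ 7 = 1" using that r7 by blast
    ultimately show False using c c0 by force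
  qed
  have h2: "(s1 = r1^2 \<or> inverse s1 = r1^2) \<or> (s2 = r1^2 \<or> inverse s2 = r1^2) \<or> (s3 = r1^2 \<or> inverse s3 = r1^2)"
    using hit[of "r1 ^ 2"] by auto
  have h3: "(s1 = r1^3 \<or> inverse s1 = r1^3) \<or> (s2 = r1^3 \<or> inverse s2 = r1^3) \<or> (s3 = r1^3 \<or> inverse s3 = r1^3)"
    using hit[of "r1 ^ 3"] by auto
  \<comment> \<open>One member meeting both classes would give \<open>r1 ^ 2 = r1 ^ 3\<close> or
    \<open>r1 ^ 5 = 1\<close>.\<close>
  have no: "\<not> ((s = r1^2 \<or> inverse s = r1^2) \<and> (s = r1^3 \<or> inverse s = r1^3))" for s
  proof
    assume h: "(s = r1^2 \<or> inverse s = r1^2) \<and> (s = r1^3 \<or> inverse s = r1^3)"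
    have "r1 ^ 2 \<noteq> r1 ^ 3" using r(2) n(1) by (simp add: power3_eq_cube power2_eq_square)
    moreover have "r1 ^ 2 * r1 ^ 3 \<noteq> 1" using n(6) by (simp flip: power_add)
    moreover have "s \<noteq> 0" using h n(1) by auto
    ultimately show False using h by (metis left_inverse right_inverse)
  qed
  have perm: "seven_sporadic a1 a2 a3 b2 b1 b3 = seven_sporadic a1 a2 a3 b1 b2 b3"
    "seven_sporadic a1 a2 a3 b1 b3 b2 = seven_sporadic a1 a2 a3 b1 b2 b3" for b1 b2 b3
    unfolding seven_sporadic_def by auto
  have tp: "class_triple 7 s1 s3 s2 b1 b3 b2" "class_triple 7 s2 s1 s3 b2 b1 b3" "class_triple 7 s2 s3 s1 b2 b3 b1"
    "class_triple 7 s3 s1 s2 b3 b1 b2" "class_triple 7 s3 s2 s1 b3 b2 b1"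
    using y unfolding class_triple_def by (auto simp: mult_ac)
  have cp: "class_sum s1 s3 s2 b1 b3 b2 = class_sum s1 s2 s3 b1 b2 b3"
    "class_sum s2 s1 s3 b2 b1 b3 = class_sum s1 s2 s3 b1 b2 b3"
    "class_sum s2 s3 s1 b2 b3 b1 = class_sum s1 s2 s3 b1 b2 b3"
    "class_sum s3 s1 s2 b3 b1 b2 = class_sum s1 s2 s3 b1 b2 b3"
    "class_sum s3 s2 s1 b3 b2 b1 = class_sum s1 s2 s3 b1 b2 b3"
    by (auto simp: class_sum_def fun_eq_iff)
  from h2 h3 no[of s1] no[of s2] no[of s3] consider
      "s1 = r1^2 \<or> inverse s1 = r1^2" "s2 = r1^3 \<or> inverse s2 = r1^3"
    | "s1 = r1^2 \<or> inverse s1 = r1^2" "s3 = r1^3 \<or> inverse s3 = r1^3"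
    | "s2 = r1^2 \<or> inverse s2 = r1^2" "s1 = r1^3 \<or> inverse s1 = r1^3"
    | "s2 = r1^2 \<or> inverse s2 = r1^2" "s3 = r1^3 \<or> inverse s3 = r1^3"
    | "s3 = r1^2 \<or> inverse s3 = r1^2" "s1 = r1^3 \<or> inverse s1 = r1^3"
    | "s3 = r1^2 \<or> inverse s3 = r1^2" "s2 = r1^3 \<or> inverse s2 = r1^3"
    by blast
  then show ?thesis
  proof cases
    case 1 show ?thesis by (rule main2[OF y c 1])
  next
    case 2
    have "seven_sporadic a1 a2 a3 b1 b3 b2" by (rule main2[OF tp(1) _ 2]) (use c cp in simp)
    then show ?thesis using perm by metis
  next
    case 3
    have "seven_sporadic a1 a2 a3 b2 b1 b3" by (rule main2[OF tp(2) _ 3]) (use c cp in simp)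
    then show ?thesis using perm by metis
  next
    case 4
    have "seven_sporadic a1 a2 a3 b2 b3 b1" by (rule main2[OF tp(3) _ 4]) (use c cp in simp)
    then show ?thesis using perm by metis
  next
    case 5
    have "seven_sporadic a1 a2 a3 b3 b1 b2" by (rule main2[OF tp(4) _ 5]) (use c cp in simp)
    then show ?thesis using perm by metis
  next
    case 6
    have "seven_sporadic a1 a2 a3 b3 b2 b1" by (rule main2[OF tp(5) _ 6]) (use c cp in simp)
    then show ?thesis using perm by metis
  qed
qed

lemma seven_one:
  assumes x: "class_triple 7 r1 r2 r3 a1 a2 a3" and y: "class_triple 7 s1 s2 s3 b1 b2 b3"
    and c: "\<And>\<eta>. \<eta> ^ 7 = 1 \<Longrightarrow> class_sum r1 r2 r3 a1 a2 a3 \<eta> - class_sum s1 s2 s3 b1 b2 b3 \<eta> = c"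
    and c0: "c \<noteq> 0" and one: "1 \<in> {r1, r2, r3}"
  shows "seven_trivial r1 r2 r3 a1 a2 a3 b1 b2 b3 \<or> seven_sporadic a1 a2 a3 b1 b2 b3"
proof (cases "r1 = 1 \<and> r2 = 1 \<and> r3 = 1")
  case True
  then show ?thesis using seven_all_one[OF _ y _ c0, of a1 a2 a3] x c unfolding seven_trivial_def by simp
next
  case False
  have rrr: "r1 * r2 * r3 = 1" using x unfolding class_triple_def by simp
  have tp: "class_triple 7 r1 r3 r2 a1 a3 a2" "class_triple 7 r3 r2 r1 a3 a2 a1"
    using x unfolding class_triple_def by (auto simp: mult_ac)
  have cp: "class_sum r1 r3 r2 a1 a3 a2 = class_sum r1 r2 r3 a1 a2 a3"
    "class_sum r3 r2 r1 a3 a2 a1 = class_sum r1 r2 r3 a1 a2 a3"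
    by (auto simp: class_sum_def fun_eq_iff)
  have perm: "seven_sporadic a1 a3 a2 b1 b2 b3 = seven_sporadic a1 a2 a3 b1 b2 b3"
    "seven_sporadic a3 a2 a1 b1 b2 b3 = seven_sporadic a1 a2 a3 b1 b2 b3"
    unfolding seven_sporadic_def by (simp_all add: insert_commute)
  consider "r3 = 1" "r1 \<noteq> 1" | "r2 = 1" "r1 \<noteq> 1" | "r1 = 1" "r3 \<noteq> 1"
    using False one rrr by (cases "r3 = 1"; cases "r1 = 1") auto
  then have "seven_sporadic a1 a2 a3 b1 b2 b3"
  proof cases
    case 1 show ?thesis by (rule seven_one_nontrivial[OF x y c c0 1])
  next
    case 2
    have "seven_sporadic a1 a3 a2 b1 b2 b3" by (rule seven_one_nontrivial[OF tp(1) y _ c0 2]) (use c cp in simp)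
    then show ?thesis using perm by simp
  next
    case 3
    have "seven_sporadic a3 a2 a1 b1 b2 b3" by (rule seven_one_nontrivial[OF tp(2) y _ c0 3]) (use c cp in simp)
    then show ?thesis using perm by simp
  qed
  then show ?thesis ..
qed

text \<open>If neither triple meets the class 1, evaluation there gives c = 0. Otherwise
  \<open>seven_one\<close> applies, with the triples exchanged and c negated if necessary.\<close>

lemma seven_cases:
  assumes x: "class_triple 7 r1 r2 r3 a1 a2 a3" and y: "class_triple 7 s1 s2 s3 b1 b2 b3"
    and c: "\<And>\<eta>. \<eta> ^ 7 = 1 \<Longrightarrow> class_sum r1 r2 r3 a1 a2 a3 \<eta> - class_sum s1 s2 s3 b1 b2 b3 \<eta> = c"
  shows "c = 0 \<or> seven_trivial r1 r2 r3 a1 a2 a3 b1 b2 b3 \<or> seven_sporadic a1 a2 a3 b1 b2 b3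
    \<or> seven_trivial s1 s2 s3 b1 b2 b3 a1 a2 a3 \<or> seven_sporadic b1 b2 b3 a1 a2 a3"
proof (cases "1 \<in> {r1, r2, r3} \<or> 1 \<in> {s1, s2, s3}")
  case True
  have c': "class_sum s1 s2 s3 b1 b2 b3 \<eta> - class_sum r1 r2 r3 a1 a2 a3 \<eta> = - c" if "\<eta> ^ 7 = 1" for \<eta>
    using c[OF that] by (metis minus_diff_eq)
  show ?thesis using True seven_one[OF x y c] seven_one[OF y x c'] by fastforce
next
  case False
  then show ?thesis
    using c[of 1] class_sum_eq_0[of 1 r1 r2 r3 a1 a2 a3] class_sum_eq_0[of 1 s1 s2 s3 b1 b2 b3]
    by (auto simp: inverse_eq_1_iff)
qed


section \<open>The primes 3 and 2\<close>

lemma third_root_mem: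
  fixes a1 :: complex
  assumes "a1 + a2 + a3 = b1 + b2 + b3" "a1 * a2 + a1 * a3 + a2 * a3 = b1 * b2 + b1 * b3 + b2 * b3"
    and "a1 * a2 * a3 = b1 * b2 * b3"
  shows "a1 \<in> {b1, b2, b3}"
proof -
  have "(a1 - b1) * (a1 - b2) * (a1 - b3)
      = a1 * a1 * a1 - a1 * a1 * (b1 + b2 + b3) + a1 * (b1 * b2 + b1 * b3 + b2 * b3) - b1 * b2 * b3"
    by (simp add: algebra_simps)
  also have "\<dots> = 0" unfolding assms[symmetric] by (simp add: algebra_simps)
  finally show ?thesis by simp
qed

lemma cube_root_cases:
  fixes r s :: complex
  assumes "r ^ 3 = 1" "r \<noteq> 1" "s ^ 3 = 1" "s \<noteq> 1"
  shows "s = r \<or> s = inverse r"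
proof -
  have q: "z * z + z + 1 = 0" if "z ^ 3 = 1" "z \<noteq> 1" for z :: complex
  proof -
    have "(z - 1) * (z * z + z + 1) = z ^ 3 - 1" by (simp add: algebra_simps power3_eq_cube)
    then show ?thesis using that by simp
  qed
  have "(s - r) * (s + r + 1) = (s * s + s + 1) - (r * r + r + 1)" by (simp add: algebra_simps)
  then have "s = r \<or> s + r + 1 = 0" using q[OF assms(1,2)] q[OF assms(3,4)] by simp
  moreover have "inverse r = s" if "s + r + 1 = 0"
  proof (rule inverse_unique)
    have s: "s = - (r + 1)" using that unfolding eq_neg_iff_add_eq_0 by (simp only: add.assoc)
    have "r * s = - (r * r + r)" unfolding s by (simp add: algebra_simps)
    also have "\<dots> = 1" using q[OF assms(1,2)] by (metis add.inverse_inverse add_eq_0_iff2)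
    finally show "r * s = 1" .
  qed
  ultimately show ?thesis by auto
qed

lemma inverse_sum_unit:
  fixes a1 :: complex
  assumes "a1 * a2 * a3 = 1"
  shows "inverse a1 + inverse a2 + inverse a3 = a1 * a2 + a1 * a3 + a2 * a3"
proof -
  have "inverse a1 = a2 * a3" "inverse a2 = a1 * a3" "inverse a3 = a1 * a2"
    using assms by (auto intro!: inverse_unique simp: mult_ac)
  then show ?thesis by simp
qed

text \<open>A pair of inverse classes would make the third class 1, and there are only two
  nontrivial cube roots of unity.\<close>

lemma three_all_nontrivial:
  assumes "class_triple 3 r1 r2 r3 a1 a2 a3" "r1 \<noteq> 1" "r2 \<noteq> 1" "r3 \<noteq> 1"
  shows "r2 = r1 \<and> r3 = r1"
proof -
  have t: "r1 ^ 3 = 1" "r2 ^ 3 = 1" "r3 ^ 3 = 1" "r1 * r2 * r3 = 1" using assms(1) unfolding class_triple_def by auto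
  have "r1 \<noteq> 0" using t(1) by auto
  moreover have "r1 * r2 \<noteq> 1" using t(4) assms by auto
  moreover have "r1 * r3 \<noteq> 1" using t(4) assms by (metis mult.assoc mult.commute mult_1)
  ultimately have "r2 \<noteq> inverse r1" "r3 \<noteq> inverse r1" by auto
  then show ?thesis using cube_root_cases[OF t(1) assms(2) t(2) assms(3)] cube_root_cases[OF t(1) assms(2) t(3) assms(4)] by blast
qed

text \<open>The class sums at r and 1/r are the first and second elementary symmetric functions of
  the a_i, the second because a1 a2 a3 = 1. If y has a single nontrivial class too, then x and y, or
  x and the inverses of y, are roots of the same cubic. The hypotheses \<open>sq\<close> and
  \<open>small\<close> rule out that y meets the class 1, partly or entirely.\<close>

lemma three_equal:
  assumes x: "class_triple 3 r r r a1 a2 a3" and r1: "r \<noteq> 1" and y: "class_triple 3 s1 s2 s3 b1 b2 b3"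
    and eq: "class_sum r r r a1 a2 a3 = class_sum s1 s2 s3 b1 b2 b3"
    and small: "a1 ^ 3 \<noteq> 1" and sq: "b1 + inverse b1 \<noteq> 0" "b2 + inverse b2 \<noteq> 0" "b3 + inverse b3 \<noteq> 0"
  shows "common_root a1 a2 a3 b1 b2 b3"
proof -
  have rp: "r ^ 3 = 1" and pa: "a1 * a2 * a3 = 1" and pb: "b1 * b2 * b3 = 1" using x y unfolding class_triple_def by auto
  have r0: "r \<noteq> 0" using rp by auto
  have rr: "inverse r \<noteq> r"
  proof
    assume "inverse r = r"
    then have "r * r = 1" using r0 by (metis right_inverse)
    then show False using rp r1 by (simp add: power3_eq_cube)
  qed
  have cx: "class_sum r r r a1 a2 a3 r = a1 + a2 + a3"
    "class_sum r r r a1 a2 a3 (inverse r) = inverse a1 + inverse a2 + inverse a3"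
    "class_sum r r r a1 a2 a3 1 = 0"
    using rr r1 by (auto simp: class_sum_def contrib_def inverse_eq_1_iff)
  have nz: "\<not> (class_sum r r r a1 a2 a3 r = 0 \<and> class_sum r r r a1 a2 a3 (inverse r) = 0)"
  proof
    assume "class_sum r r r a1 a2 a3 r = 0 \<and> class_sum r r r a1 a2 a3 (inverse r) = 0"
    then have e: "a1 + a2 + a3 = 0" "a1 * a2 + a1 * a3 + a2 * a3 = 0" using cx inverse_sum_unit[OF pa] by auto
    have "a1 * a1 * a1 = a1 * a1 * (a1 + a2 + a3) - a1 * (a1 * a2 + a1 * a3 + a2 * a3) + a1 * a2 * a3"
      by (simp add: algebra_simps)
    then have "a1 ^ 3 = 1" using e pa by (simp add: power3_eq_cube)
    then show False using small by simp
  qed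
  have one: "s1 \<noteq> 1 \<and> s2 \<noteq> 1 \<and> s3 \<noteq> 1"
  proof (rule ccontr)
    assume s: "\<not> ?thesis"
    have sss: "s1 * s2 * s3 = 1" using y unfolding class_triple_def by simp
    show False
    proof (cases "s1 = 1 \<and> s2 = 1 \<and> s3 = 1")
      case True
      then have "class_sum s1 s2 s3 b1 b2 b3 r = 0" "class_sum s1 s2 s3 b1 b2 b3 (inverse r) = 0"
        using r1 by (auto simp: class_sum_def contrib_def inverse_eq_1_iff)
      then show False using nz eq by simp
    next
      case False
      then consider "s3 = 1" "s1 \<noteq> 1" "s2 \<noteq> 1" | "s2 = 1" "s1 \<noteq> 1" "s3 \<noteq> 1" | "s1 = 1" "s2 \<noteq> 1" "s3 \<noteq> 1"
        using s sss by (cases "s3 = 1"; cases "s1 = 1"; cases "s2 = 1") auto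
      then have "class_sum s1 s2 s3 b1 b2 b3 1 \<in> {b1 + inverse b1, b2 + inverse b2, b3 + inverse b3}"
        by cases (auto simp: class_sum_def contrib_def inverse_eq_1_iff)
      then show False using cx(3) eq sq by auto
    qed
  qed
  then have s: "s2 = s1" "s3 = s1" using three_all_nontrivial[OF y] by auto
  have "s1 ^ 3 = 1" using y unfolding class_triple_def by simp
  with one have "s1 = r \<or> s1 = inverse r" using cube_root_cases[OF rp r1] by blast
  then show ?thesis
  proof
    assume s1: "s1 = r"
    then have "class_sum s1 s2 s3 b1 b2 b3 r = b1 + b2 + b3"
      "class_sum s1 s2 s3 b1 b2 b3 (inverse r) = inverse b1 + inverse b2 + inverse b3"
      using rr s by (auto simp: class_sum_def contrib_def)
    then have "a1 \<in> {b1, b2, b3}"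
      using third_root_mem[of a1 a2 a3 b1 b2 b3] cx eq inverse_sum_unit[OF pa] inverse_sum_unit[OF pb] pa pb by metis
    then show ?thesis unfolding common_root_def by blast
  next
    assume s1: "s1 = inverse r"
    then have e: "class_sum s1 s2 s3 b1 b2 b3 (inverse r) = b1 + b2 + b3"
      "class_sum s1 s2 s3 b1 b2 b3 r = inverse b1 + inverse b2 + inverse b3"
      using rr s by (auto simp: class_sum_def contrib_def)
    have pb': "inverse b1 * inverse b2 * inverse b3 = 1" using pb by (metis inverse_1 inverse_mult_distrib)
    have "a1 \<in> {inverse b1, inverse b2, inverse b3}"
      using third_root_mem[of a1 a2 a3 "inverse b1" "inverse b2" "inverse b3"] cx eq e
        inverse_sum_unit[OF pa] inverse_sum_unit[OF pb'] pa pb' by (metis inverse_inverse_eq)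
    then show ?thesis unfolding common_root_def by blast
  qed
qed

lemma class_analysis_three:
  assumes x: "class_triple 3 r1 r2 r3 a1 a2 a3" and y: "class_triple 3 s1 s2 s3 b1 b2 b3"
    and eq: "class_sum r1 r2 r3 a1 a2 a3 = class_sum s1 s2 s3 b1 b2 b3"
    and nt: "\<not> (r1 = 1 \<and> r2 = 1 \<and> r3 = 1)"
    and small: "r1 \<noteq> 1 \<Longrightarrow> a1 ^ 3 \<noteq> 1" "s1 \<noteq> 1 \<Longrightarrow> b1 ^ 3 \<noteq> 1"
    and sq: "\<forall>a\<in>{a1, a2, a3, b1, b2, b3}. a + inverse a \<noteq> 0"
  shows "common_root a1 a2 a3 b1 b2 b3 \<or> -1 \<in> {a1, a2, a3}"
proof (cases "r1 \<noteq> 1 \<and> r2 \<noteq> 1 \<and> r3 \<noteq> 1")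
  case True
  then have "r2 = r1" "r3 = r1" using three_all_nontrivial[OF x] by auto
  then show ?thesis using three_equal[of r1 a1 a2 a3 s1 s2 s3 b1 b2 b3] True x y eq small sq by auto
next
  case r: False
  show ?thesis
  proof (cases "s1 \<noteq> 1 \<and> s2 \<noteq> 1 \<and> s3 \<noteq> 1")
    case True
    then have "s2 = s1" "s3 = s1" using three_all_nontrivial[OF y] by auto
    then have "common_root b1 b2 b3 a1 a2 a3"
      using three_equal[of s1 b1 b2 b3 r1 r2 r3 a1 a2 a3] True x y eq small sq by auto
    then show ?thesis by (simp add: common_root_sym)
  next
    case s: False
    have rr: "r * r \<noteq> 1" if "r ^ 3 = 1" "r \<noteq> 1" for r :: complex
      using that by (auto simp: power3_eq_cube)
    have rrr: "r1 * r2 * r3 = 1" "r1 ^ 3 = 1" "r2 ^ 3 = 1" "r3 ^ 3 = 1" using x unfolding class_triple_def by auto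
    have stepx: "common_root a1 a2 a3 b1 b2 b3 \<or> -1 \<in> {a1, a2, a3}"
      if s: "s3 = 1" and y: "class_triple 3 s1 s2 s3 b1 b2 b3"
        and eq: "class_sum r1 r2 r3 a1 a2 a3 = class_sum s1 s2 s3 b1 b2 b3" for s1 s2 s3 b1 b2 b3
    proof -
      consider "r3 = 1" "r1 \<noteq> 1" | "r2 = 1" "r1 \<noteq> 1" | "r1 = 1" "r3 \<noteq> 1"
        using r nt rrr(1) by (cases "r3 = 1"; cases "r1 = 1") auto
      then show ?thesis
      proof cases
        case 1
        then show ?thesis using class_analysis_one[OF 1 rr[OF rrr(2) 1(2)] s x y eq] by blast
      next
        case 2
        have "common_root a1 a3 a2 b1 b2 b3 \<or> a2 = -1"
          by (rule class_analysis_one[OF 2 rr[OF rrr(2) 2(2)] s _ y]) (use x eq in \<open>simp_all add: class_triple_perm class_sum_perm\<close>)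
        then show ?thesis by (auto simp: common_root_perm)
      next
        case 3
        have "common_root a3 a2 a1 b1 b2 b3 \<or> a1 = -1"
          by (rule class_analysis_one[OF 3 rr[OF rrr(4) 3(2)] s _ y]) (use x eq in \<open>simp_all add: class_triple_perm class_sum_perm\<close>)
        then show ?thesis by (auto simp: common_root_perm)
      qed
    qed
    consider "s3 = 1" | "s2 = 1" | "s1 = 1" using s by blast
    then show ?thesis
    proof cases
      case 1
      then show ?thesis using stepx[OF 1 y eq] by blast
    next
      case 2
      then show ?thesis using stepx[OF 2, of s1 s3 b1 b3 b2] y eq
        by (simp add: class_triple_perm class_sum_perm common_root_perm)
    next
      case 3
      then show ?thesis using stepx[OF 3, of s3 s2 b3 b2 b1] y eq
        by (simp add: class_triple_perm class_sum_perm common_root_perm)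
    qed
  qed
qed

text \<open>The class -1 is its own inverse, so a term there counts together with its inverse. If y
  has only the class 1, the class -1 gives (1 + a3) (a1 + a2) = 0 up to order, which is where
  triples with opposite members come from. Otherwise the class 1 gives a3 + 1/a3 = b3 +
  1/b3.\<close>

lemma class_analysis_two:
  assumes x: "class_triple 2 r1 r2 r3 a1 a2 a3" and y: "class_triple 2 s1 s2 s3 b1 b2 b3"
    and eq: "class_sum r1 r2 r3 a1 a2 a3 = class_sum s1 s2 s3 b1 b2 b3"
    and nt: "\<not> (r1 = 1 \<and> r2 = 1 \<and> r3 = 1)"
  shows "common_root a1 a2 a3 b1 b2 b3 \<or> -1 \<in> {a1, a2, a3} \<or> a1 = - a2 \<or> a1 = - a3 \<or> a2 = - a3"
proof -
  have pm: "r = 1 \<or> r = -1" if "r ^ 2 = 1" for r :: complex using that by (simp add: power2_eq_1_iff)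
  have core: "common_root a1 a2 a3 b1 b2 b3 \<or> a3 = -1 \<or> a1 = - a2"
    if x: "class_triple 2 (-1) (-1) 1 a1 a2 a3" and y: "class_triple 2 s1 s2 s3 b1 b2 b3" and s: "s3 = 1"
      and eq: "class_sum (-1) (-1) 1 a1 a2 a3 = class_sum s1 s2 s3 b1 b2 b3"
    for a1 a2 a3 s1 s2 s3 b1 b2 b3
  proof -
    have pa: "a1 * a2 * a3 = 1" and pb: "b1 * b2 * b3 = 1" and ss: "s1 ^ 2 = 1" "s1 * s2 = 1"
      using x y s unfolding class_triple_def by auto
    show ?thesis
    proof (cases "s1 = 1")
      case True
      then have "s2 = 1" using ss by simp
      then have "class_sum s1 s2 s3 b1 b2 b3 (-1) = 0" using True s by (simp add: class_sum_def contrib_def)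
      moreover have "class_sum (-1) (-1) 1 a1 a2 a3 (-1) = a1 + inverse a1 + (a2 + inverse a2)"
        by (simp add: class_sum_def contrib_def)
      ultimately have z: "a1 + inverse a1 + (a2 + inverse a2) = 0" using eq by metis
      have "inverse a1 = a2 * a3" "inverse a2 = a1 * a3" using pa by (auto intro!: inverse_unique simp: mult_ac)
      then have "(1 + a3) * (a1 + a2) = 0" using z by (simp add: algebra_simps)
      then show ?thesis by (simp add: add_eq_0_iff) (auto simp: add_eq_0_iff2)
    next
      case False
      then have s1: "s1 = -1" using pm[OF ss(1)] by simp
      then have s2: "s2 = -1" using ss(2) s1 by (metis mult_minus1 minus_minus)
      have "class_sum s1 s2 s3 b1 b2 b3 1 = b3 + inverse b3" using s s1 s2 by (simp add: class_sum_def contrib_def)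
      moreover have "class_sum (-1) (-1) 1 a1 a2 a3 1 = a3 + inverse a3" by (simp add: class_sum_def contrib_def)
      ultimately have sums: "a3 + inverse a3 = b3 + inverse b3" using eq by metis
      have "a3 \<noteq> 0" "b3 \<noteq> 0" using pa pb by auto
      then have "{#a3, inverse a3#} = {#b3, inverse b3#}" using sums by (intro two_roots_eq) auto
      then have "a3 \<in> {b3, inverse b3}" by (metis insert_iff set_mset_add_mset_insert set_mset_empty)
      then show ?thesis unfolding common_root_def by blast
    qed
  qed
  have sss: "s1 = 1 \<or> s2 = 1 \<or> s3 = 1"
    using y pm[of s1] pm[of s2] pm[of s3] unfolding class_triple_def by auto
  have stepx: "common_root a1 a2 a3 b1 b2 b3 \<or> -1 \<in> {a1, a2, a3} \<or> a1 = - a2 \<or> a1 = - a3 \<or> a2 = - a3"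
    if s: "s3 = 1" and y: "class_triple 2 s1 s2 s3 b1 b2 b3"
      and eq: "class_sum r1 r2 r3 a1 a2 a3 = class_sum s1 s2 s3 b1 b2 b3"
    for s1 s2 s3 b1 b2 b3
  proof -
    have "r1 * r2 * r3 = 1" using x unfolding class_triple_def by simp
    then consider "r1 = -1" "r2 = -1" "r3 = 1" | "r1 = -1" "r3 = -1" "r2 = 1" | "r3 = -1" "r2 = -1" "r1 = 1"
      using x pm[of r1] pm[of r2] pm[of r3] nt unfolding class_triple_def by auto
    then show ?thesis
    proof cases
      case 1
      then show ?thesis using core[OF _ y s, of a1 a2 a3] x eq by auto
    next
      case 2
      have "common_root a1 a3 a2 b1 b2 b3 \<or> a2 = -1 \<or> a1 = - a3"
        by (rule core[OF _ y s]) (use 2 x eq class_triple_perm(2)[of 2 r1 r2 r3] class_sum_perm(2)[of r1 r2 r3] in \<open>simp_all add: fun_eq_iff\<close>)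
      then show ?thesis by (auto simp: common_root_perm)
    next
      case 3
      have "common_root a3 a2 a1 b1 b2 b3 \<or> a1 = -1 \<or> a3 = - a2"
        by (rule core[OF _ y s]) (use 3 x eq class_triple_perm(3)[of 2 r1 r2 r3] class_sum_perm(3)[of r1 r2 r3] in \<open>simp_all add: fun_eq_iff\<close>)
      then show ?thesis by (auto simp: common_root_perm)
    qed
  qed
  from sss show ?thesis
  proof (elim disjE)
    assume s: "s3 = 1"
    show ?thesis by (rule stepx[OF s y eq])
  next
    assume s: "s2 = 1"
    have "class_triple 2 s1 s3 s2 b1 b3 b2" using y by (auto simp: class_triple_def mult_ac)
    moreover have "class_sum r1 r2 r3 a1 a2 a3 = class_sum s1 s3 s2 b1 b3 b2"
      unfolding eq by (auto simp: class_sum_def fun_eq_iff)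
    ultimately show ?thesis using stepx[OF s, of s1 s3 b1 b3 b2] by (simp add: common_root_perm)
  next
    assume s: "s1 = 1"
    have "class_triple 2 s3 s2 s1 b3 b2 b1" using y by (auto simp: class_triple_def mult_ac)
    moreover have "class_sum r1 r2 r3 a1 a2 a3 = class_sum s3 s2 s1 b3 b2 b1"
      unfolding eq by (auto simp: class_sum_def fun_eq_iff)
    ultimately show ?thesis using stepx[OF s, of s3 s2 b3 b2 b1] by (simp add: common_root_perm)
  qed
qed

section \<open>Relations between generating triples\<close>


definition unity_triple :: "nat \<Rightarrow> complex \<Rightarrow> complex \<Rightarrow> complex \<Rightarrow> bool" where
  "unity_triple m x1 x2 x3 \<longleftrightarrow> x1 ^ m = 1 \<and> x2 ^ m = 1 \<and> x3 ^ m = 1 \<and> x1 * x2 * x3 = 1"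

text \<open>For m-th roots of unity this says that the three together generate the whole group of
  m-th roots of unity.\<close>

definition generating :: "nat \<Rightarrow> complex \<Rightarrow> complex \<Rightarrow> complex \<Rightarrow> bool" where
  "generating m x1 x2 x3 \<longleftrightarrow> (\<forall>t. x1 ^ t = 1 \<and> x2 ^ t = 1 \<and> x3 ^ t = 1 \<longrightarrow> m dvd t)"

lemma norm_root_unity: "m > 0 \<Longrightarrow> z ^ m = 1 \<Longrightarrow> norm (z :: complex) = 1"
  using power_eq_1_iff[of z m] by auto

lemma class_triple_power:
  assumes "unity_triple m x1 x2 x3" "m > 0" "m dvd s * p"
  shows "class_triple p (x1 ^ s) (x2 ^ s) (x3 ^ s) x1 x2 x3"
proof -
  have pw: "(z ^ s) ^ p = 1" if "z ^ m = 1" for z :: complex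
  proof -
    obtain k where "s * p = m * k" using assms(3) by (auto simp: dvd_def)
    then show ?thesis using that by (metis power_mult power_one)
  qed
  have "x1 ^ s * x2 ^ s * x3 ^ s = (x1 * x2 * x3) ^ s" by (simp add: power_mult_distrib)
  then show ?thesis
    using assms(1,2) pw norm_root_unity[OF assms(2)] unfolding class_triple_def unity_triple_def by auto
qed

lemma class_triple_quotient:
  assumes "class_triple p r1 r2 r3 x1 x2 x3" "p > 0"
  shows "class_triple p r1 r2 r3 (x1 * inverse r1) (x2 * inverse r2) (x3 * inverse r3)"
proof -
  have n: "norm r1 = 1" "norm r2 = 1" "norm r3 = 1"
    using assms norm_root_unity[of p] unfolding class_triple_def by auto
  have "x1 * inverse r1 * (x2 * inverse r2) * (x3 * inverse r3) = (x1 * x2 * x3) * inverse (r1 * r2 * r3)"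
    by (simp add: inverse_mult_distrib mult_ac)
  then show ?thesis using assms n unfolding class_triple_def by (auto simp: norm_mult norm_inverse)
qed

lemma class_sum_outside:
  assumes "class_triple p r1 r2 r3 a1 a2 a3" "\<eta> ^ p \<noteq> 1"
  shows "class_sum r1 r2 r3 a1 a2 a3 \<eta> = 0"
  using assms by (intro class_sum_eq_0) (auto simp: class_triple_def power_inverse)

section \<open>Class sums of the relation between two triples\<close>

lemma class_sums_equal_square:
  assumes p: "prime p" "p ^ 2 dvd m" and m: "m > 0"
    and x: "unity_triple m x1 x2 x3" and y: "unity_triple m y1 y2 y3" and al: "alpha x1 x2 x3 = alpha y1 y2 y3"
  shows "class_sum (x1 ^ (m div p)) (x2 ^ (m div p)) (x3 ^ (m div p)) x1 x2 x3
    = class_sum (y1 ^ (m div p)) (y2 ^ (m div p)) (y3 ^ (m div p)) y1 y2 y3"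
proof
  fix \<eta>
  let ?L = "[(1, x1), (1, x2), (1, x3), (1, inverse x1), (1, inverse x2), (1, inverse x3),
    (-1, y1), (-1, y2), (-1, y3), (-1, inverse y1), (-1, inverse y2), (-1, inverse y3)] :: (int \<times> complex) list"
  have L: "z ^ m = 1" if "(a, z) \<in> set ?L" for a z
    using that x y unfolding unity_triple_def by (auto simp: power_inverse)
  have eq: "(\<Sum>(a,z)\<leftarrow>?L. of_int a * z) = 0" using al by (simp add: alpha_def algebra_simps)
  have neg: "(if P then - z else 0) = - (if P then z else 0)" for P and z :: complex by simp
  have A: "(\<Sum>(a,z)\<leftarrow>?L. if z ^ (m div p) = \<eta> then of_int a * z else 0) = 0"
    by (rule class_sum_square[OF p m _ eq]) (rule L)
  have B: "(\<Sum>(a,z)\<leftarrow>?L. if z ^ (m div p) = \<eta> then of_int a * z else 0) =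
    class_sum (x1 ^ (m div p)) (x2 ^ (m div p)) (x3 ^ (m div p)) x1 x2 x3 \<eta>
    - class_sum (y1 ^ (m div p)) (y2 ^ (m div p)) (y3 ^ (m div p)) y1 y2 y3 \<eta>"
    by (simp add: class_sum_def contrib_def power_inverse neg split del: if_split cong: if_cong)
  from A[unfolded B] show "class_sum (x1 ^ (m div p)) (x2 ^ (m div p)) (x3 ^ (m div p)) x1 x2 x3 \<eta>
    = class_sum (y1 ^ (m div p)) (y2 ^ (m div p)) (y3 ^ (m div p)) y1 y2 y3 \<eta>"
    by (simp only: right_minus_eq)
qed

lemma class_sums_differ_const:
  assumes p: "prime p" and m: "m = p * N" "m > 0" and s: "[s = 1] (mod p)" "N dvd s"
    and x: "unity_triple m x1 x2 x3" and y: "unity_triple m y1 y2 y3" and al: "alpha x1 x2 x3 = alpha y1 y2 y3"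
  obtains c where "\<And>\<eta>. \<eta> ^ p = 1 \<Longrightarrow>
    class_sum (x1 ^ s) (x2 ^ s) (x3 ^ s) (x1 * inverse (x1 ^ s)) (x2 * inverse (x2 ^ s)) (x3 * inverse (x3 ^ s)) \<eta>
    - class_sum (y1 ^ s) (y2 ^ s) (y3 ^ s) (y1 * inverse (y1 ^ s)) (y2 * inverse (y2 ^ s)) (y3 * inverse (y3 ^ s)) \<eta> = c"
proof -
  let ?L = "[(1, x1), (1, x2), (1, x3), (1, inverse x1), (1, inverse x2), (1, inverse x3),
    (-1, y1), (-1, y2), (-1, y3), (-1, inverse y1), (-1, inverse y2), (-1, inverse y3)] :: (int \<times> complex) list"
  have L: "z ^ m = 1" if "(a, z) \<in> set ?L" for a z
    using that x y unfolding unity_triple_def by (auto simp: power_inverse)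
  have eq: "(\<Sum>(a,z)\<leftarrow>?L. of_int a * z) = 0" using al by (simp add: alpha_def algebra_simps)
  have N: "N > 0" using m by (cases N) auto
  have neg: "(if P then - z else 0) = - (if P then z else 0)" for P and z :: complex by simp
  show ?thesis
  proof (rule class_sum_coprime[OF p m(1) N s _ eq])
    fix a z assume "(a, z) \<in> set ?L"
    then show "z ^ m = 1" by (rule L)
  next
    fix c assume c: "\<And>\<eta>. \<eta> ^ p = 1 \<Longrightarrow>
       (\<Sum>(a,z)\<leftarrow>?L. if z ^ s = \<eta> then of_int a * (z * inverse (z ^ s)) else 0) = c"
    show ?thesis
    proof (rule that[of c])
      fix \<eta> :: complex assume e: "\<eta> ^ p = 1"
      have B: "(\<Sum>(a,z)\<leftarrow>?L. if z ^ s = \<eta> then of_int a * (z * inverse (z ^ s)) else 0) =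
        class_sum (x1 ^ s) (x2 ^ s) (x3 ^ s) (x1 * inverse (x1 ^ s)) (x2 * inverse (x2 ^ s)) (x3 * inverse (x3 ^ s)) \<eta>
        - class_sum (y1 ^ s) (y2 ^ s) (y3 ^ s) (y1 * inverse (y1 ^ s)) (y2 * inverse (y2 ^ s)) (y3 * inverse (y3 ^ s)) \<eta>"
        by (simp add: class_sum_def contrib_def power_inverse neg inverse_mult_distrib split del: if_split cong: if_cong)
      from c[OF e, unfolded B] show "class_sum (x1 ^ s) (x2 ^ s) (x3 ^ s) (x1 * inverse (x1 ^ s)) (x2 * inverse (x2 ^ s)) (x3 * inverse (x3 ^ s)) \<eta>
        - class_sum (y1 ^ s) (y2 ^ s) (y3 ^ s) (y1 * inverse (y1 ^ s)) (y2 * inverse (y2 ^ s)) (y3 * inverse (y3 ^ s)) \<eta> = c" .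
    qed
  qed
qed

text \<open>Whatever contributes to the class \<eta>, be it a term or an inverse, acquires the same
  factor \<eta>. This restores the p-parts after the comparison of cofactors.\<close>

lemma class_sum_rescale:
  "class_sum r1 r2 r3 (r1 * a1) (r2 * a2) (r3 * a3) \<eta> = \<eta> * class_sum r1 r2 r3 a1 a2 a3 \<eta>"
proof -
  have *: "contrib \<eta> r (r * a) = \<eta> * contrib \<eta> r a" for r a
    by (auto simp: contrib_def inverse_mult_distrib algebra_simps)
  show ?thesis unfolding class_sum_def * by (simp only: distrib_left)
qed

lemma class_sums_equal_of_const_zero:
  assumes x: "class_triple p r1 r2 r3 x1 x2 x3" and y: "class_triple p s1 s2 s3 y1 y2 y3" and p: "p > 0"
    and c: "\<And>\<eta>. \<eta> ^ p = 1 \<Longrightarrow>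
    class_sum r1 r2 r3 (x1 * inverse r1) (x2 * inverse r2) (x3 * inverse r3) \<eta>
    - class_sum s1 s2 s3 (y1 * inverse s1) (y2 * inverse s2) (y3 * inverse s3) \<eta> = 0"
  shows "class_sum r1 r2 r3 x1 x2 x3 = class_sum s1 s2 s3 y1 y2 y3"
proof
  fix \<eta>
  have nz: "r1 \<noteq> 0" "r2 \<noteq> 0" "r3 \<noteq> 0" "s1 \<noteq> 0" "s2 \<noteq> 0" "s3 \<noteq> 0" using x y p unfolding class_triple_def by (auto simp: power_0_left)
  show "class_sum r1 r2 r3 x1 x2 x3 \<eta> = class_sum s1 s2 s3 y1 y2 y3 \<eta>"
  proof (cases "\<eta> ^ p = 1")
    case True
    have e: "r * (z * inverse r) = z" if "r \<noteq> 0" for r z :: complex using that by simp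
    show ?thesis
      using class_sum_rescale[of r1 r2 r3 "x1 * inverse r1" "x2 * inverse r2" "x3 * inverse r3" \<eta>]
        class_sum_rescale[of s1 s2 s3 "y1 * inverse s1" "y2 * inverse s2" "y3 * inverse s3" \<eta>]
        c[OF True] unfolding e[OF nz(1)] e[OF nz(2)] e[OF nz(3)] e[OF nz(4)] e[OF nz(5)] e[OF nz(6)] by simp
  next
    case False
    then show ?thesis using class_sum_outside[OF x] class_sum_outside[OF y] by simp
  qed
qed

section \<open>Finding a common root\<close>

lemma generating_not_trivial:
  assumes "generating m x1 x2 x3" "\<not> m dvd s"
  shows "\<not> (x1 ^ s = 1 \<and> x2 ^ s = 1 \<and> x3 ^ s = 1)"
  using assms unfolding generating_def by blast

lemma not_dvd_div_prime:
  assumes "prime p" "p dvd m" "(m::nat) > 0"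
  shows "\<not> m dvd m div p"
proof
  assume d: "m dvd m div p"
  have "m div p > 0" using assms by (auto elim!: dvdE)
  then have "m \<le> m div p" using d dvd_imp_le by blast
  moreover have "m div p < m" using assms prime_gt_1_nat by (intro div_less_dividend) auto
  ultimately show False by simp
qed

text \<open>The roles are asymmetric: x generates, whereas the second triple will be a power of a
  generating triple with unknown exponent.\<close>

context
  fixes m x1 x2 x3 y1 y2 y3
  assumes m: "m > 0" and x: "unity_triple m x1 x2 x3" and y: "unity_triple m y1 y2 y3"
    and al: "alpha x1 x2 x3 = alpha y1 y2 y3" and gen: "generating m x1 x2 x3"
begin

text \<open>The last claim removes the exceptional solutions at 3 and 5: since p divides
  \<open>m div p\<close>, every p-th root of unity lies in the class 1.\<close>

lemma relation_square:
  assumes p: "prime p" "p ^ 2 dvd m"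
  shows "class_triple p (x1 ^ (m div p)) (x2 ^ (m div p)) (x3 ^ (m div p)) x1 x2 x3"
    "class_triple p (y1 ^ (m div p)) (y2 ^ (m div p)) (y3 ^ (m div p)) y1 y2 y3"
    "\<not> (x1 ^ (m div p) = 1 \<and> x2 ^ (m div p) = 1 \<and> x3 ^ (m div p) = 1)"
    "z ^ p = 1 \<Longrightarrow> z ^ (m div p) = (1 :: complex)"
proof -
  have d: "p dvd m" using p(2) dvd_trans[of p "p ^ 2" m] by simp
  show "class_triple p (x1 ^ (m div p)) (x2 ^ (m div p)) (x3 ^ (m div p)) x1 x2 x3"
    "class_triple p (y1 ^ (m div p)) (y2 ^ (m div p)) (y3 ^ (m div p)) y1 y2 y3"
    using d by (auto intro!: class_triple_power x y m)
  show "\<not> (x1 ^ (m div p) = 1 \<and> x2 ^ (m div p) = 1 \<and> x3 ^ (m div p) = 1)"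
    by (rule generating_not_trivial[OF gen not_dvd_div_prime[OF p(1) d m]])
  assume z: "z ^ p = 1"
  obtain k where k: "m = p ^ 2 * k" using p(2) by (elim dvdE)
  have "m div p = p * k" unfolding k using prime_gt_0_nat[OF p(1)] by (simp add: power2_eq_square mult.assoc)
  then show "z ^ (m div p) = 1" using z by (simp add: power_mult)
qed

lemma relation_4:
  assumes "4 dvd m"
  shows "common_root x1 x2 x3 y1 y2 y3 \<or> -1 \<in> {x1, x2, x3} \<or> x1 = - x2 \<or> x1 = - x3 \<or> x2 = - x3"
proof -
  have p: "prime (2::nat)" "2 ^ 2 dvd m" using assms by simp_all
  show ?thesis
    by (rule class_analysis_two[OF relation_square(1,2)[OF p] class_sums_equal_square[OF p m x y al] relation_square(3)[OF p]])
qed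

text \<open>A vanishing sum means \<open>z ^ 2 = -1\<close>, so that z has order 4.\<close>

lemma sum_inverse_nonzero:
  assumes "\<not> 4 dvd m" "z ^ m = (1 :: complex)"
  shows "z + inverse z \<noteq> 0"
proof
  assume h: "z + inverse z = 0"
  have "z \<noteq> 0" using assms(2) m by (metis power_0_left not_gr_zero zero_neq_one)
  then have z2: "z ^ 2 = -1" using h by (simp add: power2_eq_square field_simps add_eq_0_iff)
  have "z ^ (2 * m) = (-1) ^ m" using z2 by (simp add: power_mult)
  moreover have "z ^ (2 * m) = 1" using assms(2) by (metis mult.commute power_mult power_one)
  ultimately have "even m" by (metis neg_one_odd_power one_neq_neg_one)
  then obtain k where k: "m = 2 * k" by blast
  have "(-1::complex) ^ k = 1" using assms(2) z2 unfolding k by (simp add: power_mult)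
  then have "even k" by (metis neg_one_odd_power one_neq_neg_one)
  then show False using assms(1) k by auto
qed

lemma relation_9:
  assumes "9 dvd m" "\<not> 4 dvd m"
  shows "common_root x1 x2 x3 y1 y2 y3 \<or> -1 \<in> {x1, x2, x3}"
proof -
  have p: "prime (3::nat)" "3 ^ 2 dvd m" using assms by simp_all
  show ?thesis
    by (rule class_analysis_three[OF relation_square(1,2)[OF p] class_sums_equal_square[OF p m x y al] relation_square(3)[OF p]])
      (use relation_square(4)[OF p] sum_inverse_nonzero[OF assms(2)] x y in \<open>auto simp: unity_triple_def power_inverse\<close>)
qed

lemma relation_large_square:
  assumes p: "prime p" "p ^ 2 dvd m" and p5: "p \<ge> 5"
  shows "common_root x1 x2 x3 y1 y2 y3 \<or> -1 \<in> {x1, x2, x3}"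
  by (rule class_analysis[OF p(1) p5 relation_square(1,2)[OF p] class_sums_equal_square[OF p m x y al] relation_square(3)[OF p]])
    (use relation_square(4)[OF p] in auto)

text \<open>With m = p N, the exponent s is N times an inverse of N modulo p. As m does not divide
  s, the generating triple x has a nontrivial class.\<close>

lemma relation_const:
  assumes p: "prime p" "p dvd m" "\<not> p ^ 2 dvd m"
  obtains s c where "[s = 1] (mod p)" "m dvd s * p"
    "class_triple p (x1 ^ s) (x2 ^ s) (x3 ^ s) x1 x2 x3" "class_triple p (y1 ^ s) (y2 ^ s) (y3 ^ s) y1 y2 y3"
    "\<not> (x1 ^ s = 1 \<and> x2 ^ s = 1 \<and> x3 ^ s = 1)"
    "\<And>\<eta>. \<eta> ^ p = 1 \<Longrightarrow>
    class_sum (x1 ^ s) (x2 ^ s) (x3 ^ s) (x1 * inverse (x1 ^ s)) (x2 * inverse (x2 ^ s)) (x3 * inverse (x3 ^ s)) \<eta>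
    - class_sum (y1 ^ s) (y2 ^ s) (y3 ^ s) (y1 * inverse (y1 ^ s)) (y2 * inverse (y2 ^ s)) (y3 * inverse (y3 ^ s)) \<eta> = c"
proof -
  obtain N where N: "m = p * N" using p(2) by (elim dvdE)
  have "\<not> p dvd N" using p(3) N by (auto simp: power2_eq_square)
  then have "coprime p N" using p(1) prime_imp_coprime by blast
  then have "coprime N p" by (simp add: coprime_commute)
  then obtain q where q: "[N * q = 1] (mod p)" using cong_solve_coprime_nat[of N p] by auto
  define s where "s = N * q"
  have s: "[s = 1] (mod p)" "N dvd s" using q unfolding s_def by auto
  have ms: "m dvd s * p" unfolding N s_def by (simp add: mult.commute)
  have nd: "\<not> m dvd s"
  proof
    assume "m dvd s"
    then have "p dvd s" using N by (metis dvd_mult_left)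
    then have "p dvd 1" using s(1) by (meson cong_dvd_iff)
    then show False using p(1) by simp
  qed
  obtain c where c: "\<And>\<eta>. \<eta> ^ p = 1 \<Longrightarrow>
    class_sum (x1 ^ s) (x2 ^ s) (x3 ^ s) (x1 * inverse (x1 ^ s)) (x2 * inverse (x2 ^ s)) (x3 * inverse (x3 ^ s)) \<eta>
    - class_sum (y1 ^ s) (y2 ^ s) (y3 ^ s) (y1 * inverse (y1 ^ s)) (y2 * inverse (y2 ^ s)) (y3 * inverse (y3 ^ s)) \<eta> = c"
    using class_sums_differ_const[OF p(1) N m s x y al] by blast
  show ?thesis
    by (rule that[OF s(1) ms class_triple_power[OF x m ms] class_triple_power[OF y m ms] generating_not_trivial[OF gen nd] c])
qed

lemma relation_large:
  assumes p: "prime p" "p dvd m" "p \<ge> 11"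
  shows "common_root x1 x2 x3 y1 y2 y3 \<or> -1 \<in> {x1, x2, x3}"
proof (cases "p ^ 2 dvd m")
  case True
  then show ?thesis using relation_large_square[OF p(1)] p(3) by simp
next
  case False
  have p0: "p > 0" "p \<ge> 5" using p(3) by simp_all
  obtain s c where s: "[s = 1] (mod p)" "m dvd s * p"
    and t: "class_triple p (x1 ^ s) (x2 ^ s) (x3 ^ s) x1 x2 x3" "class_triple p (y1 ^ s) (y2 ^ s) (y3 ^ s) y1 y2 y3"
    and nt: "\<not> (x1 ^ s = 1 \<and> x2 ^ s = 1 \<and> x3 ^ s = 1)"
    and c: "\<And>\<eta>. \<eta> ^ p = 1 \<Longrightarrow>
    class_sum (x1 ^ s) (x2 ^ s) (x3 ^ s) (x1 * inverse (x1 ^ s)) (x2 * inverse (x2 ^ s)) (x3 * inverse (x3 ^ s)) \<eta>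
    - class_sum (y1 ^ s) (y2 ^ s) (y3 ^ s) (y1 * inverse (y1 ^ s)) (y2 * inverse (y2 ^ s)) (y3 * inverse (y3 ^ s)) \<eta> = c"
    using relation_const[OF p(1,2) False] by blast
  have "c = 0" by (rule class_sum_const_zero[OF p(3) class_triple_quotient[OF t(1) p0(1)] class_triple_quotient[OF t(2) p0(1)] c])
  then have "class_sum (x1 ^ s) (x2 ^ s) (x3 ^ s) x1 x2 x3 = class_sum (y1 ^ s) (y2 ^ s) (y3 ^ s) y1 y2 y3"
    using class_sums_equal_of_const_zero[OF t p0(1)] c by blast
  then show ?thesis by (rule class_analysis[OF p(1) p0(2) t _ nt]) (use p(3) in simp)
qed

text \<open>Of the four exceptional outcomes of \<open>seven_cases\<close>, three are incompatible
  with x being generating. The sporadic relation in which y carries the cube roots of unity remains;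
  it is recorded through orders, in a form that excludes itself when the roles are
  exchanged.\<close>

lemma relation_7:
  assumes "7 dvd m"
  shows "common_root x1 x2 x3 y1 y2 y3 \<or> -1 \<in> {x1, x2, x3} \<or>
    ((\<exists>z\<in>{x1, x2, x3}. z ^ 7 = 1) \<and> (\<forall>z\<in>{y1, y2, y3}. z ^ 14 \<noteq> 1))"
proof (cases "7 ^ 2 dvd m")
  case True
  have "common_root x1 x2 x3 y1 y2 y3 \<or> -1 \<in> {x1, x2, x3}"
    by (rule relation_large_square[OF _ True]) simp_all
  then show ?thesis by blast
next
  case False
  have p: "prime (7::nat)" "(7::nat) > 0" "(7::nat) \<ge> 5" by simp_all
  obtain s c where s: "[s = 1] (mod 7)" "m dvd s * 7"
    and t: "class_triple 7 (x1 ^ s) (x2 ^ s) (x3 ^ s) x1 x2 x3" "class_triple 7 (y1 ^ s) (y2 ^ s) (y3 ^ s) y1 y2 y3"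
    and nt: "\<not> (x1 ^ s = 1 \<and> x2 ^ s = 1 \<and> x3 ^ s = 1)"
    and c: "\<And>\<eta>. \<eta> ^ 7 = 1 \<Longrightarrow>
    class_sum (x1 ^ s) (x2 ^ s) (x3 ^ s) (x1 * inverse (x1 ^ s)) (x2 * inverse (x2 ^ s)) (x3 * inverse (x3 ^ s)) \<eta>
    - class_sum (y1 ^ s) (y2 ^ s) (y3 ^ s) (y1 * inverse (y1 ^ s)) (y2 * inverse (y2 ^ s)) (y3 * inverse (y3 ^ s)) \<eta> = c"
    using relation_const[OF p(1) assms False] by blast
  let ?a = "\<lambda>z. z * inverse (z ^ s)"
  have z7: "(z ^ s) ^ 7 = 1" if "z \<in> {x1, x2, x3, y1, y2, y3}" for z
    using t that unfolding class_triple_def by auto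
  have split: "z = z ^ s * ?a z" if "z \<in> {x1, x2, x3, y1, y2, y3}" for z
    using z7[OF that] by (metis mult.assoc mult.commute mult.right_neutral power_0_left right_inverse zero_neq_numeral zero_neq_one)
  have split_pow: "z ^ (7 * k) = ?a z ^ (7 * k)" if "z \<in> {x1, x2, x3, y1, y2, y3}" for z k
  proof -
    have "z ^ (7 * k) = ((z ^ s) ^ 7) ^ k * ?a z ^ (7 * k)"
      by (subst split[OF that]) (simp only: power_mult_distrib power_mult)
    then show ?thesis using z7[OF that] by simp
  qed
  have mz: "z ^ m = 1" if "z \<in> {x1, x2, x3, y1, y2, y3}" for z
    using x y that unfolding unity_triple_def by auto
  \<comment> \<open>Since x generates, an exponent that kills x is a multiple of m and kills y as
    well.\<close>
  have dm: "z ^ k = 1" if "x1 ^ k = 1" "x2 ^ k = 1" "x3 ^ k = 1" "z \<in> {x1, x2, x3, y1, y2, y3}" for z k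
  proof -
    have "m dvd k" using gen that(1-3) unfolding generating_def by blast
    then obtain j where "k = m * j" by (elim dvdE)
    then show ?thesis using mz[OF that(4)] by (simp add: power_mult)
  qed
  have w3: "w ^ 3 = 1" "w ^ 2 \<noteq> 1" if "w ^ 2 + w + 1 = 0" for w :: complex
  proof -
    have "w ^ 3 - 1 = (w - 1) * (w ^ 2 + w + 1)" by (simp add: algebra_simps power2_eq_square power3_eq_cube)
    then show "w ^ 3 = 1" using that by simp
    show "w ^ 2 \<noteq> 1"
    proof
      assume w2: "w ^ 2 = 1"
      then have "w + 2 = 0" using that by (simp add: add.commute)
      then have "w = -2" by (simp add: add_eq_0_iff2)
      then show False using w2 by simp
    qed
  qed
  consider "c = 0"
    | "seven_trivial (x1 ^ s) (x2 ^ s) (x3 ^ s) (?a x1) (?a x2) (?a x3) (?a y1) (?a y2) (?a y3)"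
    | "seven_sporadic (?a x1) (?a x2) (?a x3) (?a y1) (?a y2) (?a y3)"
    | "seven_trivial (y1 ^ s) (y2 ^ s) (y3 ^ s) (?a y1) (?a y2) (?a y3) (?a x1) (?a x2) (?a x3)"
    | "seven_sporadic (?a y1) (?a y2) (?a y3) (?a x1) (?a x2) (?a x3)"
    using seven_cases[OF class_triple_quotient[OF t(1) p(2)] class_triple_quotient[OF t(2) p(2)] c] by blast
  then show ?thesis
  proof cases
    case 1
    then have "class_sum (x1 ^ s) (x2 ^ s) (x3 ^ s) x1 x2 x3 = class_sum (y1 ^ s) (y2 ^ s) (y3 ^ s) y1 y2 y3"
      using class_sums_equal_of_const_zero[OF t p(2)] c by blast
    then have "common_root x1 x2 x3 y1 y2 y3 \<or> -1 \<in> {x1, x2, x3}"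
      by (rule class_analysis[OF p(1,3) t _ nt]) simp
    then show ?thesis by blast
  next
    case 2
    then show ?thesis using nt unfolding seven_trivial_def by auto
  next
    \<comment> \<open>Here x, hence also y, would have exponent 21, but some cofactor of y has cube
      -1 and thus even order.\<close>
    case 3
    then obtain w where w: "w ^ 2 + w + 1 = 0" "{?a x1, ?a x2, ?a x3} = {w}"
      unfolding seven_sporadic_def by blast
    obtain z where z: "z \<in> {y1, y2, y3}" "?a z ^ 3 = -1" using 3 unfolding seven_sporadic_def by blast
    have "u ^ (7 * 3) = 1" if "u \<in> {x1, x2, x3}" for u
    proof -
      have uu: "u \<in> {x1, x2, x3, y1, y2, y3}" using that by blast
      have "?a u = w" using w(2) that by auto
      then have "u ^ (7 * 3) = w ^ (3 * 7)" using split_pow[OF uu, of 3] by simp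
      also have "\<dots> = 1" unfolding power_mult w3(1)[OF w(1)] by simp
      finally show ?thesis .
    qed
    then have "z ^ (7 * 3) = 1" using dm[of "7 * 3" z] z(1) by blast
    then have "?a z ^ (7 * 3) = 1" using split_pow[of z 3] z(1) by simp
    moreover have "?a z ^ (3 * 7) = (-1) ^ 7" unfolding power_mult z(2) ..
    ultimately show ?thesis by (simp add: mult.commute)
  next
    \<comment> \<open>Here x, hence also y, has exponent 7. As the classes of y are trivial, y
      consists of 1 only, and \<open>alpha\<close> is 6 instead of -1.\<close>
    case 4
    then have ys: "y1 ^ s = 1" "y2 ^ s = 1" "y3 ^ s = 1" and ax: "{?a x1, ?a x2, ?a x3} = {1}"
      and al1: "alpha (?a y1) (?a y2) (?a y3) = -1" unfolding seven_trivial_def by auto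
    have "u ^ 7 = 1" if "u \<in> {x1, x2, x3}" for u
      using split_pow[of u 1] ax that by auto
    then have y7: "u ^ 7 = 1" if "u \<in> {y1, y2, y3}" for u using dm[of 7 u] that by blast
    have "u = 1" if u: "u \<in> {y1, y2, y3}" for u
    proof (rule root_unity_prime_power_eq_1[OF p(1) y7[OF u]])
      show "u ^ s = 1" using u ys by auto
      show "\<not> 7 dvd s" using cong_dvd_iff[OF s(1)] by simp
    qed
    then have "y1 = 1" "y2 = 1" "y3 = 1" by blast+
    then have "alpha (?a y1) (?a y2) (?a y3) = 6" by (simp add: alpha_def)
    then show ?thesis using al1 by simp
  next
    \<comment> \<open>The cofactors of y are primitive cube roots of unity, which the fourteenth
      power does not kill.\<close>
    case 5
    then obtain w where w: "w ^ 2 + w + 1 = 0" "{?a y1, ?a y2, ?a y3} = {w}"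
      unfolding seven_sporadic_def by blast
    obtain z where z: "z \<in> {x1, x2, x3}" "?a z = 1" using 5 unfolding seven_sporadic_def by force
    have "z ^ 7 = 1" using split_pow[of z 1] z by auto
    moreover have "u ^ 14 \<noteq> 1" if "u \<in> {y1, y2, y3}" for u
    proof -
      have uu: "u \<in> {x1, x2, x3, y1, y2, y3}" using that by blast
      have "?a u = w" using w(2) that by auto
      then have "u ^ 14 = w ^ (3 * 4 + 2)" using split_pow[OF uu, of 2] by simp
      also have "\<dots> = w ^ 2" unfolding power_add power_mult w3(1)[OF w(1)] by simp
      finally show ?thesis using w3(2)[OF w(1)] by simp
    qed
    ultimately show ?thesis using z(1) by blast
  qed
qed

end

section \<open>Isospectral triples\<close>


definition power_equiv :: "nat \<Rightarrow> complex \<Rightarrow> complex \<Rightarrow> complex \<Rightarrow> complex \<Rightarrow> complex \<Rightarrow> complex \<Rightarrow> bool" where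
  "power_equiv m x1 x2 x3 y1 y2 y3 \<longleftrightarrow> (\<exists>k. coprime k m \<and> {#x1, x2, x3#} = {#y1 ^ k, y2 ^ k, y3 ^ k#})"

text \<open>The exponents run over all residues and not only over units: when m is the matrix size,
  this compares the full spectra of the Gram matrices, with multiplicities and shifted by 3.\<close>

definition isospectral :: "nat \<Rightarrow> complex \<Rightarrow> complex \<Rightarrow> complex \<Rightarrow> complex \<Rightarrow> complex \<Rightarrow> complex \<Rightarrow> bool" where
  "isospectral m x1 x2 x3 y1 y2 y3 \<longleftrightarrow>
     image_mset (\<lambda>c. alpha (x1 ^ c) (x2 ^ c) (x3 ^ c)) (mset_set {..<m}) =
     image_mset (\<lambda>c. alpha (y1 ^ c) (y2 ^ c) (y3 ^ c)) (mset_set {..<m})"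

definition primitive_unity :: "nat \<Rightarrow> complex \<Rightarrow> bool" where
  "primitive_unity m g \<longleftrightarrow> g ^ m = 1 \<and> (\<forall>t. g ^ t = 1 \<longrightarrow> m dvd t)"

lemma power_cong_mod:
  fixes z :: complex
  assumes "z ^ m = 1" "[j = k] (mod m)"
  shows "z ^ j = z ^ k"
proof -
  have "z ^ i = z ^ (i mod m)" for i
    by (metis assms(1) div_mult_mod_eq mult.commute mult_1 power_add power_mult power_one)
  then show ?thesis using assms(2) unfolding cong_def by metis
qed

lemma power_equiv_sym:
  assumes y: "unity_triple m y1 y2 y3" and e: "power_equiv m x1 x2 x3 y1 y2 y3"
  shows "power_equiv m y1 y2 y3 x1 x2 x3"
proof -
  obtain k where k: "coprime k m" "{#x1, x2, x3#} = {#y1 ^ k, y2 ^ k, y3 ^ k#}"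
    using e unfolding power_equiv_def by blast
  obtain k' where k': "[k * k' = 1] (mod m)" using k(1) cong_solve_coprime_nat[of k m] by auto
  have "coprime (k * k') m" using cong_imp_coprime[OF cong_sym[OF k']] by simp
  then have "coprime k' m" by simp
  moreover have "image_mset (\<lambda>z. z ^ k') {#x1, x2, x3#} = image_mset (\<lambda>z. z ^ k') {#y1 ^ k, y2 ^ k, y3 ^ k#}"
    unfolding k(2) ..
  moreover have "(z ^ k) ^ k' = z" if "z \<in> {y1, y2, y3}" for z
  proof -
    have "z ^ m = 1" using y that unfolding unity_triple_def by auto
    from power_cong_mod[OF this k'] show ?thesis by (simp add: power_mult)
  qed
  ultimately show ?thesis unfolding power_equiv_def by (intro exI[of _ k']) simp
qed

text \<open>The k-th powers of m-th roots of unity have order dividing m / gcd k m, and a generating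
  triple does not fit into a proper subgroup.\<close>

lemma generating_power_coprime:
  assumes m: "m > 0" and gen: "generating m x1 x2 x3" and y: "y1 ^ m = 1" "y2 ^ m = 1" "y3 ^ m = 1"
    and e: "{#x1, x2, x3#} = {#y1 ^ k, y2 ^ k, y3 ^ k#}"
  shows "coprime k m"
proof -
  define t where "t = m div gcd k m"
  have t: "t * gcd k m = m" unfolding t_def by simp
  have "m dvd k * t"
  proof -
    have "k * t = (k div gcd k m) * (gcd k m * t)" by simp
    also have "gcd k m * t = m" using t by (simp add: mult.commute)
    finally show ?thesis by simp
  qed
  then obtain j where j: "k * t = m * j" by (elim dvdE)
  have yk: "(u ^ k) ^ t = 1" if "u ^ m = 1" for u :: complex
    unfolding power_mult[symmetric] j unfolding power_mult that by simp
  have "set_mset {#x1, x2, x3#} = set_mset {#y1 ^ k, y2 ^ k, y3 ^ k#}" unfolding e ..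
  then have "{x1, x2, x3} = {y1 ^ k, y2 ^ k, y3 ^ k}" by simp
  then have "z ^ t = 1" if "z \<in> {x1, x2, x3}" for z using that yk[OF y(1)] yk[OF y(2)] yk[OF y(3)] by auto
  then have "x1 ^ t = 1" "x2 ^ t = 1" "x3 ^ t = 1" by simp_all
  then have "m dvd t" using gen unfolding generating_def by blast
  moreover have "t > 0" using t m by (cases t) auto
  ultimately have "m \<le> t" using dvd_imp_le by blast
  have "gcd k m = 1"
  proof (rule ccontr)
    assume "gcd k m \<noteq> 1"
    moreover have "gcd k m \<noteq> 0" using m by simp
    ultimately have "gcd k m \<ge> 2" by linarith
    then have "t * 2 \<le> m" using t by (metis mult_le_mono2)
    then show False using \<open>m \<le> t\<close> \<open>t > 0\<close> by linarith
  qed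
  then show ?thesis using coprime_iff_gcd_eq_1 by blast
qed

text \<open>Inversion is itself a power, with exponent m - 1, so both kinds of match present x as a
  power of y. That the exponent is a unit follows because x generates.\<close>

lemma power_equiv_of_matching:
  assumes m: "m > 0" and gen: "generating m x1 x2 x3" and y: "unity_triple m y1 y2 y3"
    and e: "matching x1 x2 x3 (y1 ^ l) (y2 ^ l) (y3 ^ l)"
  shows "power_equiv m x1 x2 x3 y1 y2 y3"
proof -
  have ym: "y1 ^ m = 1" "y2 ^ m = 1" "y3 ^ m = 1" using y unfolding unity_triple_def by auto
  have inv: "inverse (z ^ l) = z ^ (l * (m - 1))" if "z ^ m = 1" for z :: complex
  proof (rule inverse_unique)
    have "l + l * (m - 1) = m * l" using m by (cases m) auto
    then show "z ^ l * z ^ (l * (m - 1)) = 1" using that by (simp flip: power_add) (simp add: power_mult)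
  qed
  have "\<exists>k. {#x1, x2, x3#} = {#y1 ^ k, y2 ^ k, y3 ^ k#}"
    using e inv[OF ym(1)] inv[OF ym(2)] inv[OF ym(3)] unfolding matching_def by metis
  then show ?thesis using generating_power_coprime[OF m gen ym] unfolding power_equiv_def by blast
qed

lemma isospectral_sym: "isospectral m x1 x2 x3 y1 y2 y3 \<Longrightarrow> isospectral m y1 y2 y3 x1 x2 x3"
  unfolding isospectral_def by simp

lemma isospectral_relation:
  assumes m: "m > 0" and x: "unity_triple m x1 x2 x3" and e: "isospectral m x1 x2 x3 y1 y2 y3"
  obtains l where "alpha x1 x2 x3 = alpha (y1 ^ l) (y2 ^ l) (y3 ^ l)"
proof -
  let ?f = "\<lambda>c. alpha (x1 ^ c) (x2 ^ c) (x3 ^ c)"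
  let ?h = "\<lambda>c. alpha (y1 ^ c) (y2 ^ c) (y3 ^ c)"
  have "set_mset (image_mset ?f (mset_set {..<m})) = set_mset (image_mset ?h (mset_set {..<m}))"
    using e unfolding isospectral_def by (rule arg_cong)
  then have "?f ` {..<m} = ?h ` {..<m}" by simp
  \<comment> \<open>The exponent is \<open>1 mod m\<close> so that it stays below m also when m =
    1.\<close>
  moreover have "?f (1 mod m) \<in> ?f ` {..<m}" using m by (intro imageI) simp
  ultimately have "?f (1 mod m) \<in> ?h ` {..<m}" by (simp only:)
  then obtain l where "?f (1 mod m) = ?h l" by (elim imageE)
  moreover have "z ^ (1 mod m) = z" if "z ^ m = 1" for z :: complex
    using power_cong_mod[OF that, of "1 mod m" 1] by (simp add: cong_def)
  ultimately show ?thesis using x that unfolding unity_triple_def by metis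
qed

lemma unity_triple_power:
  assumes "unity_triple m y1 y2 y3"
  shows "unity_triple m (y1 ^ l) (y2 ^ l) (y3 ^ l)"
proof -
  have "(z ^ l) ^ m = 1" if "z ^ m = 1" for z :: complex
    using that by (metis mult.commute power_mult power_one)
  moreover have "y1 ^ l * y2 ^ l * y3 ^ l = (y1 * y2 * y3) ^ l" by (simp add: power_mult_distrib)
  ultimately show ?thesis using assms unfolding unity_triple_def by simp
qed

lemma primitive_unity_generates:
  assumes m: "m > 0" and g: "primitive_unity m g" and h: "h ^ m = 1"
  obtains k where "h = g ^ k"
proof -
  have gm: "g ^ m = 1" using g unfolding primitive_unity_def by blast
  have g0: "g \<noteq> 0" using gm m by (metis power_0_left not_gr_zero zero_neq_one)
  have lt: "i = j" if "g ^ i = g ^ j" "i \<le> j" "j < m" for i j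
  proof (rule ccontr)
    assume "i \<noteq> j"
    have "g ^ i * g ^ (j - i) = g ^ j" using that(2) by (subst power_add[symmetric]) simp
    then have "g ^ i * g ^ (j - i) = g ^ i * 1" using that(1) by simp
    then have "g ^ (j - i) = 1" using g0 by simp
    then have "m dvd j - i" using g unfolding primitive_unity_def by blast
    moreover have "0 < j - i" using \<open>i \<noteq> j\<close> that(2) by simp
    ultimately have "m \<le> j - i" using dvd_imp_le by blast
    then show False using that(3) by simp
  qed
  have "inj_on (\<lambda>k. g ^ k) {..<m}"
  proof (rule inj_onI)
    fix i j assume "i \<in> {..<m}" "j \<in> {..<m}" "g ^ i = g ^ j"
    then show "i = j" using lt[of i j] lt[of j i] by (cases "i \<le> j") auto
  qed
  then have "card ((\<lambda>k. g ^ k) ` {..<m}) = card {z::complex. z ^ m = 1}"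
    using card_roots_unity_eq[OF m] by (simp add: card_image)
  moreover have "(\<lambda>k. g ^ k) ` {..<m} \<subseteq> {z. z ^ m = 1}"
    using gm by (auto simp flip: power_mult) (simp add: mult.commute[of _ m] power_mult)
  moreover have "finite {z::complex. z ^ m = 1}" using finite_roots_unity[of m] m by simp
  ultimately have "(\<lambda>k. g ^ k) ` {..<m} = {z. z ^ m = 1}" by (intro card_subset_eq)
  then show ?thesis using h that by blast
qed

lemma primitive_unity_power:
  assumes m: "m > 0" and g: "primitive_unity m g" and h: "primitive_unity m h"
  obtains k where "h = g ^ k" "coprime k m"
proof -
  have hm: "h ^ m = 1" and gm: "g ^ m = 1" using g h unfolding primitive_unity_def by auto
  obtain k where k: "h = g ^ k" using primitive_unity_generates[OF m g hm] by blast
  have "coprime k m"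
    by (rule generating_power_coprime[OF m _ gm gm gm, of h h h])
      (use h k in \<open>auto simp: generating_def primitive_unity_def\<close>)
  then show ?thesis using k that by blast
qed

section \<open>The exceptional triples\<close>

lemma even_of_minus_one_power: "(-1::complex) ^ m = 1 \<Longrightarrow> even m"
  by (metis neg_one_odd_power one_neq_neg_one)

text \<open>With x3 = -1 and x1 x2 = -1, an even exponent that kills x1 or x2 kills the whole
  triple, so only odd exponents t have to be excluded. Let m = 2 q. If q is even, it divides t,
  which is impossible. If q is odd, one of x1 and x2 has q-th power -1, and this one is
  primitive.\<close>

lemma minus_one_structure:
  assumes m: "m > 0" and x: "unity_triple m x1 x2 x3" and gen: "generating m x1 x2 x3"
    and h: "-1 \<in> {x1, x2, x3}"
  obtains g where "primitive_unity m g" "{#x1, x2, x3#} = {#g, - inverse g, -1#}" "even m"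
proof -
  have main: "even m \<and> (\<exists>g. primitive_unity m g \<and> {#x1, x2, x3#} = {#g, - inverse g, -1#})"
    if x: "unity_triple m x1 x2 x3" and gen: "generating m x1 x2 x3" and h: "x3 = -1" for x1 x2 x3
  proof -
    have xm: "x1 ^ m = 1" "x2 ^ m = 1" "(-1::complex) ^ m = 1" and p: "x1 * x2 = -1"
      using x h unfolding unity_triple_def by (auto simp: minus_equation_iff)
    have ev: "even m" using xm(3) by (rule even_of_minus_one_power)
    then obtain q where q: "m = 2 * q" by blast
    have half: "m dvd 2 * t" if "z ^ t = 1" "z \<in> {x1, x2}" for z t
    proof -
      have "(x1 * x2) ^ (2 * t) = 1" unfolding p by (simp add: power_mult)
      moreover have "z ^ (2 * t) = 1" using that(1) by (metis mult.commute power_mult power_one)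
      ultimately have "x1 ^ (2 * t) = 1" "x2 ^ (2 * t) = 1" using that(2) by (auto simp: power_mult_distrib)
      then show ?thesis using gen h unfolding generating_def by simp
    qed
    have evn: "m dvd t" if "z ^ t = 1" "z \<in> {x1, x2}" "even t" for z t
    proof -
      have "(x1 * x2) ^ t = 1" using that(3) unfolding p by simp
      then have "x1 ^ t = 1" "x2 ^ t = 1" using that(1,2) by (auto simp: power_mult_distrib)
      then show ?thesis using gen h that(3) unfolding generating_def by simp
    qed
    have "\<exists>z\<in>{x1, x2}. primitive_unity m z"
    proof (cases "even q")
      case True
      have "m dvd t" if "x1 ^ t = 1" for t
      proof (rule evn[OF that])
        have "2 * q dvd 2 * t" using half[OF that] q by simp
        then have "q dvd t" by simp
        then show "even t" using True by (meson dvd_trans)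
      qed simp
      then show ?thesis using xm unfolding primitive_unity_def by blast
    next
      case False
      have "(x1 * x2) ^ q = -1" using False p by simp
      then have "\<not> (x1 ^ q = 1 \<and> x2 ^ q = 1)" by (auto simp: power_mult_distrib)
      then obtain z where z: "z \<in> {x1, x2}" "z ^ q \<noteq> 1" by blast
      have zm: "z ^ m = 1" using xm z(1) by auto
      then have "(z ^ q) ^ 2 = 1" unfolding q by (simp add: mult.commute power_mult)
      then have zq: "z ^ q = -1" using z(2) by (simp add: power2_eq_1_iff)
      have "m dvd t" if t: "z ^ t = 1" for t
      proof (cases "even t")
        case True
        then show ?thesis using evn[OF t z(1)] by simp
      next
        case ot: False
        have "2 * q dvd 2 * t" using half[OF t z(1)] q by simp
        then obtain j where j: "t = q * j" by (auto elim: dvdE)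
        then have "odd j" using ot by simp
        then have "z ^ t = -1" unfolding j power_mult zq by simp
        then show ?thesis using t by simp
      qed
      then show ?thesis using zm z(1) unfolding primitive_unity_def by blast
    qed
    moreover have i: "x2 = - inverse x1" "x1 = - inverse x2"
    proof -
      have "x1 * (- x2) = 1" "x2 * (- x1) = 1" using p by (simp_all add: mult.commute)
      then show "x2 = - inverse x1" "x1 = - inverse x2" using inverse_unique minus_minus by metis+
    qed
    moreover have "{#x1, x2, x3#} = {#x1, - inverse x1, -1#}" unfolding h by (subst i(1)) (rule refl)
    moreover have "{#x1, x2, x3#} = {#x2, - inverse x2, -1#}"
      unfolding h i(2)[symmetric] by (rule add_mset_commute)
    ultimately show ?thesis using ev by blast
  qed
  consider "x3 = -1" | "x2 = -1" | "x1 = -1" using h by auto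
  then have "even m \<and> (\<exists>g. primitive_unity m g \<and> {#x1, x2, x3#} = {#g, - inverse g, -1#})"
  proof cases
    case 1
    then show ?thesis using main[OF x gen] by blast
  next
    case 2
    have "unity_triple m x1 x3 x2" "generating m x1 x3 x2" using x gen by (auto simp: unity_triple_def generating_def mult_ac)
    from main[OF this 2] show ?thesis by (simp add: add_mset_commute)
  next
    case 3
    have "unity_triple m x3 x2 x1" "generating m x3 x2 x1" using x gen by (auto simp: unity_triple_def generating_def mult_ac)
    from main[OF this 3] show ?thesis by (simp add: add_mset_commute)
  qed
  then show ?thesis using that by blast
qed

text \<open>Units modulo the even number m are odd, and odd powers preserve the shape g, -1/g, -1;
  primitive roots are unit powers of each other.\<close>

lemma minus_one_power_equiv:
  assumes m: "m > 0" and x: "unity_triple m x1 x2 x3" and y: "unity_triple m y1 y2 y3"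
    and gen: "generating m x1 x2 x3" "generating m y1 y2 y3"
    and h: "-1 \<in> {x1, x2, x3}" "-1 \<in> {y1, y2, y3}"
  shows "power_equiv m x1 x2 x3 y1 y2 y3"
proof -
  obtain g where g: "primitive_unity m g" "{#x1, x2, x3#} = {#g, - inverse g, -1#}" "even m"
    using minus_one_structure[OF m x gen(1) h(1)] by blast
  obtain g' where g': "primitive_unity m g'" "{#y1, y2, y3#} = {#g', - inverse g', -1#}"
    using minus_one_structure[OF m y gen(2) h(2)] by blast
  obtain k where k: "g = g' ^ k" "coprime k m" using primitive_unity_power[OF m g'(1) g(1)] by blast
  have ok: "odd k" using k(2) g(3) by (meson coprime_common_divisor dvd_refl odd_one)
  have "image_mset (\<lambda>z. z ^ k) {#y1, y2, y3#} = image_mset (\<lambda>z. z ^ k) {#g', - inverse g', -1#}"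
    unfolding g'(2) ..
  then have "{#y1 ^ k, y2 ^ k, y3 ^ k#} = {#g, - inverse g, -1#}" using ok k(1) by (simp add: power_inverse)
  then show ?thesis unfolding power_equiv_def using g(2) k(2) by metis
qed

text \<open>With x2 = -x1 and x3 the negative inverse of \<open>x1 ^ 2\<close>, an even exponent
  that kills x1 kills all three. If \<open>x1 ^ t = 1\<close>, then m divides 2 t, and since 4
  divides m, the exponent t itself is even.\<close>

lemma opposite_structure:
  assumes m: "m > 0" and x: "unity_triple m x1 x2 x3" and gen: "generating m x1 x2 x3"
    and h: "x1 = - x2 \<or> x1 = - x3 \<or> x2 = - x3" and m4: "4 dvd m"
  obtains g where "primitive_unity m g" "{#x1, x2, x3#} = {#g, - g, - inverse (g ^ 2)#}"
proof -
  have main: "\<exists>g. primitive_unity m g \<and> {#x1, x2, x3#} = {#g, - g, - inverse (g ^ 2)#}"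
    if x: "unity_triple m x1 x2 x3" and gen: "generating m x1 x2 x3" and h: "x2 = - x1" for x1 x2 x3
  proof -
    have x1: "x1 ^ m = 1" "- (x1 ^ 2) * x3 = 1" using x h unfolding unity_triple_def by (auto simp: power2_eq_square)
    have x3: "x3 = - inverse (x1 ^ 2)" using inverse_unique[OF x1(2)] by simp
    have evn: "m dvd t" if "x1 ^ t = 1" "even t" for t
    proof -
      have "x3 ^ t = inverse ((x1 ^ t) ^ 2)" unfolding x3 using that(2)
        by (simp add: power_inverse) (simp add: mult.commute flip: power_mult)
      then show ?thesis using gen that h unfolding generating_def by simp
    qed
    have "m dvd t" if t: "x1 ^ t = 1" for t
    proof -
      have "x1 ^ (2 * t) = 1" using t by (metis mult.commute power_mult power_one)
      then have "m dvd 2 * t" by (rule evn) simp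
      with m4 have "4 dvd 2 * t" by (rule dvd_trans)
      then have "even t" by presburger
      then show ?thesis by (rule evn[OF t])
    qed
    then show ?thesis using x1(1) x3 h unfolding primitive_unity_def by blast
  qed
  have "\<exists>g. primitive_unity m g \<and> {#x1, x2, x3#} = {#g, - g, - inverse (g ^ 2)#}"
    using h
  proof (elim disjE)
    assume "x1 = - x2"
    then show ?thesis using main[OF x gen] by auto
  next
    assume h: "x1 = - x3"
    have "unity_triple m x1 x3 x2" "generating m x1 x3 x2" using x gen by (auto simp: unity_triple_def generating_def mult_ac)
    from main[OF this] show ?thesis using h by (simp add: add_mset_commute)
  next
    assume h: "x2 = - x3"
    have "unity_triple m x3 x2 x1" "generating m x3 x2 x1" using x gen by (auto simp: unity_triple_def generating_def mult_ac)
    from main[OF this] show ?thesis using h by (simp add: add_mset_commute)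
  qed
  then show ?thesis using that by blast
qed

lemma opposite_power_equiv:
  assumes m: "m > 0" and x: "unity_triple m x1 x2 x3" and y: "unity_triple m y1 y2 y3"
    and gen: "generating m x1 x2 x3" "generating m y1 y2 y3" and m4: "4 dvd m"
    and h: "x1 = - x2 \<or> x1 = - x3 \<or> x2 = - x3" "y1 = - y2 \<or> y1 = - y3 \<or> y2 = - y3"
  shows "power_equiv m x1 x2 x3 y1 y2 y3"
proof -
  obtain g where g: "primitive_unity m g" "{#x1, x2, x3#} = {#g, - g, - inverse (g ^ 2)#}"
    using opposite_structure[OF m x gen(1) h(1) m4] by blast
  obtain g' where g': "primitive_unity m g'" "{#y1, y2, y3#} = {#g', - g', - inverse (g' ^ 2)#}"
    using opposite_structure[OF m y gen(2) h(2) m4] by blast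
  obtain k where k: "g = g' ^ k" "coprime k m" using primitive_unity_power[OF m g'(1) g(1)] by blast
  have "even m" using m4 by (meson dvd_trans even_numeral)
  then have ok: "odd k" using k(2) by (meson coprime_common_divisor dvd_refl odd_one)
  have "image_mset (\<lambda>z. z ^ k) {#y1, y2, y3#} = image_mset (\<lambda>z. z ^ k) {#g', - g', - inverse (g' ^ 2)#}"
    unfolding g'(2) ..
  moreover have "(g' ^ 2) ^ k = g ^ 2" unfolding k(1) by (simp add: mult.commute flip: power_mult)
  ultimately have "{#y1 ^ k, y2 ^ k, y3 ^ k#} = {#g, - g, - inverse (g ^ 2)#}"
    using ok k(1) by (simp add: power_inverse)
  then show ?thesis unfolding power_equiv_def using g(2) k(2) by metis
qed


section \<open>Second moments\<close>

lemma isospectral_sum: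
  assumes "isospectral m x1 x2 x3 y1 y2 y3"
  shows "(\<Sum>c<m. f (alpha (x1 ^ c) (x2 ^ c) (x3 ^ c))) = (\<Sum>c<m. f (alpha (y1 ^ c) (y2 ^ c) (y3 ^ c)))"
proof -
  have "sum_mset (image_mset f (image_mset (\<lambda>c. alpha (x1 ^ c) (x2 ^ c) (x3 ^ c)) (mset_set {..<m})))
    = sum_mset (image_mset f (image_mset (\<lambda>c. alpha (y1 ^ c) (y2 ^ c) (y3 ^ c)) (mset_set {..<m})))"
    using assms unfolding isospectral_def by simp
  then show ?thesis by (simp add: sum_unfold_sum_mset image_mset.compositionality comp_def)
qed

lemma alpha_power_mset:
  assumes "{#x1, x2, x3#} = {#y1, y2, y3#}"
  shows "alpha (x1 ^ c) (x2 ^ c) (x3 ^ c) = alpha (y1 ^ c) (y2 ^ c) (y3 ^ c)"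
proof -
  have "sum_mset (image_mset (\<lambda>z. z ^ c + inverse (z ^ c)) {#x1, x2, x3#})
    = sum_mset (image_mset (\<lambda>z. z ^ c + inverse (z ^ c)) {#y1, y2, y3#})"
    unfolding assms ..
  then show ?thesis by (simp add: alpha_def add_ac)
qed

text \<open>Up to the factor m this is the sum of the squares of \<open>alpha\<close> over all
  exponents: by orthogonality only pairs of terms with product 1 survive.\<close>

definition inverse_pairs :: "complex list \<Rightarrow> nat" where
  "inverse_pairs L = (\<Sum>z\<leftarrow>L. \<Sum>w\<leftarrow>L. if z * w = 1 then 1 else 0)"

lemma sum_list_mult_distrib:
  fixes L K :: "complex list"
  shows "(\<Sum>z\<leftarrow>L. f z) * (\<Sum>w\<leftarrow>K. g w) = (\<Sum>z\<leftarrow>L. \<Sum>w\<leftarrow>K. f z * g w :: complex)"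
  by (simp add: sum_list_mult_const sum_list_const_mult)

lemma sum_sum_list: "(\<Sum>c\<in>A. \<Sum>z\<leftarrow>L. f c z) = (\<Sum>z\<leftarrow>L. \<Sum>c\<in>A. f c z :: complex)"
  by (induction L) (simp_all add: sum.distrib)

lemma of_nat_sum_list_map: "(of_nat (\<Sum>z\<leftarrow>L. f z) :: complex) = (\<Sum>z\<leftarrow>L. of_nat (f z))"
  by (induction L) simp_all

lemma sum_power_sums_square:
  assumes "\<And>z. z \<in> set L \<Longrightarrow> z ^ m = 1"
  shows "(\<Sum>c<m. (\<Sum>z\<leftarrow>L. z ^ c) ^ 2) = of_nat m * of_nat (inverse_pairs L)"
proof -
  have "(\<Sum>c<m. (\<Sum>z\<leftarrow>L. z ^ c) ^ 2) = (\<Sum>z\<leftarrow>L. \<Sum>w\<leftarrow>L. \<Sum>c<m. z ^ c * w ^ c)"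
    unfolding power2_eq_square sum_list_mult_distrib sum_sum_list ..
  also have "\<dots> = (\<Sum>z\<leftarrow>L. \<Sum>w\<leftarrow>L. of_nat m * of_nat (if z * w = 1 then 1 else 0))"
  proof (intro arg_cong[of _ _ sum_list] map_cong refl)
    fix z w assume "z \<in> set L" "w \<in> set L"
    then have "(z * w) ^ m = 1" using assms by (simp add: power_mult_distrib)
    from sum_root_unity_powers[OF this] show "(\<Sum>c<m. z ^ c * w ^ c) = of_nat m * of_nat (if z * w = 1 then 1 else 0)"
      by (simp add: power_mult_distrib)
  qed
  also have "\<dots> = of_nat m * of_nat (inverse_pairs L)"
    by (simp only: inverse_pairs_def of_nat_sum_list_map sum_list_const_mult)
  finally show ?thesis .
qed

lemma inverse_pairs_distinct:
  assumes "distinct L" "\<And>z. z \<in> set L \<Longrightarrow> z \<noteq> 0 \<and> inverse z \<in> set L"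
  shows "inverse_pairs L = length L"
proof -
  have ind: "(\<Sum>w\<leftarrow>K. if w = a then 1 else 0) = (if a \<in> set K then 1 else 0 :: nat)" if "distinct K" for K :: "complex list" and a
    using that by (induction K) auto
  have "inverse_pairs L = (\<Sum>z\<leftarrow>L. 1)"
    unfolding inverse_pairs_def
  proof (intro arg_cong[of _ _ sum_list] map_cong refl)
    fix z assume z: "z \<in> set L"
    have "z * w = 1 \<longleftrightarrow> w = inverse z" for w
      using assms(2)[OF z] by (metis inverse_unique right_inverse)
    then show "(\<Sum>w\<leftarrow>L. if z * w = 1 then 1 else 0) = (1::nat)"
      using ind[OF assms(1), of "inverse z"] assms(2)[OF z] by simp
  qed
  then show ?thesis by (simp add: sum_list_triv)
qed

text \<open>The four terms other than -1 each pair with their inverse, and the doubled term -1 pairs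
  with itself in four ways.\<close>

lemma inverse_pairs_minus_one:
  fixes g :: complex
  assumes "g \<noteq> 0"
  shows "inverse_pairs [g, - inverse g, -1, inverse g, - g, -1] \<ge> 8"
proof -
  define L where "L = [g, - inverse g, -1, inverse g, - g, -1]"
  have row: "(\<Sum>w\<leftarrow>L. if z * w = 1 then 1 else 0) \<ge> (1::nat)" if "w \<in> set L" "z * w = 1" for z w
    using member_le_sum_list[of "1::nat" "map (\<lambda>w. if z * w = 1 then 1 else 0) L"] that by force
  have rows: "(\<Sum>w\<leftarrow>L. if g * w = 1 then 1 else 0) \<ge> (1::nat)"
    "(\<Sum>w\<leftarrow>L. if (- inverse g) * w = 1 then 1 else 0) \<ge> (1::nat)"
    "(\<Sum>w\<leftarrow>L. if inverse g * w = 1 then 1 else 0) \<ge> (1::nat)"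
    "(\<Sum>w\<leftarrow>L. if (- g) * w = 1 then 1 else 0) \<ge> (1::nat)"
    using row[of "inverse g" g] row[of "- g" "- inverse g"] row[of g "inverse g"] row[of "- inverse g" "- g"] assms
    by (simp_all add: L_def)
  have "(\<Sum>w\<leftarrow>L. if (-1) * w = 1 then 1 else 0) \<ge> (2::nat)"
    unfolding L_def by simp
  moreover have "inverse_pairs L = (\<Sum>w\<leftarrow>L. if g * w = 1 then 1 else 0) + (\<Sum>w\<leftarrow>L. if (- inverse g) * w = 1 then 1 else 0)
    + (\<Sum>w\<leftarrow>L. if (-1) * w = 1 then 1 else 0) + (\<Sum>w\<leftarrow>L. if inverse g * w = 1 then 1 else 0)
    + (\<Sum>w\<leftarrow>L. if (- g) * w = 1 then 1 else 0) + (\<Sum>w\<leftarrow>L. if (-1) * w = 1 then 1 else 0)"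
    unfolding inverse_pairs_def by (subst (2) L_def) (simp only: list.map sum_list.Cons sum_list.Nil add.assoc add_0_right)
  ultimately show ?thesis using rows unfolding L_def[symmetric] by linarith
qed

text \<open>The second moments differ: at least 8 for a triple with -1, which occurs again among the
  inverses, and exactly 6 for an opposite triple, whose six terms are distinct.\<close>

lemma minus_one_not_isospectral_opposite:
  assumes m: "m > 0" and x: "unity_triple m x1 x2 x3" and y: "unity_triple m y1 y2 y3"
    and gen: "generating m x1 x2 x3" "generating m y1 y2 y3" and m4: "4 dvd m"
    and h: "-1 \<in> {x1, x2, x3}" "y1 = - y2 \<or> y1 = - y3 \<or> y2 = - y3"
    and ne: "-1 \<notin> {y1, y2, y3}" "1 \<notin> {y1, y2, y3}"
  shows "\<not> isospectral m x1 x2 x3 y1 y2 y3"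
proof
  assume iso: "isospectral m x1 x2 x3 y1 y2 y3"
  obtain g where g: "primitive_unity m g" "{#x1, x2, x3#} = {#g, - inverse g, -1#}" "even m"
    using minus_one_structure[OF m x gen(1) h(1)] by blast
  obtain k where k: "primitive_unity m k" "{#y1, y2, y3#} = {#k, - k, - inverse (k ^ 2)#}"
    using opposite_structure[OF m y gen(2) h(2) m4] by blast
  have gm: "g ^ m = 1" "k ^ m = 1" using g k unfolding primitive_unity_def by auto
  have nz: "g \<noteq> 0" "k \<noteq> 0" using gm m by (metis power_0_left not_gr_zero zero_neq_one)+
  define L where "L = [g, - inverse g, -1, inverse g, - g, -1]"
  define K where "K = [k, - k, - inverse (k ^ 2), inverse k, - inverse k, - (k ^ 2)]"
  have ax: "alpha (x1 ^ c) (x2 ^ c) (x3 ^ c) = (\<Sum>z\<leftarrow>L. z ^ c)" for c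
    using alpha_power_mset[OF g(2), of c] by (simp add: alpha_def L_def power_inverse[symmetric])
  have ay: "alpha (y1 ^ c) (y2 ^ c) (y3 ^ c) = (\<Sum>z\<leftarrow>K. z ^ c)" for c
    using alpha_power_mset[OF k(2), of c] by (simp add: alpha_def K_def power_inverse[symmetric])
  have Lm: "z ^ m = 1" if "z \<in> set L" for z using that gm g(3) unfolding L_def by (auto simp: power_inverse)
  have km2: "(k ^ 2) ^ m = 1" using gm(2) by (metis mult.commute power_mult power_one)
  have Km: "z ^ m = 1" if "z \<in> set K" for z using that gm km2 g(3) unfolding K_def by (auto simp: power_inverse)
  have sL: "(\<Sum>c<m. (\<Sum>z\<leftarrow>L. z ^ c) ^ 2) = of_nat m * of_nat (inverse_pairs L)"
    by (rule sum_power_sums_square) (rule Lm)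
  have sK: "(\<Sum>c<m. (\<Sum>z\<leftarrow>K. z ^ c) ^ 2) = of_nat m * of_nat (inverse_pairs K)"
    by (rule sum_power_sums_square) (rule Km)
  have "of_nat m * of_nat (inverse_pairs L) = (of_nat m * of_nat (inverse_pairs K) :: complex)"
    using isospectral_sum[OF iso, of "\<lambda>z. z ^ 2"] unfolding ax ay sL sK .
  then have eq: "inverse_pairs L = inverse_pairs K" using m by simp
  have yset: "{y1, y2, y3} = {k, - k, - inverse (k ^ 2)}"
    using arg_cong[OF k(2), of set_mset] by simp
  have n1: "k \<noteq> 1" "k \<noteq> -1" "k ^ 2 \<noteq> 1" "k ^ 2 \<noteq> -1"
    using ne unfolding yset by auto
  have nt: "k ^ t \<noteq> 1" if "\<not> 4 dvd t" for t
    using k(1) m4 that unfolding primitive_unity_def by (metis dvd_trans)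
  have n6: "k ^ 3 \<noteq> 1" "k ^ 3 \<noteq> -1"
  proof -
    show "k ^ 3 \<noteq> 1" using nt[of 3] by simp
    show "k ^ 3 \<noteq> -1"
    proof
      assume "k ^ 3 = -1"
      then have "k ^ (3 * 2) = 1" unfolding power_mult by simp
      then show False using nt[of 6] by simp
    qed
  qed
  have k2: "k * k \<noteq> - k" "- k \<noteq> k * k"
  proof -
    have "k * (k + 1) \<noteq> 0" using n1(2) nz(2) by (simp add: eq_neg_iff_add_eq_0)
    then show "k * k \<noteq> - k" unfolding eq_neg_iff_add_eq_0 by (simp add: distrib_left)
    then show "- k \<noteq> k * k" by (rule not_sym)
  qed
  have k4: "k * (k * (k * k)) \<noteq> 1"
  proof
    assume "k * (k * (k * k)) = 1"
    then have "(k ^ 2 - 1) * (k ^ 2 + 1) = 0" by (simp add: algebra_simps power2_eq_square)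
    then show False using n1(3,4) by (simp add: eq_neg_iff_add_eq_0)
  qed
  \<comment> \<open>A coincidence among the terms of \<open>K\<close> would force k = 0 or one of k,
    \<open>k ^ 2\<close>, \<open>k ^ 3\<close> to be 1 or -1; here \<open>k ^ 4 = 1\<close> splits
    into the two cases for \<open>k ^ 2\<close>.\<close>
  have ik: "- inverse (k ^ 2) \<noteq> k" "- inverse (k ^ 2) \<noteq> - k" "- (k ^ 2) \<noteq> k" "- (k ^ 2) \<noteq> - k"
    "inverse k \<noteq> k" "- inverse k \<noteq> k" "inverse k \<noteq> - k" "- inverse k \<noteq> - k"
    "- inverse (k ^ 2) \<noteq> inverse k" "- inverse (k ^ 2) \<noteq> - inverse k" "- inverse (k ^ 2) \<noteq> - (k ^ 2)"
    "- (k ^ 2) \<noteq> inverse k" "- (k ^ 2) \<noteq> - inverse k" "k \<noteq> - k" "inverse k \<noteq> - inverse k"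
    using n1 n6 nt[of 2] nt[of 1] nz k2 k4 by (auto simp: field_simps power2_eq_square power3_eq_cube eval_nat_numeral minus_equation_iff equation_minus_iff)
  have "distinct K" unfolding K_def using ik by auto
  moreover have "z \<noteq> 0 \<and> inverse z \<in> set K" if "z \<in> set K" for z
    using that nz unfolding K_def by auto
  ultimately have "inverse_pairs K = 6" using inverse_pairs_distinct[of K] by (simp add: K_def)
  then show False using inverse_pairs_minus_one[OF nz(1)] eq unfolding L_def by simp
qed

section \<open>Moduli not dividing 30\<close>

lemma dvd_30_if_small_primes:
  fixes m :: nat
  assumes m: "m > 0" and "\<not> 4 dvd m" "\<not> 9 dvd m" "\<not> 7 dvd m"
    and sq: "\<And>p. prime p \<Longrightarrow> p \<ge> 5 \<Longrightarrow> \<not> p ^ 2 dvd m" and big: "\<And>p. prime p \<Longrightarrow> p \<ge> 11 \<Longrightarrow> \<not> p dvd m"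
  shows "m dvd 30"
proof (rule multiplicity_le_imp_dvd)
  fix p :: nat assume p: "prime p"
  show "multiplicity p m \<le> multiplicity p 30"
  proof (cases "p dvd m")
    case False
    then show ?thesis by (simp add: not_dvd_imp_multiplicity_0)
  next
    case True
    have "p < 11" using True big[OF p] by (meson not_le)
    then have "p = 0 \<or> p = 1 \<or> p = 2 \<or> p = 3 \<or> p = 4 \<or> p = 5 \<or> p = 6 \<or> p = 7 \<or> p = 8 \<or> p = 9 \<or> p = 10"
      by presburger
    then have "p \<in> {2, 3, 5, 7}" using p by (elim disjE) simp_all
    then have p3: "p \<in> {2, 3, 5}" using True assms by auto
    then have "\<not> p ^ 2 dvd m" using assms(2,3) sq[of 5] by auto
    then have "\<not> multiplicity p m \<ge> 2" using m p by (metis multiplicity_dvd' )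
    then have "multiplicity p m \<le> 1" by simp
    also have "1 \<le> multiplicity p 30" using p3 p by (intro multiplicity_geI) auto
    finally show ?thesis .
  qed
qed (use m in simp)

text \<open>The relation is taken in both directions, with exponents l and j. A common root on the
  side of a triple without -1 finishes the proof; what is left are two exceptional triples, which
  are compared through their structure.\<close>

theorem power_equiv_of_isospectral_large:
  assumes m: "m > 0" and nd: "\<not> m dvd 30"
    and x: "unity_triple m x1 x2 x3" and y: "unity_triple m y1 y2 y3"
    and gx: "generating m x1 x2 x3" and gy: "generating m y1 y2 y3"
    and ne: "1 \<notin> {x1, x2, x3}" "1 \<notin> {y1, y2, y3}"
    and iso: "isospectral m x1 x2 x3 y1 y2 y3"
  shows "power_equiv m x1 x2 x3 y1 y2 y3"
proof -
  obtain l where l: "alpha x1 x2 x3 = alpha (y1 ^ l) (y2 ^ l) (y3 ^ l)"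
    using isospectral_relation[OF m x iso] by blast
  obtain j where j: "alpha y1 y2 y3 = alpha (x1 ^ j) (x2 ^ j) (x3 ^ j)"
    using isospectral_relation[OF m y isospectral_sym[OF iso]] by blast
  note xr = m x unity_triple_power[OF y, of l] l gx
  note yr = m y unity_triple_power[OF x, of j] j gy
  have xprod: "x1 * x2 * x3 = 1" and yprod: "y1 * y2 * y3 = 1" using x y unfolding unity_triple_def by auto
  have ylp: "y1 ^ l * y2 ^ l * y3 ^ l = 1" and xjp: "x1 ^ j * x2 ^ j * x3 ^ j = 1"
    using xr(3) yr(3) unfolding unity_triple_def by auto
  have goodx: ?thesis if "common_root x1 x2 x3 (y1 ^ l) (y2 ^ l) (y3 ^ l)" "-1 \<notin> {x1, x2, x3}"
    using power_equiv_of_matching[OF m gx y matching_of_common_root[OF xprod ylp l that]] .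
  have goody: ?thesis if "common_root y1 y2 y3 (x1 ^ j) (x2 ^ j) (x3 ^ j)" "-1 \<notin> {y1, y2, y3}"
    using power_equiv_sym[OF x power_equiv_of_matching[OF m gy x matching_of_common_root[OF yprod xjp j that]]] .
  have both: ?thesis if "-1 \<in> {x1, x2, x3}" "-1 \<in> {y1, y2, y3}"
    by (rule minus_one_power_equiv[OF m x y gx gy that])
  have simple: ?thesis
    if "common_root x1 x2 x3 (y1 ^ l) (y2 ^ l) (y3 ^ l) \<or> -1 \<in> {x1, x2, x3}"
      "common_root y1 y2 y3 (x1 ^ j) (x2 ^ j) (x3 ^ j) \<or> -1 \<in> {y1, y2, y3}"
    using that goodx goody both by blast
  consider "4 dvd m" | "9 dvd m" "\<not> 4 dvd m" | p where "prime p" "p \<ge> 5" "p ^ 2 dvd m"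
    | p where "prime p" "p \<ge> 11" "p dvd m" | "7 dvd m"
    using dvd_30_if_small_primes[OF m] nd by blast
  then show ?thesis
  proof cases
    case 1
    have a: "common_root x1 x2 x3 (y1 ^ l) (y2 ^ l) (y3 ^ l) \<or> -1 \<in> {x1, x2, x3} \<or> (x1 = - x2 \<or> x1 = - x3 \<or> x2 = - x3)"
      by (rule relation_4[OF xr 1])
    have b: "common_root y1 y2 y3 (x1 ^ j) (x2 ^ j) (x3 ^ j) \<or> -1 \<in> {y1, y2, y3} \<or> (y1 = - y2 \<or> y1 = - y3 \<or> y2 = - y3)"
      by (rule relation_4[OF yr 1])
    show ?thesis
    proof (cases "-1 \<in> {x1, x2, x3}")
      case X: True
      show ?thesis
      proof (cases "-1 \<in> {y1, y2, y3}")
        case True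
        then show ?thesis using both X by blast
      next
        case False
        then show ?thesis using b goody minus_one_not_isospectral_opposite[OF m x y gx gy 1 X _ False ne(2)] iso by blast
      qed
    next
      case X: False
      show ?thesis
      proof (cases "-1 \<in> {y1, y2, y3}")
        case True
        then show ?thesis
          using a X goodx minus_one_not_isospectral_opposite[OF m y x gy gx 1 True _ X ne(1)] isospectral_sym[OF iso] by blast
      next
        case False
        then show ?thesis using a b X goodx goody opposite_power_equiv[OF m x y gx gy 1] by blast
      qed
    qed
  next
    case 2
    show ?thesis by (rule simple[OF relation_9[OF xr 2] relation_9[OF yr 2]])
  next
    case 3
    show ?thesis by (rule simple[OF relation_large_square[OF xr 3(1,3,2)] relation_large_square[OF yr 3(1,3,2)]])
  next
    case 4
    show ?thesis by (rule simple[OF relation_large[OF xr 4(1,3,2)] relation_large[OF yr 4(1,3,2)]])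
  next
    case 5
    have a: "common_root x1 x2 x3 (y1 ^ l) (y2 ^ l) (y3 ^ l) \<or> -1 \<in> {x1, x2, x3} \<or>
      ((\<exists>z\<in>{x1, x2, x3}. z ^ 7 = 1) \<and> (\<forall>z\<in>{y1 ^ l, y2 ^ l, y3 ^ l}. z ^ 14 \<noteq> 1))"
      by (rule relation_7[OF xr 5])
    have b: "common_root y1 y2 y3 (x1 ^ j) (x2 ^ j) (x3 ^ j) \<or> -1 \<in> {y1, y2, y3} \<or>
      ((\<exists>z\<in>{y1, y2, y3}. z ^ 7 = 1) \<and> (\<forall>z\<in>{x1 ^ j, x2 ^ j, x3 ^ j}. z ^ 14 \<noteq> 1))"
      by (rule relation_7[OF yr 5])
    have pw: "z ^ 14 \<noteq> 1" if "(z ^ i) ^ 14 \<noteq> 1" for z :: complex and i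
      using that by (metis mult.commute power_mult power_one)
    have sp: "z ^ 14 = 1" if "z ^ 7 = 1 \<or> z = -1" for z :: complex
    proof -
      have "z ^ (7 * 2) = 1"
      proof (cases "z ^ 7 = 1")
        case True
        then show ?thesis unfolding power_mult by simp
      next
        case False
        then show ?thesis using that by simp
      qed
      then show ?thesis by simp
    qed
    \<comment> \<open>If y contained -1 or a seventh root of unity, so would a power of it be a
      fourteenth root of unity. Hence the sporadic alternative for x leaves only the common root for
      y, and conversely.\<close>
    have cx: "\<not> ((\<forall>z\<in>{y1 ^ l, y2 ^ l, y3 ^ l}. z ^ 14 \<noteq> 1) \<and> (-1 \<in> {y1, y2, y3} \<or> (\<exists>z\<in>{y1, y2, y3}. z ^ 7 = 1)))"
      using pw sp by blast
    have cy: "\<not> ((\<forall>z\<in>{x1 ^ j, x2 ^ j, x3 ^ j}. z ^ 14 \<noteq> 1) \<and> (-1 \<in> {x1, x2, x3} \<or> (\<exists>z\<in>{x1, x2, x3}. z ^ 7 = 1)))"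
      using pw sp by blast
    show ?thesis using a b cx cy goodx goody both by blast
  qed
qed

section \<open>Moduli dividing 30\<close>


text \<open>Division by the common gcd d turns a and b into units modulo n / d. Their quotient is a
  unit there, and \<open>coprime_lift\<close> raises it to a unit modulo n.\<close>

lemma unit_multiple:
  fixes a b n :: nat
  assumes n: "n > 0" and g: "gcd a n = gcd b n"
  obtains u where "coprime u n" "[a = u * b] (mod n)"
proof -
  define d where "d = gcd b n"
  have d0: "d > 0" using n unfolding d_def by simp
  obtain a' b' n' where e: "a = d * a'" "b = d * b'" "n = d * n'"
    using gcd_dvd1[of a n] gcd_dvd1[of b n] gcd_dvd2[of b n] g unfolding d_def by (metis dvdE)
  have "gcd a' n' * d = d" "gcd b' n' * d = d"
    using g e unfolding d_def[symmetric] by (metis d_def gcd_mult_distrib_nat mult.commute)+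
  then have "gcd a' n' = 1" "gcd b' n' = 1" using d0 by simp_all
  then have co: "coprime a' n'" "coprime b' n'" using coprime_iff_gcd_eq_1 by blast+
  obtain q where q: "[b' * q = 1] (mod n')" using co(2) cong_solve_coprime_nat[of b' n'] by auto
  have "coprime (b' * q) n'" using cong_imp_coprime[OF cong_sym[OF q]] by simp
  then have cu: "coprime (a' * q) n'" using co(1) by simp
  obtain t where t: "\<And>r. prime r \<Longrightarrow> r dvd a' * q + n' * t \<Longrightarrow> r > n"
    using coprime_lift[OF cu, of n] by blast
  define u where "u = a' * q + n' * t"
  have "coprime u n"
  proof (rule ccontr)
    assume "\<not> coprime u n"
    then have "gcd u n \<noteq> 1" using coprime_iff_gcd_eq_1 by blast
    from prime_factor_nat[OF this] obtain r where r: "prime r" "r dvd gcd u n" by blast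
    from r(2) have "r dvd u" "r dvd n" by (simp_all only: gcd_greatest_iff)
    then have "r > n" "r \<le> n" using t[OF r(1)] n dvd_imp_le unfolding u_def by blast+
    then show False by simp
  qed
  moreover have "[a = u * b] (mod n)"
  proof -
    have "[u * b' = a' * (b' * q) + n' * (t * b')] (mod n')" unfolding u_def by (simp add: algebra_simps)
    moreover have "[a' * (b' * q) + n' * (t * b') = a' * 1 + 0] (mod n')"
      by (intro cong_add cong_mult q cong_refl) (simp add: cong_0_iff)
    ultimately have "[a' = u * b'] (mod n')" by (simp add: cong_def)
    then have "(d * a') mod (d * n') = (d * (u * b')) mod (d * n')" by (simp only: cong_def mod_mult_mult1)
    then show ?thesis unfolding e cong_def by (simp only: mult.left_commute)
  qed
  ultimately show ?thesis by (rule that)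
qed

lemma power_equiv_trans:
  assumes "power_equiv m x1 x2 x3 y1 y2 y3" "power_equiv m y1 y2 y3 z1 z2 z3"
  shows "power_equiv m x1 x2 x3 z1 z2 z3"
proof -
  obtain k where k: "coprime k m" "{#x1, x2, x3#} = {#y1 ^ k, y2 ^ k, y3 ^ k#}"
    using assms(1) unfolding power_equiv_def by blast
  obtain j where j: "coprime j m" "{#y1, y2, y3#} = {#z1 ^ j, z2 ^ j, z3 ^ j#}"
    using assms(2) unfolding power_equiv_def by blast
  have "image_mset (\<lambda>z. z ^ k) {#y1, y2, y3#} = image_mset (\<lambda>z. z ^ k) {#z1 ^ j, z2 ^ j, z3 ^ j#}"
    unfolding j(2) ..
  then have "{#x1, x2, x3#} = {#z1 ^ (j * k), z2 ^ (j * k), z3 ^ (j * k)#}"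
    unfolding k(2) by (simp add: power_mult)
  then show ?thesis unfolding power_equiv_def using k(1) j(1) by (intro exI[of _ "j * k"]) simp
qed

text \<open>A list of length 30 stands for a polynomial modulo \<open>X^30 - 1\<close>; \<open>walk_step\<close> multiplies it by the sum of the
  \<open>X^(-k)\<close>, so \<open>energy30\<close> is the trace of the tenth power of \<open>alpha\<close>, divided by 30. The exponent ten is the
  smallest even one for which these traces separate all classes.\<close>

definition walk_step :: "nat list \<Rightarrow> int list \<Rightarrow> int list" where
  "walk_step D v = foldr (\<lambda>k acc. map2 (+) (drop k v @ take k v) acc) D (map (\<lambda>_. 0) v)"

definition energy30 :: "nat \<times> nat \<Rightarrow> int" where
  "energy30 = (\<lambda>(a, b). let s = (a + b) mod 30; D = [a, b, 30 - s, 30 - a, 30 - b, s] in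
     sum_list (map (\<lambda>x. x * x)
       (walk_step D (walk_step D (walk_step D (walk_step D (walk_step D (1 # replicate 29 0))))))))"

text \<open>Up to units, the exponent with the smallest gcd with 30 can be made equal to that gcd,
  so the first component runs through the proper divisors of 30. The condition on a + b keeps the
  third root different from 1.\<close>

definition reps30 :: "(nat \<times> nat) list" where
  "reps30 = filter (\<lambda>(a, b). (a + b) mod 30 \<noteq> 0 \<and> gcd a 30 \<le> gcd b 30 \<and> gcd a 30 \<le> gcd (a + b) 30)
     (List.product [1, 2, 3, 5, 6, 10, 15] [1..<30])"

text \<open>The multipliers are the units modulo 30. The third exponent is computed from 60 - (a +
  b), which is not truncated for reduced exponents.\<close>

definition equiv30 :: "nat \<times> nat \<Rightarrow> nat \<times> nat \<Rightarrow> bool" where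
  "equiv30 = (\<lambda>(a, b) (a', b'). list_ex (\<lambda>u.
     let x = u * a' mod 30; y = u * b' mod 30; z = (60 - (x + y)) mod 30; c = (60 - (a + b)) mod 30
     in (a, b, c) \<in> set [(x, y, z), (x, z, y), (y, x, z), (y, z, x), (z, x, y), (z, y, x)])
     [1, 7, 11, 13, 17, 19, 23, 29])"

section \<open>Evaluation of the search modulo 30\<close>

lemma map2_Cons: "map2 f (x # xs) (y # ys) = f x y # map2 f xs ys"
  by simp

lemma map2_Nil: "map2 f [] [] = []"
  by simp

lemma drop_take_1: "drop 1 (x # xs) = xs" "take 1 (x # xs) = [x]"
  by simp_all

lemma drop_take_numeral:
  "drop (numeral k) (x # xs) = drop (pred_numeral k) xs"
  "take (numeral k) (x # xs) = x # take (pred_numeral k) xs"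
  by (simp_all add: numeral_eq_Suc)

lemma walk_step_six:
  "walk_step [a, b, c, d, e, f] v =
   map2 (+) (drop a v @ take a v) (map2 (+) (drop b v @ take b v) (map2 (+) (drop c v @ take c v)
   (map2 (+) (drop d v @ take d v) (map2 (+) (drop e v @ take e v) (map2 (+) (drop f v @ take f v)
     (map (\<lambda>_. 0) v))))))"
  by (simp only: walk_step_def foldr.simps comp_def id_def)

lemma replicate_29: "replicate 29 (0::int) =
  [0, 0, 0, 0, 0, 0, 0, 0, 0, 0, 0, 0, 0, 0, 0, 0, 0, 0, 0, 0, 0, 0, 0, 0, 0, 0, 0, 0, 0]"
  by (simp add: eval_nat_numeral)

text \<open>The evaluation is left to the simplifier with a fixed set of first-order equations: with a \<open>let\<close> or a
  \<open>\<lambda>\<close> in the way it would rewrite symbolic lists of length 30.\<close>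

lemmas walk_simps = walk_step_six replicate_29 map2_Cons map2_Nil drop_take_1 drop_take_numeral
  pred_numeral_simps BitM.simps numeral_One drop_0 take_0 append_Cons append_Nil list.map arith_simps
  one_add_one one_plus_numeral numeral_plus_one add_0_left add_0_right

lemma energy30_unfold:
  "energy30 (a, b) = sum_list (map (\<lambda>x. x * x)
    (walk_step [a, b, 30 - (a + b) mod 30, 30 - a, 30 - b, (a + b) mod 30]
    (walk_step [a, b, 30 - (a + b) mod 30, 30 - a, 30 - b, (a + b) mod 30]
    (walk_step [a, b, 30 - (a + b) mod 30, 30 - a, 30 - b, (a + b) mod 30]
    (walk_step [a, b, 30 - (a + b) mod 30, 30 - a, 30 - b, (a + b) mod 30]
    (walk_step [a, b, 30 - (a + b) mod 30, 30 - a, 30 - b, (a + b) mod 30]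
      (1 # replicate 29 0)))))))"
  by (simp only: energy30_def Let_def prod.case)

definition scaled30 :: "nat \<Rightarrow> nat \<Rightarrow> nat \<Rightarrow> nat \<Rightarrow> nat \<Rightarrow> bool" where
  "scaled30 a b a' b' u = (let x = u * a' mod 30; y = u * b' mod 30; z = (60 - (x + y)) mod 30; c = (60 - (a+b)) mod 30
     in (a,b,c) \<in> set [(x,y,z),(x,z,y),(y,x,z),(y,z,x),(z,x,y),(z,y,x)])"

text \<open>Equations between numerals in place of membership in a set of tuples, so that the
  evaluation stays first-order.\<close>

definition permuted :: "nat \<Rightarrow> nat \<Rightarrow> nat \<Rightarrow> nat \<Rightarrow> nat \<Rightarrow> nat \<Rightarrow> bool" where
  "permuted a b c x y z \<longleftrightarrow>
     a = x \<and> b = y \<and> c = z \<or> a = x \<and> b = z \<and> c = y \<or> a = y \<and> b = x \<and> c = z \<or>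
     a = y \<and> b = z \<and> c = x \<or> a = z \<and> b = x \<and> c = y \<or> a = z \<and> b = y \<and> c = x"

lemma scaled30_eq:
  "scaled30 a b a' b' u \<longleftrightarrow> permuted a b ((60 - (a + b)) mod 30) (u * a' mod 30) (u * b' mod 30)
     ((60 - (u * a' mod 30 + u * b' mod 30)) mod 30)"
  by (simp only: scaled30_def permuted_def Let_def list.set insert_iff empty_iff prod.inject simp_thms)

text \<open>Nested conditionals let the simplifier stop at the first unit that works instead of
  evaluating all eight.\<close>

lemma equiv30_unfold:
  "equiv30 (a, b) (a', b') \<longleftrightarrow>
    (if scaled30 a b a' b' 1 then True else if scaled30 a b a' b' 7 then True else
     if scaled30 a b a' b' 11 then True else if scaled30 a b a' b' 13 then True else
     if scaled30 a b a' b' 17 then True else if scaled30 a b a' b' 19 then True else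
     if scaled30 a b a' b' 23 then True else scaled30 a b a' b' 29)"
proof -
  have "equiv30 (a, b) (a', b') \<longleftrightarrow> list_ex (scaled30 a b a' b') [1, 7, 11, 13, 17, 19, 23, 29]"
    by (simp only: equiv30_def scaled30_def[abs_def] prod.case list_ex_iff)
  then show ?thesis by simp
qed

text \<open>The table reaches 44 because \<open>reps30\<close> takes gcds of sums up to 15 +
  29.\<close>

lemma gcd_30:
  "gcd 2 (30::nat) = 2" "gcd 3 (30::nat) = 3" "gcd 4 (30::nat) = 2" "gcd 5 (30::nat) = 5" "gcd 6 (30::nat) = 6"
  "gcd 7 (30::nat) = 1" "gcd 8 (30::nat) = 2" "gcd 9 (30::nat) = 3" "gcd 10 (30::nat) = 10" "gcd 11 (30::nat) = 1"
  "gcd 12 (30::nat) = 6" "gcd 13 (30::nat) = 1" "gcd 14 (30::nat) = 2" "gcd 15 (30::nat) = 15" "gcd 16 (30::nat) = 2"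
  "gcd 17 (30::nat) = 1" "gcd 18 (30::nat) = 6" "gcd 19 (30::nat) = 1" "gcd 20 (30::nat) = 10" "gcd 21 (30::nat) = 3"
  "gcd 22 (30::nat) = 2" "gcd 23 (30::nat) = 1" "gcd 24 (30::nat) = 6" "gcd 25 (30::nat) = 5" "gcd 26 (30::nat) = 2"
  "gcd 27 (30::nat) = 3" "gcd 28 (30::nat) = 2" "gcd 29 (30::nat) = 1" "gcd 30 (30::nat) = 30" "gcd 31 (30::nat) = 1"
  "gcd 32 (30::nat) = 2" "gcd 33 (30::nat) = 3" "gcd 34 (30::nat) = 2" "gcd 35 (30::nat) = 5" "gcd 36 (30::nat) = 6"
  "gcd 37 (30::nat) = 1" "gcd 38 (30::nat) = 2" "gcd 39 (30::nat) = 3" "gcd 40 (30::nat) = 10" "gcd 41 (30::nat) = 1"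
  "gcd 42 (30::nat) = 6" "gcd 43 (30::nat) = 1" "gcd 44 (30::nat) = 2"
  by (simp_all add: gcd_non_0_nat)

lemma upt_1_30: "[1..<30] =
    [1, 2, 3, 4, 5, 6, 7, 8, 9, 10, 11, 12, 13, 14, 15, 16, 17, 18, 19, 20, 21, 22, 23, 24, 25, 26, 27, 28, 29]"
  by (simp add: upt_rec)

lemma reps30_eq: "reps30 =
    [(1,1), (1,2), (1,3), (1,4), (1,5), (1,6), (1,7), (1,8), (1,9), (1,10), (1,11), (1,12), (1,13), (1,14), (1,15),
    (1,16), (1,17), (1,18), (1,19), (1,20), (1,21), (1,22), (1,23), (1,24), (1,25), (1,26), (1,27), (1,28), (2,2),
    (2,3), (2,4), (2,6), (2,8), (2,10), (2,12), (2,14), (2,16), (2,18), (2,20), (2,22), (2,24), (2,25), (2,26), (3,3),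
    (3,6), (3,9), (3,12), (3,15), (3,18), (3,21), (3,24), (5,5), (5,10), (5,15), (5,20), (6,6), (6,12), (6,18),
    (10,10)]"
  by (simp add: reps30_def upt_1_30 gcd_30 del: One_nat_def)

text \<open>A certificate for the separation: each entry collects the representatives with one value
  of \<open>energy30\<close>. That values are right and distinct and that members of an entry are
  equivalent takes far fewer evaluations than a comparison of all pairs.\<close>

definition classes30 :: "(int \<times> (nat \<times> nat) list) list" where
  "classes30 =
     [(5303340, [(1, 1), (1, 28)]), (3466358, [(1, 2), (1, 27)]), (2564438, [(1, 3), (1, 26)]),
     (2175030, [(1, 4), (1, 25)]), (2119712, [(1, 5), (1, 24)]), (2130842, [(1, 6), (1, 12), (1, 17), (1, 23)]),
     (2662920, [(1, 7), (1, 13), (1, 16), (1, 22)]), (2114218, [(1, 8), (1, 21)]), (3062608, [(1, 9), (1, 20)]),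
     (3062610, [(1, 10), (1, 19)]), (2137922, [(1, 11), (1, 18)]), (4584448, [(1, 14), (1, 15)]),
     (5325588, [(2, 2), (2, 14), (2, 26)]), (2227928, [(2, 3), (2, 25)]),
     (4113262, [(2, 4), (2, 12), (2, 16), (2, 24)]), (4034762, [(2, 6), (2, 22)]), (4055778, [(2, 8), (2, 20)]),
     (4052872, [(2, 10), (2, 18)]), (6201550, [(3, 3), (3, 24)]), (6049770, [(3, 6), (3, 9), (3, 18), (3, 21)]),
     (6072320, [(3, 12), (3, 15)]), (10097550, [(5, 5), (5, 20)]), (10078208, [(5, 10), (5, 15)]),
     (12099286, [(6, 6), (6, 12), (6, 18)]), (20194758, [(10, 10)])]"

lemma classes30_distinct: "distinct (map fst classes30)"
  by (simp add: classes30_def)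

lemma classes30_cover: "list_all (\<lambda>t. list_ex (\<lambda>c. t \<in> set (snd c)) classes30) reps30"
  by (simp add: reps30_eq classes30_def del: One_nat_def)

lemma classes30_equiv: "list_all (\<lambda>c. list_all (\<lambda>s. list_all (equiv30 s) (snd c)) (snd c)) classes30"
  by (simp add: classes30_def equiv30_unfold scaled30_eq permuted_def del: One_nat_def)

lemma classes30_energy: "list_all (\<lambda>c. list_all (\<lambda>t. energy30 t = fst c) (snd c)) classes30"
  by (simp add: classes30_def energy30_unfold walk_simps del: One_nat_def)

lemma energy30_separates:
  assumes "s \<in> set reps30" "t \<in> set reps30" "energy30 s = energy30 t"
  shows "equiv30 s t"
proof -
  have "\<exists>c \<in> set classes30. r \<in> set (snd c)" if "r \<in> set reps30" for r
    using classes30_cover that by (simp add: list_all_iff list_ex_iff)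
  then obtain c d where cd: "c \<in> set classes30" "s \<in> set (snd c)" "d \<in> set classes30" "t \<in> set (snd d)"
    using assms(1,2) by meson
  have "fst c = fst d"
    using classes30_energy cd assms(3) unfolding list_all_iff by metis
  then have "c = d"
    using classes30_distinct cd(1,3) unfolding distinct_map inj_on_def by blast
  then show ?thesis
    using classes30_equiv cd unfolding list_all_iff by blast
qed

section \<open>Traces as sums of squares of coefficients\<close>

definition list_eval :: "int list \<Rightarrow> complex \<Rightarrow> complex" where
  "list_eval v \<zeta> = (\<Sum>r<length v. of_int (v ! r) * \<zeta> ^ r)"

text \<open>Rotation to the left by k is division by X^k modulo X^n - 1, where n is the
  length.\<close>

lemma list_eval_rotate:
  assumes "\<zeta> ^ length v = 1" "k \<le> length v" "v \<noteq> []"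
  shows "list_eval (drop k v @ take k v) \<zeta> = inverse (\<zeta> ^ k) * list_eval v \<zeta>"
proof -
  let ?n = "length v"
  have n: "?n > 0" using assms(3) by simp
  have z0: "\<zeta> \<noteq> 0" using assms(1) n by (metis power_0_left not_gr_zero zero_neq_one)
  have idx: "(drop k v @ take k v) ! r = v ! ((r + k) mod ?n)" if "r < ?n" for r
  proof (cases "r < ?n - k")
    case True
    then show ?thesis using assms(2) by (simp add: nth_append add.commute)
  next
    case False
    then have "r + k = (r - (?n - k)) + ?n" using assms(2) by simp
    then have "(r + k) mod ?n = (r - (?n - k)) mod ?n" by (simp only: mod_add_self2)
    also have "\<dots> = r - (?n - k)" using that by simp
    finally show ?thesis using False that assms(2) by (simp add: nth_append)
  qed
  have "\<zeta> ^ k * list_eval (drop k v @ take k v) \<zeta> = (\<Sum>r<?n. of_int (v ! ((r + k) mod ?n)) * \<zeta> ^ (r + k))"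
    unfolding list_eval_def sum_distrib_left using idx assms(2)
    by (intro sum.cong) (auto simp: power_add)
  also have "\<dots> = (\<Sum>s<?n. of_int (v ! s) * \<zeta> ^ s)"
  proof (rule sum.reindex_bij_witness[of _ "\<lambda>s. (s + (?n - k)) mod ?n" "\<lambda>r. (r + k) mod ?n"])
    fix r assume r: "r \<in> {..<?n}"
    have "((r + k) mod ?n + (?n - k)) mod ?n = (r + k + (?n - k)) mod ?n" by (simp add: mod_simps)
    also have "\<dots> = r" using r assms(2) by simp
    finally show "((r + k) mod ?n + (?n - k)) mod ?n = r" .
    have "\<zeta> ^ ((r + k) mod ?n) = \<zeta> ^ (r + k)" by (rule power_cong_mod[OF assms(1)]) (simp add: cong_def)
    then show "of_int (v ! ((r + k) mod ?n)) * \<zeta> ^ ((r + k) mod ?n) = of_int (v ! ((r + k) mod ?n)) * \<zeta> ^ (r + k)"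
      by simp
  next
    fix s assume s: "s \<in> {..<?n}"
    have "((s + (?n - k)) mod ?n + k) mod ?n = (s + (?n - k) + k) mod ?n" by (simp add: mod_simps)
    also have "\<dots> = s" using s assms(2) by simp
    finally show "((s + (?n - k)) mod ?n + k) mod ?n = s" .
  qed (use n in auto)
  finally have "\<zeta> ^ k * list_eval (drop k v @ take k v) \<zeta> = list_eval v \<zeta>" unfolding list_eval_def .
  then show ?thesis using z0 by (simp add: field_simps)
qed

lemma list_eval_add:
  assumes "length u = length v"
  shows "list_eval (map2 (+) u v) \<zeta> = list_eval u \<zeta> + list_eval v \<zeta>"
  using assms unfolding list_eval_def by (simp add: sum.distrib algebra_simps)

lemma walk_step_eval:
  assumes "\<zeta> ^ length v = 1" "\<And>k. k \<in> set D \<Longrightarrow> k \<le> length v" "v \<noteq> []"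
  shows "length (walk_step D v) = length v \<and>
    list_eval (walk_step D v) \<zeta> = (\<Sum>k\<leftarrow>D. inverse (\<zeta> ^ k)) * list_eval v \<zeta>"
  using assms(2)
proof (induction D)
  case Nil
  then show ?case by (simp add: walk_step_def list_eval_def)
next
  case (Cons k D)
  then have IH: "length (walk_step D v) = length v"
    "list_eval (walk_step D v) \<zeta> = (\<Sum>k\<leftarrow>D. inverse (\<zeta> ^ k)) * list_eval v \<zeta>" by auto
  have e: "walk_step (k # D) v = map2 (+) (drop k v @ take k v) (walk_step D v)" by (simp add: walk_step_def)
  have len: "length (drop k v @ take k v) = length (walk_step D v)" using IH(1) Cons.prems[of k] by simp
  show ?case
    unfolding e list_eval_add[OF len] using list_eval_rotate[OF assms(1) _ assms(3), of k] Cons.prems[of k] IH len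
    by (simp add: algebra_simps)
qed

text \<open>Parseval's identity for the cyclic group of order n, by orthogonality of the
  characters.\<close>

lemma list_eval_parseval:
  fixes v :: "int list"
  assumes n: "length v = n" "n > 0"
  shows "(\<Sum>c<n. list_eval v (cis (2 * pi / real n) ^ c) * cnj (list_eval v (cis (2 * pi / real n) ^ c)))
    = of_nat n * of_int (sum_list (map (\<lambda>x. x * x) v))"
proof -
  define w where "w = cis (2 * pi / real n)"
  have wn: "w ^ k = 1 \<longleftrightarrow> n dvd k" for k unfolding w_def by (rule cis_power_eq_1_iff[OF n(2)])
  have w0: "w \<noteq> 0" unfolding w_def by simp
  have cw: "cnj w = inverse w" unfolding w_def by (simp add: cis_cnj cis_inverse)
  have orth: "(\<Sum>c<n. (w ^ c) ^ r * inverse ((w ^ c) ^ s)) = (if r = s then of_nat n else 0)"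
    if rs: "r < n" "s < n" for r s
  proof -
    have "(w ^ r * inverse (w ^ s)) ^ n = 1"
      using wn[of n] by (simp add: power_mult_distrib power_inverse) (metis mult.commute power_mult power_one inverse_1 mult_1)
    from sum_root_unity_powers[OF this]
    have "(\<Sum>c<n. (w ^ r * inverse (w ^ s)) ^ c) = (if w ^ r * inverse (w ^ s) = 1 then of_nat n else 0)" .
    moreover have "w ^ r * inverse (w ^ s) = 1 \<longleftrightarrow> r = s"
    proof
      assume "w ^ r * inverse (w ^ s) = 1"
      then have e: "w ^ r = w ^ s" using w0 by (simp add: field_simps)
      have no: "i = j" if "w ^ i = w ^ j" "i \<le> j" "j < n" for i j
      proof -
        have "w ^ i * w ^ (j - i) = w ^ j" using that(2) by (subst power_add[symmetric]) simp
        then have "w ^ i * w ^ (j - i) = w ^ i * 1" using that(1) by simp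
        then have "w ^ (j - i) = 1" using w0 by simp
        then have "n dvd j - i" using wn by simp
        then show ?thesis using that nat_dvd_not_less[of "j - i" n] by (cases "j - i = 0") auto
      qed
      show "r = s" using no[of r s] no[of s r] e rs by (cases "r \<le> s") auto
    qed (use w0 in simp)
    moreover have "(w ^ c) ^ r * inverse ((w ^ c) ^ s) = (w ^ r * inverse (w ^ s)) ^ c" for c
      by (simp add: power_mult_distrib power_inverse mult.commute flip: power_mult)
    ultimately show ?thesis by simp
  qed
  have cz: "cnj ((w ^ c) ^ s) = inverse ((w ^ c) ^ s)" for c s by (simp add: cw power_inverse)
  have "(\<Sum>c<n. list_eval v (w ^ c) * cnj (list_eval v (w ^ c)))
    = (\<Sum>c<n. \<Sum>r<n. \<Sum>s<n. of_int (v ! r) * of_int (v ! s) * ((w ^ c) ^ r * inverse ((w ^ c) ^ s)))"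
    unfolding list_eval_def n(1) cnj_sum complex_cnj_mult complex_cnj_of_int cz sum_product
    by (intro sum.cong refl) (simp add: mult_ac)
  also have "\<dots> = (\<Sum>r<n. \<Sum>s<n. of_int (v ! r) * of_int (v ! s) * (\<Sum>c<n. (w ^ c) ^ r * inverse ((w ^ c) ^ s)))"
    unfolding sum_distrib_left by (rule trans[OF sum.swap], rule sum.cong[OF refl], rule sum.swap)
  also have "\<dots> = (\<Sum>r<n. \<Sum>s<n. if r = s then of_int (v ! r) * of_int (v ! s) * of_nat n else 0)"
    by (intro sum.cong refl) (simp add: orth)
  also have "\<dots> = (\<Sum>r<n. of_int (v ! r) * of_int (v ! r) * of_nat n)" by simp
  also have "\<dots> = of_nat n * of_int (sum_list (map (\<lambda>x. x * x) v))"
    by (simp add: sum_list_sum_nth n(1) sum_distrib_left lessThan_atLeast0 mult_ac)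
  finally show ?thesis unfolding w_def .
qed

definition w30 :: complex where "w30 = cis (2 * pi / real 30)"

lemma w30_nonzero: "w30 \<noteq> 0"
  unfolding w30_def by simp

lemma w30_power_eq_1_iff: "w30 ^ k = 1 \<longleftrightarrow> 30 dvd k"
  unfolding w30_def by (rule cis_power_eq_1_iff) simp

lemma w30_power_30: "w30 ^ 30 = 1"
  by (simp add: w30_power_eq_1_iff)

text \<open>On roots of unity \<open>alpha\<close> is real, so the summands are its tenth powers.
  Written as a fifth power times its conjugate, the sum is accessible to Parseval's identity after
  only five steps of the walk.\<close>

definition energy :: "complex \<Rightarrow> complex \<Rightarrow> complex \<Rightarrow> complex" where
  "energy x1 x2 x3 = (\<Sum>c<30. let z = alpha (x1 ^ c) (x2 ^ c) (x3 ^ c) in z ^ 5 * cnj (z ^ 5))"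

lemma energy30_eq:
  assumes a: "a < 30" "b < 30"
  shows "energy (w30 ^ a) (w30 ^ b) (inverse (w30 ^ (a + b))) = 30 * of_int (energy30 (a, b))"
proof -
  define s where "s = (a + b) mod 30"
  \<comment> \<open>As a set of residues modulo 30, \<open>D\<close> is closed under negation, so
    the negative exponents in \<open>walk_step\<close> produce \<open>alpha\<close> all the
    same.\<close>
  define D where "D = [a, b, 30 - s, 30 - a, 30 - b, s]"
  let ?v0 = "1 # replicate 29 0 :: int list"
  define v where "v = walk_step D (walk_step D (walk_step D (walk_step D (walk_step D ?v0))))"
  have s: "s < 30" unfolding s_def by simp
  have D: "k \<le> 30" if "k \<in> set D" for k using that a s unfolding D_def by auto
  have step: "length (walk_step D u) = 30 \<and> list_eval (walk_step D u) \<zeta> = (\<Sum>k\<leftarrow>D. inverse (\<zeta> ^ k)) * list_eval u \<zeta>"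
    if "length u = 30" "\<zeta> ^ 30 = 1" for u \<zeta>
  proof -
    have "u \<noteq> []" using that by auto
    then show ?thesis using walk_step_eval[of \<zeta> u D] that D by simp
  qed
  have v: "length v = 30" "list_eval v \<zeta> = (\<Sum>k\<leftarrow>D. inverse (\<zeta> ^ k)) ^ 5" if z: "\<zeta> ^ 30 = 1" for \<zeta>
  proof -
    have l0: "length ?v0 = 30" by simp
    have e0: "list_eval ?v0 \<zeta> = 1"
      unfolding list_eval_def l0 by (simp add: sum.lessThan_Suc_shift[of _ 29, simplified] nth_Cons' cong: if_cong)
    have p5: "x ^ 5 = x * (x * (x * (x * (x * 1))))" for x :: complex by (simp add: numeral_eq_Suc)
    note s1 = step[OF l0 z]
    note s2 = step[OF conjunct1[OF s1] z]
    note s3 = step[OF conjunct1[OF s2] z]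
    note s4 = step[OF conjunct1[OF s3] z]
    note s5 = step[OF conjunct1[OF s4] z]
    show "length v = 30" using s5 unfolding v_def by blast
    show "list_eval v \<zeta> = (\<Sum>k\<leftarrow>D. inverse (\<zeta> ^ k)) ^ 5"
      unfolding v_def p5 s1[THEN conjunct2] s2[THEN conjunct2] s3[THEN conjunct2] s4[THEN conjunct2] s5[THEN conjunct2] e0 ..
  qed
  have al: "alpha ((w30 ^ a) ^ c) ((w30 ^ b) ^ c) (inverse (w30 ^ (a + b)) ^ c) = (\<Sum>k\<leftarrow>D. inverse ((w30 ^ c) ^ k))" for c
  proof -
    define \<zeta> where "\<zeta> = w30 ^ c"
    have z: "\<zeta> ^ 30 = 1" unfolding \<zeta>_def using w30_power_30 by (metis mult.commute power_mult power_one)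
    have z0: "\<zeta> \<noteq> 0" unfolding \<zeta>_def using w30_nonzero by simp
    have neg: "inverse (\<zeta> ^ (30 - k)) = \<zeta> ^ k" if "k \<le> 30" for k
      using that z by (intro inverse_unique) (simp flip: power_add)
    have ss: "\<zeta> ^ s = \<zeta> ^ (a + b)" unfolding s_def by (rule power_cong_mod[OF z]) (simp add: cong_def)
    have c: "(w30 ^ k) ^ c = \<zeta> ^ k" for k unfolding \<zeta>_def by (metis mult.commute power_mult)
    have "(\<Sum>k\<leftarrow>D. inverse (\<zeta> ^ k)) = inverse (\<zeta> ^ a) + inverse (\<zeta> ^ b) + \<zeta> ^ s + \<zeta> ^ a + \<zeta> ^ b + inverse (\<zeta> ^ s)"
      unfolding D_def using a s by (simp add: neg)
    then show ?thesis unfolding alpha_def power_inverse c ss \<zeta>_def[symmetric] by simp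
  qed
  have w1: "(w30 ^ c) ^ 30 = 1" for c using w30_power_30 by (metis mult.commute power_mult power_one)
  have "energy (w30 ^ a) (w30 ^ b) (inverse (w30 ^ (a + b))) = (\<Sum>c<30. list_eval v (w30 ^ c) * cnj (list_eval v (w30 ^ c)))"
    unfolding energy_def Let_def al v(2)[OF w1] ..
  also have "\<dots> = 30 * of_int (sum_list (map (\<lambda>x. x * x) v))"
    using list_eval_parseval[OF v(1)[of 1], folded w30_def] by simp
  also have "sum_list (map (\<lambda>x. x * x) v) = energy30 (a, b)"
    unfolding energy30_def v_def D_def s_def by (simp only: prod.case Let_def)
  finally show ?thesis .
qed


lemma sum_periodic:
  fixes F :: "nat \<Rightarrow> complex"
  assumes "\<And>c. F (c + m) = F c"
  shows "(\<Sum>c<m * k. F c) = of_nat k * (\<Sum>c<m. F c)"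
proof (induction k)
  case (Suc k)
  have shift: "F (c + m * j) = F c" for c j
  proof (induction j)
    case (Suc j)
    have "F (c + m * Suc j) = F (c + m * j + m)" by (simp add: algebra_simps)
    then show ?case using assms Suc by simp
  qed simp
  have "{..<m * Suc k} = {..<m * k} \<union> {m * k..<m * k + m}" by auto
  then have "(\<Sum>c<m * Suc k. F c) = (\<Sum>c<m * k. F c) + (\<Sum>c=m * k..<m * k + m. F c)"
    by (simp add: sum.union_disjoint ivl_disj_int)
  also have "(\<Sum>c=m * k..<m * k + m. F c) = (\<Sum>c<m. F (c + m * k))"
    using sum.shift_bounds_nat_ivl[of F 0 "m * k" m] by (simp add: add.commute lessThan_atLeast0)
  finally show ?case using Suc shift by (simp add: algebra_simps)
qed simp

text \<open>The summand has period m, so the sum up to 30 consists of 30 / m copies of the sum up to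
  m. This brings all divisors m of 30 under one table.\<close>

lemma energy_isospectral:
  assumes m: "m > 0" "m dvd 30" and x: "unity_triple m x1 x2 x3" and y: "unity_triple m y1 y2 y3"
    and iso: "isospectral m x1 x2 x3 y1 y2 y3"
  shows "energy x1 x2 x3 = energy y1 y2 y3"
proof -
  define f where "f z = z ^ 5 * cnj (z ^ 5)" for z :: complex
  obtain k where k: "30 = m * k" using m(2) by (elim dvdE)
  have e: "energy z1 z2 z3 = of_nat k * (\<Sum>c<m. f (alpha (z1 ^ c) (z2 ^ c) (z3 ^ c)))"
    if z: "unity_triple m z1 z2 z3" for z1 z2 z3
  proof -
    have "energy z1 z2 z3 = (\<Sum>c<m * k. f (alpha (z1 ^ c) (z2 ^ c) (z3 ^ c)))"
      unfolding energy_def f_def Let_def k ..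
    also have "\<dots> = of_nat k * (\<Sum>c<m. f (alpha (z1 ^ c) (z2 ^ c) (z3 ^ c)))"
      by (rule sum_periodic) (use z in \<open>simp add: unity_triple_def power_add\<close>)
    finally show ?thesis .
  qed
  show ?thesis unfolding e[OF x] e[OF y] isospectral_sum[OF iso] ..
qed

text \<open>Multiplication by the unit k permutes the exponents modulo 30.\<close>

lemma energy_power_equiv:
  assumes y: "unity_triple 30 y1 y2 y3" and e: "power_equiv 30 x1 x2 x3 y1 y2 y3"
  shows "energy x1 x2 x3 = energy y1 y2 y3"
proof -
  obtain k where k: "coprime k 30" "{#x1, x2, x3#} = {#y1 ^ k, y2 ^ k, y3 ^ k#}"
    using e unfolding power_equiv_def by blast
  obtain q where q: "[k * q = 1] (mod 30)" using k(1) cong_solve_coprime_nat[of k 30] by auto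
  have yp: "y1 ^ 30 = 1" "y2 ^ 30 = 1" "y3 ^ 30 = 1" using y unfolding unity_triple_def by auto
  define F where "F c = (let z = alpha (y1 ^ c) (y2 ^ c) (y3 ^ c) in z ^ 5 * cnj (z ^ 5))" for c
  have Fm: "F (c mod 30) = F c" for c
  proof -
    have "z ^ (c mod 30) = z ^ c" if "z ^ 30 = 1" for z :: complex
      by (rule power_cong_mod[OF that]) (simp add: cong_def)
    then show ?thesis unfolding F_def using yp by metis
  qed
  have "energy x1 x2 x3 = (\<Sum>c<30. F (k * c))"
    unfolding energy_def F_def alpha_power_mset[OF k(2)] by (simp add: power_mult)
  also have "\<dots> = (\<Sum>c<30. F c)"
  proof (rule sum.reindex_bij_witness[of _ "\<lambda>c. (q * c) mod 30" "\<lambda>c. (k * c) mod 30"])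
    fix c :: nat assume c: "c \<in> {..<30}"
    have "(q * ((k * c) mod 30)) mod 30 = (k * q * c) mod 30" by (simp add: mod_simps mult_ac)
    also have "\<dots> = c" using cong_scalar_right[OF q, of c] c by (simp add: cong_def)
    finally show "(q * ((k * c) mod 30)) mod 30 = c" .
    have "(k * ((q * c) mod 30)) mod 30 = (k * q * c) mod 30" by (simp add: mod_simps mult_ac)
    also have "\<dots> = c" using cong_scalar_right[OF q, of c] c by (simp add: cong_def)
    finally show "(k * ((q * c) mod 30)) mod 30 = c" .
    show "F ((k * c) mod 30) = F (k * c)" by (rule Fm)
  qed auto
  also have "\<dots> = energy y1 y2 y3" unfolding energy_def F_def ..
  finally show ?thesis .
qed

section \<open>Reduction of triples to representatives\<close>

lemma w30_exponent:
  assumes "z ^ 30 = 1"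
  obtains a where "z = w30 ^ a" "a < 30"
proof -
  obtain k where "z = cis (2 * pi / real 30) ^ k" "k < 30"
    using root_unity_generator[of 30 z] assms by auto
  then show ?thesis using that unfolding w30_def by blast
qed

text \<open>The exponent a1, whose gcd g with 30 is smallest, is u * g for a unit u; multiplying by
  the inverse of u turns the pair (a1, a2) into (g, b). Units preserve gcds with 30, and a3 has the
  same gcd as a1 + a2, so the ordering demanded by \<open>reps30\<close> is inherited.\<close>

lemma rep30_ordered:
  assumes a: "a1 < 30" "a2 < 30" "a3 < 30" "a1 \<noteq> 0" "a2 \<noteq> 0" "a3 \<noteq> 0" and s: "30 dvd a1 + a2 + a3"
    and min: "gcd a1 30 \<le> gcd a2 30" "gcd a1 30 \<le> gcd a3 30"
  obtains a b where "(a, b) \<in> set reps30" "a < 30" "b < 30"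
    "power_equiv 30 (w30 ^ a1) (w30 ^ a2) (w30 ^ a3) (w30 ^ a) (w30 ^ b) (inverse (w30 ^ (a + b)))"
proof -
  define g where "g = gcd a1 30"
  have "gcd a1 30 = gcd g 30" unfolding g_def by simp
  then obtain u where u: "coprime u 30" "[a1 = u * g] (mod 30)" using unit_multiple[of 30 a1 g] by auto
  obtain q where q: "[u * q = 1] (mod 30)" using u(1) cong_solve_coprime_nat[of u 30] by auto
  define b where "b = (q * a2) mod 30"
  have b: "b < 30" "[a2 = u * b] (mod 30)"
  proof -
    show "b < 30" unfolding b_def by simp
    have "[u * b = u * (q * a2)] (mod 30)" unfolding b_def by (simp add: cong_def mod_simps)
    moreover have "[u * (q * a2) = 1 * a2] (mod 30)" using cong_scalar_right[OF q, of a2] by (simp add: mult.assoc)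
    ultimately show "[a2 = u * b] (mod 30)" by (metis cong_sym cong_trans mult_1)
  qed
  have gu: "gcd (u * c) 30 = gcd c 30" for c :: nat
    using u(1) by (simp add: gcd_mult_left_left_cancel coprime_commute)
  have ga2: "gcd a2 30 = gcd b 30" using cong_gcd_eq[OF b(2)] gu[of b] by simp
  have sumc: "[a1 + a2 = u * (g + b)] (mod 30)" using cong_add[OF u(2) b(2)] by (simp add: distrib_left)
  have g12: "gcd (a1 + a2) 30 = gcd (g + b) 30" using cong_gcd_eq[OF sumc] gu[of "g + b"] by simp
  have "gcd a3 30 = gcd (a1 + a2) 30"
  proof (rule dvd_antisym)
    have "gcd a3 30 dvd a1 + a2 + a3" using s by (meson dvd_trans gcd_dvd2)
    then have "gcd a3 30 dvd a1 + a2" by (simp add: dvd_add_left_iff)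
    then show "gcd a3 30 dvd gcd (a1 + a2) 30" by simp
    have "gcd (a1 + a2) 30 dvd a1 + a2 + a3" using s by (meson dvd_trans gcd_dvd2)
    then have "gcd (a1 + a2) 30 dvd a3" using dvd_add_right_iff[of "gcd (a1 + a2) 30" "a1 + a2" a3] by simp
    then show "gcd (a1 + a2) 30 dvd gcd a3 30" by simp
  qed
  then have min': "gcd g 30 \<le> gcd b 30" "gcd g 30 \<le> gcd (g + b) 30"
    using min ga2 g12 unfolding g_def by simp_all
  have gdvd: "g dvd 30" unfolding g_def by simp
  have g30: "g \<noteq> 30"
  proof
    assume "g = 30"
    then have "30 dvd a1" unfolding g_def by (metis gcd_dvd1)
    then show False using a by (auto dest: dvd_imp_le)
  qed
  have "g \<le> 30" using gdvd by (rule dvd_imp_le) simp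
  then have "g \<in> {0..30}" by simp
  also have "{0..30} = set [0..<31]" by auto
  finally have "g \<in> set (filter (\<lambda>g. g dvd 30) [0..<31])" using gdvd by simp
  also have "filter (\<lambda>g::nat. g dvd 30) [0..<31] = [1, 2, 3, 5, 6, 10, 15, 30]" by code_simp
  finally have gset: "g \<in> set [1, 2, 3, 5, 6, 10, 15]" using g30 by auto
  have b0: "b \<noteq> 0"
  proof
    assume "b = 0"
    then have "30 dvd a2" using b(2) by (simp add: cong_0_iff)
    then show False using a by (auto dest: dvd_imp_le)
  qed
  have gb: "(g + b) mod 30 \<noteq> 0"
  proof
    assume "(g + b) mod 30 = 0"
    then have "gcd (g + b) 30 = 30" by (metis dvd_eq_mod_eq_0 gcd_nat.absorb2)
    then have "gcd a3 30 = 30" using \<open>gcd a3 30 = gcd (a1 + a2) 30\<close> g12 by simp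
    then have "30 dvd a3" by (metis gcd_dvd1)
    then show False using a by (auto dest: dvd_imp_le)
  qed
  have "(g, b) \<in> set reps30" unfolding reps30_def using gset b0 b(1) gb min' by auto
  moreover have "g < 30" using \<open>g \<le> 30\<close> g30 by simp
  moreover have "power_equiv 30 (w30 ^ a1) (w30 ^ a2) (w30 ^ a3) (w30 ^ g) (w30 ^ b) (inverse (w30 ^ (g + b)))"
    unfolding power_equiv_def
  proof (intro exI[of _ u] conjI u(1))
    have e1: "w30 ^ a1 = (w30 ^ g) ^ u"
      using power_cong_mod[OF w30_power_30 u(2)] by (simp add: mult.commute flip: power_mult)
    have e2: "w30 ^ a2 = (w30 ^ b) ^ u"
      using power_cong_mod[OF w30_power_30 b(2)] by (simp add: mult.commute flip: power_mult)
    have e12: "w30 ^ (a1 + a2) = (w30 ^ (g + b)) ^ u" by (simp only: power_add e1 e2 power_mult_distrib)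
    have "w30 ^ (a1 + a2) * w30 ^ a3 = 1"
      using s w30_power_eq_1_iff[of "a1 + a2 + a3"] by (simp add: power_add)
    then have "w30 ^ a3 = inverse (w30 ^ (a1 + a2))" using inverse_unique by metis
    then have e3: "w30 ^ a3 = inverse (w30 ^ (g + b)) ^ u" unfolding e12 by (simp add: power_inverse)
    show "{#w30 ^ a1, w30 ^ a2, w30 ^ a3#} = {#(w30 ^ g) ^ u, (w30 ^ b) ^ u, inverse (w30 ^ (g + b)) ^ u#}"
      unfolding e1 e2 e3 ..
  qed
  ultimately show ?thesis using that b(1) by blast
qed

lemma power_equiv_perm:
  "power_equiv m x2 x1 x3 y1 y2 y3 = power_equiv m x1 x2 x3 y1 y2 y3"
  "power_equiv m x3 x2 x1 y1 y2 y3 = power_equiv m x1 x2 x3 y1 y2 y3"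
  by (simp_all only: power_equiv_def add_mset_commute[of x2 x1] add_mset_commute[of x3 x2]
      add_mset_commute[of x3 x1] add_mset_commute[of x2 x1])

lemma rep30:
  assumes x: "unity_triple 30 x1 x2 x3" and ne: "1 \<notin> {x1, x2, x3}"
  obtains a b where "(a, b) \<in> set reps30" "a < 30" "b < 30"
    "power_equiv 30 x1 x2 x3 (w30 ^ a) (w30 ^ b) (inverse (w30 ^ (a + b)))"
proof -
  have xm: "x1 ^ 30 = 1" "x2 ^ 30 = 1" "x3 ^ 30 = 1" "x1 * x2 * x3 = 1" using x unfolding unity_triple_def by auto
  obtain a1 where a1: "x1 = w30 ^ a1" "a1 < 30" using w30_exponent[OF xm(1)] by blast
  obtain a2 where a2: "x2 = w30 ^ a2" "a2 < 30" using w30_exponent[OF xm(2)] by blast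
  obtain a3 where a3: "x3 = w30 ^ a3" "a3 < 30" using w30_exponent[OF xm(3)] by blast
  have nz: "a1 \<noteq> 0" "a2 \<noteq> 0" "a3 \<noteq> 0" using ne a1 a2 a3 by (metis insertCI power_0)+
  have s: "30 dvd a1 + a2 + a3"
    using xm(4) w30_power_eq_1_iff[of "a1 + a2 + a3"] unfolding a1 a2 a3 by (simp add: power_add)
  then have s2: "30 dvd a2 + a1 + a3" "30 dvd a3 + a2 + a1" by (simp_all add: add_ac)
  consider "gcd a1 30 \<le> gcd a2 30" "gcd a1 30 \<le> gcd a3 30"
    | "gcd a2 30 \<le> gcd a1 30" "gcd a2 30 \<le> gcd a3 30"
    | "gcd a3 30 \<le> gcd a2 30" "gcd a3 30 \<le> gcd a1 30" by linarith
  then show ?thesis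
  proof cases
    case 1
    obtain a b where r: "(a, b) \<in> set reps30" "a < 30" "b < 30"
      "power_equiv 30 (w30 ^ a1) (w30 ^ a2) (w30 ^ a3) (w30 ^ a) (w30 ^ b) (inverse (w30 ^ (a + b)))"
      by (rule rep30_ordered[OF a1(2) a2(2) a3(2) nz(1-3) s 1])
    have "power_equiv 30 x1 x2 x3 (w30 ^ a) (w30 ^ b) (inverse (w30 ^ (a + b)))"
      unfolding a1(1) a2(1) a3(1) using r(4) by blast
    then show ?thesis by (rule that[OF r(1-3)])
  next
    case 2
    obtain a b where r: "(a, b) \<in> set reps30" "a < 30" "b < 30"
      "power_equiv 30 (w30 ^ a2) (w30 ^ a1) (w30 ^ a3) (w30 ^ a) (w30 ^ b) (inverse (w30 ^ (a + b)))"
      by (rule rep30_ordered[OF a2(2) a1(2) a3(2) nz(2,1,3) s2(1) 2])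
    have "power_equiv 30 x1 x2 x3 (w30 ^ a) (w30 ^ b) (inverse (w30 ^ (a + b)))"
      unfolding a1(1) a2(1) a3(1) using r(4) power_equiv_perm(1) by blast
    then show ?thesis by (rule that[OF r(1-3)])
  next
    case 3
    obtain a b where r: "(a, b) \<in> set reps30" "a < 30" "b < 30"
      "power_equiv 30 (w30 ^ a3) (w30 ^ a2) (w30 ^ a1) (w30 ^ a) (w30 ^ b) (inverse (w30 ^ (a + b)))"
      by (rule rep30_ordered[OF a3(2) a2(2) a1(2) nz(3,2,1) s2(2) 3])
    have "power_equiv 30 x1 x2 x3 (w30 ^ a) (w30 ^ b) (inverse (w30 ^ (a + b)))"
      unfolding a1(1) a2(1) a3(1) using r(4) power_equiv_perm(2) by blast
    then show ?thesis by (rule that[OF r(1-3)])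
  qed
qed

lemma equiv30_power_equiv:
  assumes a: "a < 30" "b < 30" and e: "equiv30 (a, b) (a', b')"
  shows "power_equiv 30 (w30 ^ a) (w30 ^ b) (inverse (w30 ^ (a + b)))
    (w30 ^ a') (w30 ^ b') (inverse (w30 ^ (a' + b')))"
proof -
  define c where "c = (60 - (a + b)) mod 30"
  obtain u where u: "u \<in> set [1, 7, 11, 13, 17, 19, 23, 29]" and
    mem: "let x = u * a' mod 30; y = u * b' mod 30; z = (60 - (x + y)) mod 30; c = (60 - (a + b)) mod 30
      in (a, b, c) \<in> set [(x, y, z), (x, z, y), (y, x, z), (y, z, x), (z, x, y), (z, y, x)]"
    using e unfolding equiv30_def prod.case list_ex_iff by blast
  define x where "x = u * a' mod 30"
  define y where "y = u * b' mod 30"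
  define z where "z = (60 - (x + y)) mod 30"
  have "(a, b, c) \<in> set [(x, y, z), (x, z, y), (y, x, z), (y, z, x), (z, x, y), (z, y, x)]"
    using mem by (simp only: Let_def x_def y_def z_def c_def)
  then have "a = x \<and> b = y \<and> c = z \<or> a = x \<and> b = z \<and> c = y \<or> a = y \<and> b = x \<and> c = z \<or>
      a = y \<and> b = z \<and> c = x \<or> a = z \<and> b = x \<and> c = y \<or> a = z \<and> b = y \<and> c = x"
    by simp
  then have abc: "{#a, b, c#} = {#x, y, z#}" by (elim disjE conjE) (simp_all add: add_mset_commute)
  have third: "w30 ^ ((60 - (i + j)) mod 30) = inverse (w30 ^ (i + j))" if "i < 30" "j < 30" for i j
  proof -
    have "w30 ^ (i + j) * w30 ^ (60 - (i + j)) = w30 ^ 60" using that by (subst power_add[symmetric]) simp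
    also have "\<dots> = 1" using w30_power_eq_1_iff[of 60] by simp
    finally have "w30 ^ (60 - (i + j)) = inverse (w30 ^ (i + j))" using inverse_unique by metis
    moreover have "w30 ^ ((60 - (i + j)) mod 30) = w30 ^ (60 - (i + j))"
      by (rule power_cong_mod[OF w30_power_30]) (simp add: cong_def)
    ultimately show ?thesis by simp
  qed
  have wx: "w30 ^ x = (w30 ^ a') ^ u"
  proof -
    have "w30 ^ x = w30 ^ (u * a')" unfolding x_def by (rule power_cong_mod[OF w30_power_30]) (simp add: cong_def)
    then show ?thesis by (simp add: mult.commute flip: power_mult)
  qed
  have wy: "w30 ^ y = (w30 ^ b') ^ u"
  proof -
    have "w30 ^ y = w30 ^ (u * b')" unfolding y_def by (rule power_cong_mod[OF w30_power_30]) (simp add: cong_def)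
    then show ?thesis by (simp add: mult.commute flip: power_mult)
  qed
  have wz: "w30 ^ z = inverse (w30 ^ (a' + b')) ^ u"
  proof -
    have "w30 ^ z = inverse (w30 ^ (x + y))" unfolding z_def by (rule third) (simp_all add: x_def y_def)
    then show ?thesis by (simp add: power_add wx wy power_inverse power_mult_distrib)
  qed
  have wc: "w30 ^ c = inverse (w30 ^ (a + b))" unfolding c_def by (rule third[OF a])
  have "image_mset (\<lambda>i. w30 ^ i) {#a, b, c#} = image_mset (\<lambda>i. w30 ^ i) {#x, y, z#}" unfolding abc ..
  then have "{#w30 ^ a, w30 ^ b, inverse (w30 ^ (a + b))#}
      = {#(w30 ^ a') ^ u, (w30 ^ b') ^ u, inverse (w30 ^ (a' + b')) ^ u#}"
    by (simp only: image_mset_add_mset image_mset_empty wx wy wz wc)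
  moreover have "coprime u 30"
  proof -
    have "list_all (\<lambda>u::nat. coprime u 30) [1, 7, 11, 13, 17, 19, 23, 29]" by code_simp
    then show ?thesis using u by (simp only: list_all_iff)
  qed
  ultimately show ?thesis unfolding power_equiv_def by blast
qed

text \<open>Both triples are read as triples of 30th roots of unity; the unit modulo 30 found there
  is a unit modulo m too.\<close>

theorem power_equiv_of_isospectral_small:
  assumes m: "m > 0" "m dvd 30" and x: "unity_triple m x1 x2 x3" and y: "unity_triple m y1 y2 y3"
    and ne: "1 \<notin> {x1, x2, x3}" "1 \<notin> {y1, y2, y3}"
    and iso: "isospectral m x1 x2 x3 y1 y2 y3"
  shows "power_equiv m x1 x2 x3 y1 y2 y3"
proof -
  obtain k where k: "30 = m * k" using m(2) by (elim dvdE)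
  have lift: "unity_triple 30 z1 z2 z3" if "unity_triple m z1 z2 z3" for z1 z2 z3
    using that unfolding unity_triple_def k by (auto simp: power_mult)
  have x30: "unity_triple 30 x1 x2 x3" and y30: "unity_triple 30 y1 y2 y3" using x y lift by blast+
  have rt: "unity_triple 30 (w30 ^ a) (w30 ^ b) (inverse (w30 ^ (a + b)))" for a b
  proof -
    have "(w30 ^ i) ^ 30 = 1" for i using w30_power_30 by (metis mult.commute power_mult power_one)
    moreover have "w30 ^ a * w30 ^ b * inverse (w30 ^ (a + b)) = 1"
      unfolding power_add[symmetric] using w30_nonzero by (intro right_inverse) simp
    ultimately show ?thesis unfolding unity_triple_def by (simp add: power_inverse)
  qed
  obtain a b where ab: "(a, b) \<in> set reps30" "a < 30" "b < 30"
    "power_equiv 30 x1 x2 x3 (w30 ^ a) (w30 ^ b) (inverse (w30 ^ (a + b)))"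
    using rep30[OF x30 ne(1)] by blast
  obtain a' b' where ab': "(a', b') \<in> set reps30" "a' < 30" "b' < 30"
    "power_equiv 30 y1 y2 y3 (w30 ^ a') (w30 ^ b') (inverse (w30 ^ (a' + b')))"
    using rep30[OF y30 ne(2)] by blast
  have "energy (w30 ^ a) (w30 ^ b) (inverse (w30 ^ (a + b)))
      = energy (w30 ^ a') (w30 ^ b') (inverse (w30 ^ (a' + b')))"
    using energy_power_equiv[OF rt ab(4)] energy_power_equiv[OF rt ab'(4)] energy_isospectral[OF m x y iso] by simp
  then have "(30::complex) * of_int (energy30 (a, b)) = 30 * of_int (energy30 (a', b'))"
    unfolding energy30_eq[OF ab(2,3)] energy30_eq[OF ab'(2,3)] .
  then have "energy30 (a, b) = energy30 (a', b')" by simp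
  then have "equiv30 (a, b) (a', b')"
    by (rule energy30_separates[OF ab(1) ab'(1)])
  then have "power_equiv 30 (w30 ^ a) (w30 ^ b) (inverse (w30 ^ (a + b)))
    (w30 ^ a') (w30 ^ b') (inverse (w30 ^ (a' + b')))" by (rule equiv30_power_equiv[OF ab(2,3)])
  from power_equiv_trans[OF power_equiv_trans[OF ab(4) this] power_equiv_sym[OF rt ab'(4)]]
  have p: "power_equiv 30 x1 x2 x3 y1 y2 y3" .
  have "coprime j m" if "coprime j 30" for j using that unfolding k by simp
  then show ?thesis using p unfolding power_equiv_def by blast
qed

section \<open>Permutation matrices and the spectrum of a circulant\<close>


lemma permutation_mat_carrier: "permutation_mat n P \<Longrightarrow> P \<in> carrier_mat n n"
  unfolding permutation_mat_def by auto

lemma permutation_mat_transpose_right: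
  assumes "permutation_mat n (P :: complex mat)"
  shows "P * transpose_mat P = 1\<^sub>m n"
proof -
  obtain p where p: "p permutes {..<n}" "P = mat n n (\<lambda>(i, j). if j = p i then 1 else 0)"
    using assms unfolding permutation_mat_def by blast
  show ?thesis
  proof (rule eq_matI)
    fix i j assume "i < dim_row (1\<^sub>m n)" "j < dim_col (1\<^sub>m n :: complex mat)"
    then have ij: "i < n" "j < n" by auto
    have pi: "p i < n" using permutes_in_image[OF p(1), of i] ij by simp
    have "(P * transpose_mat P) $$ (i, j) = (\<Sum>k = 0..<n. (if k = p i then 1 else 0) * (if k = p j then 1 else 0))"
      using ij by (simp add: p(2) scalar_prod_def)
    also have "\<dots> = (\<Sum>k = 0..<n. if k = p i then (if p i = p j then 1 else 0) else 0)"
      by (intro sum.cong) auto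
    also have "\<dots> = (if p i = p j then 1 else 0)" using pi by simp
    also have "p i = p j \<longleftrightarrow> i = j" using permutes_inj[OF p(1)] by (auto dest: injD)
    finally show "(P * transpose_mat P) $$ (i, j) = 1\<^sub>m n $$ (i, j)" using ij by simp
  qed (simp_all add: p(2))
qed

lemma permutation_mat_transpose_left:
  assumes "permutation_mat n (P :: complex mat)"
  shows "transpose_mat P * P = 1\<^sub>m n"
  using permutation_mat_transpose_right[OF assms] permutation_mat_carrier[OF assms]
  by (intro mat_mult_left_right_inverse[of P n]) auto

lemma permutation_mat_mult_left:
  assumes p: "p permutes {..<n}" and B: "B \<in> carrier_mat n n" and ij: "i < n" "j < n"
  shows "(mat n n (\<lambda>(i, j). if j = p i then 1 else 0) * B) $$ (i, j) = (B :: complex mat) $$ (p i, j)"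
proof -
  have pi: "p i < n" using permutes_in_image[OF p, of i] ij by simp
  have "(mat n n (\<lambda>(i, j). if j = p i then 1 else 0) * B) $$ (i, j)
     = (\<Sum>k = 0..<n. (if k = p i then 1 else 0) * B $$ (k, j))"
    using ij B by (simp add: scalar_prod_def)
  also have "\<dots> = (\<Sum>k = 0..<n. if k = p i then B $$ (p i, j) else 0)" by (intro sum.cong) auto
  finally show ?thesis using pi by simp
qed

lemma permutation_mat_mult_right:
  assumes q: "q permutes {..<n}" and B: "B \<in> carrier_mat n n" and il: "i < n" "l < n"
  shows "(B * mat n n (\<lambda>(i, j). if j = q i then 1 else 0)) $$ (i, q l) = (B :: complex mat) $$ (i, l)"
proof -
  have ql: "q l < n" using permutes_in_image[OF q, of l] il by simp
  have "(B * mat n n (\<lambda>(i, j). if j = q i then 1 else 0)) $$ (i, q l)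
     = (\<Sum>k = 0..<n. B $$ (i, k) * (if q l = q k then 1 else 0))"
    using il ql B by (simp add: scalar_prod_def)
  also have "\<dots> = (\<Sum>k = 0..<n. if k = l then B $$ (i, l) else 0)"
    using permutes_inj[OF q] by (intro sum.cong) (auto dest: injD)
  finally show ?thesis using il by simp
qed

lemma zero_one_circulant_entry:
  assumes A: "zero_one_circulant n (A :: complex mat)" and ij: "i < n" "j < n"
  shows "A $$ (i, j) = (if (j + n - i) mod n \<in> circulant_support A then 1 else 0)"
proof -
  have circ: "circulant n A" and el: "elements_mat A \<subseteq> {0, 1}" using A unfolding zero_one_circulant_def by auto
  have car: "A \<in> carrier_mat n n" using circ unfolding circulant_def by blast
  have "int (j + n - i) = int j - int i + int n" using ij by (simp add: of_nat_diff)
  then have "int ((j + n - i) mod n) = (int j - int i) mod int n"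
    by (simp only: zmod_int mod_add_self2)
  then have e: "nat ((int j - int i) mod int n) = (j + n - i) mod n" by (metis nat_int)
  have "A $$ (i, j) \<in> elements_mat A" using ij car by (auto intro: elements_matI)
  then have "A $$ (i, j) \<in> {0, 1}" using el by blast
  then show ?thesis using circulant_entry_eq_1_iff[OF circ ij] unfolding e by auto
qed

lemma circulant_carrier: "zero_one_circulant n A \<Longrightarrow> A \<in> carrier_mat n n"
  unfolding zero_one_circulant_def circulant_def by blast

lemma circulant_support_subset:
  assumes "zero_one_circulant n A"
  shows "circulant_support A \<subseteq> {..<n}"
  using circulant_carrier[OF assms] unfolding circulant_support_def by auto

text \<open>Row i of A is taken from row u' i of B, where u' is the inverse of u, and column l of B
  goes to column j = u l + v. Then u (l - u' i) + v = j - i, so membership in the two supports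
  agrees.\<close>

lemma affine_image_mat_equiv:
  assumes A: "zero_one_circulant n (A :: complex mat)" and B: "zero_one_circulant n B" and n: "n \<ge> 1"
    and u: "gcd u n = 1" and S: "circulant_support A = affine_image n u v (circulant_support B)"
  shows "\<exists>P Q. permutation_mat n P \<and> permutation_mat n Q \<and> A = P * B * Q"
proof -
  have cu: "coprime u n" using u coprime_iff_gcd_eq_1 by blast
  obtain u' where u': "[u * u' = 1] (mod n)" using cong_solve_coprime_nat[OF cu] by auto
  \<comment> \<open>From n on both maps are the identity, as \<open>permutes\<close>
    requires.\<close>
  define p where "p i = (if i < n then (u' * i) mod n else i)" for i
  define q where "q i = (if i < n then (u * i + v) mod n else i)" for i
  have cancel: "[i = j] (mod n)" if "[u * i = u * j] (mod n)" for i j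
    using that cu by (simp add: cong_mult_lcancel_nat)
  have uu: "[u * (u' * i) = i] (mod n)" for i using cong_scalar_right[OF u', of i] by (simp add: mult.assoc)
  have perm: "f permutes {..<n}" if f: "\<And>i. i < n \<Longrightarrow> f i < n" "\<And>i. \<not> i < n \<Longrightarrow> f i = i"
      and inj: "\<And>i j. i < n \<Longrightarrow> j < n \<Longrightarrow> f i = f j \<Longrightarrow> i = j" for f :: "nat \<Rightarrow> nat"
  proof -
    have "inj_on f {..<n}" using inj by (intro inj_onI) auto
    moreover have "f ` {..<n} \<subseteq> {..<n}" using f(1) by auto
    ultimately have "bij_betw f {..<n} {..<n}" by (simp add: bij_betw_def endo_inj_surj)
    then show ?thesis using f(2) by (intro bij_imp_permutes) auto
  qed
  have p: "p permutes {..<n}"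
  proof (rule perm)
    fix i j assume ij: "i < n" "j < n" "p i = p j"
    then have "[u' * i = u' * j] (mod n)" by (simp add: p_def cong_def)
    then have "[u * (u' * i) = u * (u' * j)] (mod n)" by (rule cong_scalar_left)
    then have "[i = j] (mod n)" using uu cong_trans cong_sym by meson
    then show "i = j" using ij by (simp add: cong_def)
  qed (use n in \<open>auto simp: p_def\<close>)
  have q: "q permutes {..<n}"
  proof (rule perm)
    fix i j assume ij: "i < n" "j < n" "q i = q j"
    then have "[u * i + v = u * j + v] (mod n)" by (simp add: q_def cong_def)
    then have "[u * i = u * j] (mod n)" by (simp add: cong_add_rcancel_nat)
    then have "[i = j] (mod n)" by (rule cancel)
    then show "i = j" using ij by (simp add: cong_def)
  qed (use n in \<open>auto simp: q_def\<close>)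
  define P :: "complex mat" where "P = mat n n (\<lambda>(i, j). if j = p i then 1 else 0)"
  define Q :: "complex mat" where "Q = mat n n (\<lambda>(i, j). if j = q i then 1 else 0)"
  have Tsub: "circulant_support B \<subseteq> {..<n}" by (rule circulant_support_subset[OF B])
  have carB: "B \<in> carrier_mat n n" and carA: "A \<in> carrier_mat n n" using A B circulant_carrier by auto
  have carP: "P \<in> carrier_mat n n" unfolding P_def by simp
  have mem: "(u * t + v) mod n \<in> circulant_support A \<longleftrightarrow> t \<in> circulant_support B" if t: "t < n" for t
  proof
    assume "(u * t + v) mod n \<in> circulant_support A"
    then obtain t' where t': "t' \<in> circulant_support B" "(u * t + v) mod n = (u * t' + v) mod n"
      unfolding S affine_image_def by auto
    then have "[u * t = u * t'] (mod n)" by (simp add: cong_add_rcancel_nat flip: cong_def)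
    then have "[t = t'] (mod n)" by (rule cancel)
    moreover have "t' < n" using t'(1) Tsub by auto
    ultimately have "t = t'" using t by (simp add: cong_def)
    then show "t \<in> circulant_support B" using t'(1) by simp
  qed (simp add: S affine_image_def)
  have "A = P * B * Q"
  proof (rule eq_matI)
    fix i j assume "i < dim_row (P * B * Q)" "j < dim_col (P * B * Q)"
    then have ij: "i < n" "j < n" unfolding P_def Q_def by auto
    then obtain l where l: "l < n" "j = q l" using permutes_image[OF q] by (metis imageE lessThan_iff)
    have pi: "p i < n" using permutes_in_image[OF p, of i] ij by simp
    have "(P * B * Q) $$ (i, j) = (P * B) $$ (i, l)"
      unfolding l(2) Q_def by (rule permutation_mat_mult_right[OF q _ ij(1) l(1)]) (use carP carB in simp)
    also have "\<dots> = B $$ (p i, l)" unfolding P_def by (rule permutation_mat_mult_left[OF p carB ij(1) l(1)])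
    also have "\<dots> = (if (l + n - p i) mod n \<in> circulant_support B then 1 else 0)"
      by (rule zero_one_circulant_entry[OF B pi l(1)])
    also have "(l + n - p i) mod n \<in> circulant_support B \<longleftrightarrow> (u * ((l + n - p i) mod n) + v) mod n \<in> circulant_support A"
      using mem[of "(l + n - p i) mod n"] n by simp
    also have "(u * ((l + n - p i) mod n) + v) mod n = (j + n - i) mod n"
    proof -
      have "[u * ((l + n - p i) mod n) + v + i = u * (l + n - p i) + v + u * p i] (mod n)"
      proof (intro cong_add cong_refl)
        show "[u * ((l + n - p i) mod n) = u * (l + n - p i)] (mod n)" by (simp add: cong_def mod_simps)
        have "[u * p i = u * (u' * i)] (mod n)" using ij by (simp add: p_def cong_def mod_simps)
        then show "[i = u * p i] (mod n)" using uu[of i] cong_trans cong_sym by meson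
      qed
      also have "u * (l + n - p i) + v + u * p i = u * (l + n) + v"
      proof -
        have "u * (l + n - p i) + u * p i = u * (l + n - p i + p i)" by (simp only: distrib_left)
        also have "l + n - p i + p i = l + n" using pi by simp
        finally show ?thesis by linarith
      qed
      also have "[u * (l + n) + v = j] (mod n)"
      proof -
        have "u * (l + n) + v = (u * l + v) + u * n" by (simp add: distrib_left)
        then have "(u * (l + n) + v) mod n = (u * l + v) mod n" by (simp only: mod_mult_self1)
        then show ?thesis using l by (simp add: q_def cong_def)
      qed
      finally have a: "[u * ((l + n - p i) mod n) + v + i = j] (mod n)" .
      have "[(j + n - i) + i = j] (mod n)" using ij by (simp add: cong_def)
      then have "[u * ((l + n - p i) mod n) + v + i = (j + n - i) + i] (mod n)" using a cong_trans cong_sym by meson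
      then have "[u * ((l + n - p i) mod n) + v = j + n - i] (mod n)" by (simp only: cong_add_rcancel_nat)
      then show ?thesis by (simp add: cong_def)
    qed
    also have "(if (j + n - i) mod n \<in> circulant_support A then 1 else 0) = A $$ (i, j)"
      by (rule zero_one_circulant_entry[OF A ij, symmetric])
    finally show "A $$ (i, j) = (P * B * Q) $$ (i, j)" by simp
  qed (use carA in \<open>simp_all add: P_def Q_def\<close>)
  moreover have "permutation_mat n P" "permutation_mat n Q"
    unfolding permutation_mat_def P_def Q_def using p q by blast+
  ultimately show ?thesis by blast
qed

lemma mat_equiv_gram_equiv:
  assumes P: "permutation_mat n (P :: complex mat)" and Q: "permutation_mat n Q" and B: "B \<in> carrier_mat n n"
  shows "(P * B * Q) * transpose_mat (P * B * Q) = P * (B * transpose_mat B) * transpose_mat P"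
proof -
  have c: "P \<in> carrier_mat n n" "Q \<in> carrier_mat n n" using P Q permutation_mat_carrier by auto
  have t: "transpose_mat (P * B * Q) = transpose_mat Q * (transpose_mat B * transpose_mat P)"
    using c B by (simp add: transpose_mult[of _ n n _ n])
  have "(P * B * Q) * (transpose_mat Q * (transpose_mat B * transpose_mat P))
      = (P * B) * (Q * transpose_mat Q) * (transpose_mat B * transpose_mat P)"
    using c B by (simp add: assoc_mult_mat[of _ n n _ n _ n])
  also have "\<dots> = P * (B * transpose_mat B) * transpose_mat P"
    unfolding permutation_mat_transpose_right[OF Q] using c B by (simp add: assoc_mult_mat[of _ n n _ n _ n])
  finally show ?thesis unfolding t .
qed

section \<open>Diagonalisation by the Fourier matrix\<close>

definition support_eval :: "nat \<Rightarrow> nat set \<Rightarrow> nat \<Rightarrow> complex" where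
  "support_eval n S c = (\<Sum>s\<in>S. (cis (2 * pi / real n) ^ c) ^ s)"

definition gram_eigenvalue :: "nat \<Rightarrow> nat set \<Rightarrow> nat \<Rightarrow> complex" where
  "gram_eigenvalue n S c = support_eval n S c * cnj (support_eval n S c)"

lemma fourier_mat_inverse:
  assumes n: "n > 0"
  defines "F \<equiv> mat n n (\<lambda>(i, j). cis (2 * pi / real n) ^ (i * j))"
    and "G \<equiv> mat n n (\<lambda>(i, j). inverse (cis (2 * pi / real n) ^ (i * j)) / of_nat n)"
  shows "F * G = 1\<^sub>m n" "G * F = 1\<^sub>m n"
proof -
  define w where "w = cis (2 * pi / real n)"
  have wn: "w ^ k = 1 \<longleftrightarrow> n dvd k" for k unfolding w_def by (rule cis_power_eq_1_iff[OF n])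
  have w0: "w \<noteq> 0" unfolding w_def by simp
  show FG: "F * G = 1\<^sub>m n"
  proof (rule eq_matI)
    fix i j assume "i < dim_row (1\<^sub>m n)" "j < dim_col (1\<^sub>m n :: complex mat)"
    then have ij: "i < n" "j < n" by auto
    have "(F * G) $$ (i, j) = (\<Sum>k = 0..<n. w ^ (i * k) * (inverse (w ^ (k * j)) / of_nat n))"
      using ij unfolding F_def G_def w_def by (simp add: scalar_prod_def)
    also have "\<dots> = (\<Sum>k<n. (w ^ i * inverse (w ^ j)) ^ k) / of_nat n"
      unfolding sum_divide_distrib lessThan_atLeast0
      by (intro sum.cong) (simp_all add: power_mult_distrib power_inverse power_mult mult.commute[of _ j])
    also have "(\<Sum>k<n. (w ^ i * inverse (w ^ j)) ^ k) = (if w ^ i * inverse (w ^ j) = 1 then of_nat n else 0)"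
    proof (rule sum_root_unity_powers)
      have "(w ^ k) ^ n = 1" for k using wn[of n] by (metis dvd_refl mult.commute power_mult power_one)
      then show "(w ^ i * inverse (w ^ j)) ^ n = 1" by (simp add: power_mult_distrib power_inverse)
    qed
    also have "w ^ i * inverse (w ^ j) = 1 \<longleftrightarrow> i = j"
    proof
      assume "w ^ i * inverse (w ^ j) = 1"
      then have e: "w ^ i = w ^ j" using w0 by (simp add: field_simps)
      have no: "a = b" if "w ^ a = w ^ b" "a \<le> b" "b < n" for a b
      proof -
        have "w ^ a * w ^ (b - a) = w ^ b" using that(2) by (subst power_add[symmetric]) simp
        then have "w ^ a * w ^ (b - a) = w ^ a * 1" using that(1) by simp
        then have "w ^ (b - a) = 1" using w0 by simp
        then have "n dvd b - a" using wn by simp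
        then show ?thesis using that nat_dvd_not_less[of "b - a" n] by (cases "b - a = 0") auto
      qed
      show "i = j" using no[of i j] no[of j i] e ij by (cases "i \<le> j") auto
    qed (use w0 in simp)
    finally show "(F * G) $$ (i, j) = 1\<^sub>m n $$ (i, j)" using ij n by simp
  qed (simp_all add: F_def G_def)
  show "G * F = 1\<^sub>m n" by (rule mat_mult_left_right_inverse[OF _ _ FG]) (simp_all add: F_def G_def)
qed

text \<open>The columns of the Fourier matrix are eigenvectors of every circulant. Transposing
  negates the support, which conjugates the eigenvalues.\<close>

lemma circulant_fourier:
  assumes A: "zero_one_circulant n (A :: complex mat)" and n: "n > 0"
  defines "F \<equiv> mat n n (\<lambda>(i, j). cis (2 * pi / real n) ^ (i * j))"
    and "S \<equiv> circulant_support A"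
  shows "A * F = F * mat_diag n (support_eval n S)"
    "transpose_mat A * F = F * mat_diag n (\<lambda>c. cnj (support_eval n S c))"
proof -
  define w where "w = cis (2 * pi / real n)"
  have wn: "w ^ n = 1" unfolding w_def using cis_power_eq_1_iff[OF n, of n] by simp
  have carA: "A \<in> carrier_mat n n" by (rule circulant_carrier[OF A])
  have Ssub: "S \<subseteq> {..<n}" unfolding S_def by (rule circulant_support_subset[OF A])
  have wjn: "(w ^ j) ^ n = 1" for j using wn by (metis mult.commute power_mult power_one)
  have cw: "cnj w = inverse w" unfolding w_def by (simp add: cis_cnj cis_inverse)
  have w0: "w \<noteq> 0" unfolding w_def by simp
  have diag: "(F * mat_diag n f) $$ (i, j) = w ^ (i * j) * f j" if "i < n" "j < n" for i j f
    using that unfolding F_def w_def by (subst mat_diag_mult_right[of _ n n]) auto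
  show "A * F = F * mat_diag n (support_eval n S)"
  proof (rule eq_matI)
    fix i j assume "i < dim_row (F * mat_diag n (support_eval n S))" "j < dim_col (F * mat_diag n (support_eval n S))"
    then have ij: "i < n" "j < n" by (auto simp: F_def mat_diag_def)
    have "(A * F) $$ (i, j) = (\<Sum>k = 0..<n. A $$ (i, k) * w ^ (k * j))"
      using ij carA unfolding F_def w_def by (simp add: scalar_prod_def)
    also have "\<dots> = (\<Sum>k<n. if (k + n - i) mod n \<in> S then w ^ (k * j) else 0)"
      unfolding lessThan_atLeast0 S_def using zero_one_circulant_entry[OF A ij(1)] by (intro sum.cong) auto
    also have "\<dots> = (\<Sum>s<n. if s \<in> S then w ^ ((s + i) * j) else 0)"
    proof (rule sum.reindex_bij_witness[of _ "\<lambda>s. (s + i) mod n" "\<lambda>k. (k + n - i) mod n"])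
      fix k assume k: "k \<in> {..<n}"
      have b: "((k + n - i) mod n + i) mod n = k" using ij k by (simp add: mod_simps)
      then show "((k + n - i) mod n + i) mod n = k" .
      have "[(k + n - i) mod n + i = k] (mod n)" unfolding cong_def b using k by simp
      then have "[((k + n - i) mod n + i) * j = k * j] (mod n)" by (rule cong_scalar_right)
      then have "w ^ (((k + n - i) mod n + i) * j) = w ^ (k * j)" by (rule power_cong_mod[OF wn])
      then show "(if (k + n - i) mod n \<in> S then w ^ (((k + n - i) mod n + i) * j) else 0)
          = (if (k + n - i) mod n \<in> S then w ^ (k * j) else 0)" by simp
    next
      fix s assume s: "s \<in> {..<n}"
      have "((s + i) mod n + n - i) mod n = ((s + i) mod n + (n - i)) mod n" using ij by simp
      also have "\<dots> = (s + i + (n - i)) mod n" by (simp add: mod_simps)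
      also have "\<dots> = s" using ij s by simp
      finally show "((s + i) mod n + n - i) mod n = s" .
    qed (use n in auto)
    also have "\<dots> = (\<Sum>s\<in>S. w ^ ((s + i) * j))" using Ssub by (simp add: sum.If_cases Int_absorb1)
    also have "\<dots> = w ^ (i * j) * support_eval n S j"
      unfolding support_eval_def sum_distrib_left w_def[symmetric]
      by (intro sum.cong refl) (simp add: algebra_simps power_add flip: power_mult)
    also have "\<dots> = (F * mat_diag n (support_eval n S)) $$ (i, j)" using diag[OF ij] by simp
    finally show "(A * F) $$ (i, j) = (F * mat_diag n (support_eval n S)) $$ (i, j)" .
  qed (use carA in \<open>simp_all add: F_def mat_diag_def\<close>)
  show "transpose_mat A * F = F * mat_diag n (\<lambda>c. cnj (support_eval n S c))"
  proof (rule eq_matI)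
    fix i j assume "i < dim_row (F * mat_diag n (\<lambda>c. cnj (support_eval n S c)))"
      "j < dim_col (F * mat_diag n (\<lambda>c. cnj (support_eval n S c)))"
    then have ij: "i < n" "j < n" by (auto simp: F_def mat_diag_def)
    have "(transpose_mat A * F) $$ (i, j) = (\<Sum>k = 0..<n. A $$ (k, i) * w ^ (k * j))"
      using ij carA unfolding F_def w_def by (simp add: scalar_prod_def)
    also have "\<dots> = (\<Sum>k<n. if (i + n - k) mod n \<in> S then w ^ (k * j) else 0)"
      unfolding lessThan_atLeast0 S_def using zero_one_circulant_entry[OF A _ ij(1)] by (intro sum.cong) auto
    also have "\<dots> = (\<Sum>s<n. if s \<in> S then w ^ ((i + n - s) * j) else 0)"
    \<comment> \<open>The substitution s = i - k modulo n is an involution and serves as its own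
      inverse.\<close>
    proof (rule sum.reindex_bij_witness[of _ "\<lambda>s. (i + n - s) mod n" "\<lambda>k. (i + n - k) mod n"])
      have inv: "(i + n - (i + n - k) mod n) mod n = k" if k: "k < n" for k
      proof -
        have "[(i + n - (i + n - k) mod n) + (i + n - k) mod n = k + (i + n - k) mod n] (mod n)"
        proof -
          have "(i + n - (i + n - k) mod n) + (i + n - k) mod n = i + n"
            using mod_less_divisor[OF n, of "i + n - k"] by simp
          moreover have "[k + (i + n - k) mod n = k + (i + n - k)] (mod n)" by (simp add: cong_def mod_simps)
          moreover have "k + (i + n - k) = i + n" using k by simp
          ultimately show ?thesis by (simp add: cong_sym)
        qed
        then have "[i + n - (i + n - k) mod n = k] (mod n)" by (simp only: cong_add_rcancel_nat)
        then show ?thesis using k by (simp add: cong_def)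
      qed
      fix k assume k: "k \<in> {..<n}"
      then show b: "(i + n - (i + n - k) mod n) mod n = k" using inv by simp
      have "[i + n - (i + n - k) mod n = k] (mod n)" unfolding cong_def b using k by simp
      then have "[(i + n - (i + n - k) mod n) * j = k * j] (mod n)" by (rule cong_scalar_right)
      then have "w ^ ((i + n - (i + n - k) mod n) * j) = w ^ (k * j)" by (rule power_cong_mod[OF wn])
      then show "(if (i + n - k) mod n \<in> S then w ^ ((i + n - (i + n - k) mod n) * j) else 0)
          = (if (i + n - k) mod n \<in> S then w ^ (k * j) else 0)" by simp
    next
      fix s assume s: "s \<in> {..<n}"
      have inv: "[i + n - (i + n - s) mod n = s] (mod n)"
      proof -
        have "[(i + n - (i + n - s) mod n) + (i + n - s) mod n = s + (i + n - s) mod n] (mod n)"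
        proof -
          have "(i + n - (i + n - s) mod n) + (i + n - s) mod n = i + n"
            using mod_less_divisor[OF n, of "i + n - s"] by simp
          moreover have "[s + (i + n - s) mod n = s + (i + n - s)] (mod n)" by (simp add: cong_def mod_simps)
          moreover have "s + (i + n - s) = i + n" using s by simp
          ultimately show ?thesis by (simp add: cong_sym)
        qed
        then show ?thesis by (simp only: cong_add_rcancel_nat)
      qed
      then show "(i + n - (i + n - s) mod n) mod n = s" using s by (simp add: cong_def)
    qed (use n in auto)
    also have "\<dots> = (\<Sum>s\<in>S. w ^ ((i + n - s) * j))" using Ssub by (simp add: sum.If_cases Int_absorb1)
    also have "\<dots> = w ^ (i * j) * cnj (support_eval n S j)"
      unfolding support_eval_def sum_distrib_left w_def[symmetric] cnj_sum
    proof (intro sum.cong refl)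
      fix s assume "s \<in> S"
      then have s: "s < n" using Ssub by auto
      have "w ^ ((i + n - s) * j) * (w ^ j) ^ s = w ^ ((i + n - s) * j + j * s)" by (simp add: power_add power_mult)
      also have "(i + n - s) * j + j * s = i * j + j * n"
      proof -
        have "(i + n - s) * j + j * s = (i + n - s + s) * j" by (simp only: distrib_right mult.commute[of j s])
        also have "i + n - s + s = i + n" using s by simp
        finally show ?thesis by (simp only: distrib_right mult.commute[of n j])
      qed
      also have "w ^ (i * j + j * n) = w ^ (i * j)" using wjn[of j] by (simp add: power_add power_mult)
      finally have "w ^ ((i + n - s) * j) = w ^ (i * j) * inverse ((w ^ j) ^ s)" using w0 by (simp add: field_simps)
      then show "w ^ ((i + n - s) * j) = w ^ (i * j) * cnj ((w ^ j) ^ s)" by (simp add: cw power_inverse)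
    qed
    also have "\<dots> = (F * mat_diag n (\<lambda>c. cnj (support_eval n S c))) $$ (i, j)" using diag[OF ij] by simp
    finally show "(transpose_mat A * F) $$ (i, j) = (F * mat_diag n (\<lambda>c. cnj (support_eval n S c))) $$ (i, j)" .
  qed (use carA in \<open>simp_all add: F_def mat_diag_def\<close>)
qed

lemma gram_similar_diag:
  assumes A: "zero_one_circulant n (A :: complex mat)" and n: "n > 0"
  shows "similar_mat (A * transpose_mat A) (mat_diag n (gram_eigenvalue n (circulant_support A)))"
proof -
  let ?F = "mat n n (\<lambda>(i, j). cis (2 * pi / real n) ^ (i * j))"
  let ?G = "mat n n (\<lambda>(i, j). inverse (cis (2 * pi / real n) ^ (i * j)) / of_nat n)"
  let ?e = "support_eval n (circulant_support A)"
  let ?D = "mat_diag n (gram_eigenvalue n (circulant_support A))"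
  have carA: "A \<in> carrier_mat n n" by (rule circulant_carrier[OF A])
  have carD: "mat_diag n f \<in> carrier_mat n n" for f :: "nat \<Rightarrow> complex" by (simp add: mat_diag_def)
  have carF: "?F \<in> carrier_mat n n" and carG: "?G \<in> carrier_mat n n" by simp_all
  have "A * transpose_mat A * ?F = A * (?F * mat_diag n (\<lambda>c. cnj (?e c)))"
    using carA carF circulant_fourier(2)[OF A n] by (simp add: assoc_mult_mat[of _ n n _ n _ n])
  also have "\<dots> = (A * ?F) * mat_diag n (\<lambda>c. cnj (?e c))"
    using carA carF carD by (simp add: assoc_mult_mat[of _ n n _ n _ n])
  also have "\<dots> = ?F * (mat_diag n ?e * mat_diag n (\<lambda>c. cnj (?e c)))"
    unfolding circulant_fourier(1)[OF A n] by (rule assoc_mult_mat[OF carF carD carD])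
  also have "mat_diag n ?e * mat_diag n (\<lambda>c. cnj (?e c)) = ?D"
    by (simp add: mat_diag_diag gram_eigenvalue_def[abs_def])
  finally have AF: "A * transpose_mat A * ?F = ?F * ?D" .
  have carM: "A * transpose_mat A \<in> carrier_mat n n" using carA by simp
  have "A * transpose_mat A = A * transpose_mat A * (?F * ?G)"
    unfolding fourier_mat_inverse(1)[OF n] by (rule right_mult_one_mat[OF carM, symmetric])
  also have "\<dots> = (A * transpose_mat A * ?F) * ?G" by (rule assoc_mult_mat[OF carM carF carG, symmetric])
  also have "\<dots> = ?F * ?D * ?G" unfolding AF ..
  finally have "A * transpose_mat A = ?F * ?D * ?G" .
  then have "similar_mat_wit (A * transpose_mat A) ?D ?F ?G"
    by (rule similar_mat_witI[OF fourier_mat_inverse[OF n] _ carM carD carF carG])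
  then show ?thesis unfolding similar_mat_def by blast
qed

text \<open>Similar matrices share the characteristic polynomial, and for the diagonal forms its
  multiset of roots is the list of eigenvalues.\<close>

lemma similar_gram_eigenvalues:
  assumes A: "zero_one_circulant n (A :: complex mat)" and B: "zero_one_circulant n B" and n: "n > 0"
    and sim: "similar_mat (A * transpose_mat A) (B * transpose_mat B)"
  shows "image_mset (gram_eigenvalue n (circulant_support A)) (mset_set {..<n})
    = image_mset (gram_eigenvalue n (circulant_support B)) (mset_set {..<n})"
proof -
  have cp: "char_poly (mat_diag n f) = (\<Prod>a\<leftarrow>map f [0..<n]. [:- a, 1:])" for f :: "nat \<Rightarrow> complex"
  proof -
    have "char_poly (mat_diag n f) = (\<Prod>a\<leftarrow>diag_mat (mat_diag n f). [:- a, 1:])"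
      by (rule char_poly_upper_triangular[of _ n]) (auto simp: mat_diag_def)
    also have "diag_mat (mat_diag n f) = map f [0..<n]"
      by (auto simp: diag_mat_def mat_diag_def intro!: map_cong)
    finally show ?thesis .
  qed
  have roots: "proots (\<Prod>a\<leftarrow>xs. [:- a, 1:]) = mset xs" for xs :: "complex list"
  proof (induction xs)
    case (Cons a xs)
    have "(\<Prod>a\<leftarrow>xs. [:- a, 1:]) \<noteq> (0 :: complex poly)" by (auto simp: prod_list_zero_iff)
    then show ?case using Cons by (simp add: proots_mult del: mult_pCons_left)
  qed simp
  have ms: "mset (map f [0..<n]) = image_mset f (mset_set {..<n})" for f :: "nat \<Rightarrow> complex"
    by (simp add: lessThan_atLeast0 mset_upt)
  have "char_poly (mat_diag n (gram_eigenvalue n (circulant_support A)))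
      = char_poly (mat_diag n (gram_eigenvalue n (circulant_support B)))"
    using char_poly_similar[OF gram_similar_diag[OF A n]] char_poly_similar[OF gram_similar_diag[OF B n]]
      char_poly_similar[OF sim] by simp
  then show ?thesis unfolding cp using roots ms by metis
qed

section \<open>Circulants of weight at most three\<close>


lemma cis_power_inj:
  assumes "n > 0" "cis (2 * pi / real n) ^ i = cis (2 * pi / real n) ^ j"
  shows "[i = j] (mod n)"
proof -
  define w where "w = cis (2 * pi / real n)"
  have w0: "w \<noteq> 0" unfolding w_def by simp
  have no: "[a = b] (mod n)" if "w ^ a = w ^ b" "a \<le> b" for a b
  proof -
    have "w ^ a * w ^ (b - a) = w ^ b" using that(2) by (subst power_add[symmetric]) simp
    then have "w ^ a * w ^ (b - a) = w ^ a * 1" using that(1) by simp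
    then have "w ^ (b - a) = 1" using w0 by simp
    then have "n dvd b - a" using cis_power_eq_1_iff[OF assms(1)] unfolding w_def by simp
    then show ?thesis using that(2) by (metis cong_altdef_nat cong_sym)
  qed
  have e: "w ^ i = w ^ j" using assms(2) unfolding w_def .
  show ?thesis
  proof (cases "i \<le> j")
    case True
    then show ?thesis using no[of i j] e by simp
  next
    case False
    then show ?thesis using no[of j i] e by (simp add: cong_sym)
  qed
qed

text \<open>Exponents can be read back from roots of unity, because the powers of w below n are
  distinct. The multiplier is reduced modulo n to meet the bound u < n.\<close>

lemma affine_image_of_roots:
  assumes n: "n > 0" and S: "S \<subseteq> {..<n}" and T: "T \<subseteq> {..<n}" and u: "coprime u n" and z: "z ^ n = 1"
  defines "w \<equiv> cis (2 * pi / real n)"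
  assumes e: "(\<lambda>s. w ^ s) ` S = (\<lambda>t. z * (w ^ t) ^ u) ` T"
  shows "\<exists>u<n. \<exists>v<n. gcd u n = 1 \<and> S = affine_image n u v T"
proof -
  obtain v where v: "z = w ^ v" "v < n" using root_unity_generator[OF n z] unfolding w_def by metis
  have wn: "w ^ n = 1" unfolding w_def using cis_power_eq_1_iff[OF n, of n] by simp
  have red: "(u mod n * t + v) mod n = (u * t + v) mod n" for t
  proof -
    have "[u mod n * t + v = u * t + v] (mod n)" by (intro cong_add cong_mult cong_refl) (simp add: cong_def)
    then show ?thesis by (simp add: cong_def)
  qed
  have pw: "z * (w ^ t) ^ u = w ^ ((u * t + v) mod n)" for t
  proof -
    have "w ^ ((u * t + v) mod n) = w ^ (u * t + v)" by (rule power_cong_mod[OF wn]) (simp add: cong_def)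
    then show ?thesis unfolding v(1) by (simp add: power_add power_mult mult.commute[of u])
  qed
  have inj: "i = j" if "w ^ i = w ^ j" "i < n" "j < n" for i j
    using cis_power_inj[OF n, of i j] that unfolding w_def by (simp add: cong_def)
  have "S = affine_image n (u mod n) v T"
  proof (intro equalityI subsetI)
    fix s assume s: "s \<in> S"
    then have "w ^ s \<in> (\<lambda>t. z * (w ^ t) ^ u) ` T" using e by blast
    then obtain t where t: "t \<in> T" "w ^ s = w ^ ((u * t + v) mod n)" unfolding pw by blast
    have "s = (u * t + v) mod n" by (rule inj[OF t(2)]) (use s S n in auto)
    then show "s \<in> affine_image n (u mod n) v T" unfolding affine_image_def red using t(1) by blast
  next
    fix s assume "s \<in> affine_image n (u mod n) v T"
    then obtain t where t: "t \<in> T" "s = (u * t + v) mod n" unfolding affine_image_def red by blast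
    then have "w ^ s \<in> (\<lambda>s. w ^ s) ` S" unfolding e pw by blast
    then obtain s' where s': "s' \<in> S" "w ^ s = w ^ s'" by blast
    have "s = s'" by (rule inj[OF s'(2)]) (use s' S t n in auto)
    then show "s \<in> S" using s' by simp
  qed
  moreover have "gcd (u mod n) n = 1" using u n coprime_iff_gcd_eq_1[of "u mod n" n] coprime_mod_left_iff[of n u] by blast
  ultimately show ?thesis using n v(2) by (intro exI[of _ "u mod n"] conjI exI[of _ v]) auto
qed

section \<open>What eigenvalue multiplicities determine\<close>

lemma card_multiples:
  assumes n: "(n::nat) > 0"
  shows "card {c. c < n \<and> n dvd c * d} = gcd d n"
proof -
  define g where "g = gcd d n"
  have g0: "g > 0" using n unfolding g_def by simp
  obtain d' q where e: "d = g * d'" "n = g * q" unfolding g_def by (metis dvdE gcd_dvd1 gcd_dvd2)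
  have "gcd d' q * g = g" using e unfolding g_def[symmetric] by (metis g_def gcd_mult_distrib_nat mult.commute)
  then have "gcd d' q = 1" using g0 by simp
  then have co: "coprime q d'" using coprime_iff_gcd_eq_1 coprime_commute by blast
  have q0: "q > 0" using n e(2) by (cases q) auto
  have iff: "n dvd c * d \<longleftrightarrow> q dvd c" for c
  proof -
    have "n dvd c * d \<longleftrightarrow> g * q dvd g * (c * d')" by (simp only: e mult.left_commute)
    also have "\<dots> \<longleftrightarrow> q dvd c * d'" using g0 by simp
    also have "\<dots> \<longleftrightarrow> q dvd c" using co by (rule coprime_dvd_mult_left_iff)
    finally show ?thesis .
  qed
  have "{c. c < n \<and> n dvd c * d} = (\<lambda>i. q * i) ` {..<g}"
    unfolding iff using e(2) q0 by (auto simp: mult.commute elim!: dvdE)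
  moreover have "inj_on (\<lambda>i. q * i) {..<g}" using q0 by (intro inj_onI) simp
  ultimately show ?thesis unfolding g_def by (simp add: card_image)
qed

lemma image_mset_filter_card:
  assumes "image_mset f (mset_set {..<n::nat}) = image_mset g (mset_set {..<n})"
  shows "card {c. c < n \<and> f c = z} = card {c. c < n \<and> g c = z}"
proof -
  have "count (image_mset h (mset_set {..<n})) z = card {c. c < n \<and> h c = z}" for h
  proof -
    have "{c. c < n \<and> h c = z} = {x \<in> {..<n}. h x = z}" by auto
    moreover have "h -` {z} \<inter> {..<n} = {x \<in> {..<n}. h x = z}" by auto
    ultimately show ?thesis by (simp add: count_image_mset)
  qed
  then show ?thesis using assms by metis
qed

text \<open>By the parallelogram law the difference has norm 0.\<close>

lemma norm_sum_two_max:
  fixes a b :: complex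
  assumes "norm a = 1" "norm b = 1" "norm (a + b) = 2"
  shows "a = b"
proof -
  have "norm (a + b) ^ 2 + norm (a - b) ^ 2 = 2 * (norm a ^ 2 + norm b ^ 2)"
    by (simp add: cmod_power2) (simp add: power2_eq_square algebra_simps)
  then have "norm (a - b) ^ 2 = 0" using assms by simp
  then show ?thesis by simp
qed

lemma alpha_eq_6_iff:
  assumes "norm a = 1" "norm b = 1" "norm c = 1"
  shows "alpha a b c = 6 \<longleftrightarrow> a = 1 \<and> b = 1 \<and> c = 1"
proof
  assume h: "alpha a b c = 6"
  have inv: "inverse z = cnj z" if "norm z = 1" for z :: complex
  proof (rule inverse_unique)
    show "z * cnj z = 1" using that by (simp add: complex_norm_square[symmetric])
  qed
  have "Re (alpha a b c) = 2 * (Re a + Re b + Re c)"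
    unfolding alpha_def inv[OF assms(1)] inv[OF assms(2)] inv[OF assms(3)] by simp
  then have s: "Re a + Re b + Re c = 3" using h by simp
  have le: "Re z \<le> 1" if "norm z = 1" for z using complex_Re_le_cmod[of z] that by simp
  have re: "Re a = 1" "Re b = 1" "Re c = 1" using s le[OF assms(1)] le[OF assms(2)] le[OF assms(3)] by linarith+
  have one: "z = 1" if "norm z = 1" "Re z = 1" for z
  proof -
    have "Re z ^ 2 + Im z ^ 2 = 1" using that(1) by (metis cmod_power2 one_power2)
    then have "Im z = 0" using that(2) by simp
    then show ?thesis using that(2) by (simp add: complex_eq_iff)
  qed
  show "a = 1 \<and> b = 1 \<and> c = 1" using one assms re by blast
qed (simp add: alpha_def)

text \<open>The largest eigenvalue is the square of the weight, attained at exponent 0.\<close>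

lemma same_weight:
  assumes n: "n > 0" and S: "S \<subseteq> {..<n}" and T: "T \<subseteq> {..<n}"
    and e: "image_mset (gram_eigenvalue n S) (mset_set {..<n}) = image_mset (gram_eigenvalue n T) (mset_set {..<n})"
  shows "card S = card T"
proof -
  have main: "card S \<le> card T"
    if e: "image_mset (gram_eigenvalue n S) (mset_set {..<n}) = image_mset (gram_eigenvalue n T) (mset_set {..<n})" for S T
  proof -
    have "set_mset (image_mset (gram_eigenvalue n S) (mset_set {..<n})) = set_mset (image_mset (gram_eigenvalue n T) (mset_set {..<n}))"
      using e by (rule arg_cong)
    then have im: "gram_eigenvalue n S ` {..<n} = gram_eigenvalue n T ` {..<n}" by simp
    have "gram_eigenvalue n S 0 \<in> gram_eigenvalue n S ` {..<n}" using n by (intro imageI) simp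
    then obtain c where c: "gram_eigenvalue n S 0 = gram_eigenvalue n T c" unfolding im by (elim imageE)
    have "norm (gram_eigenvalue n S 0) = real (card S) ^ 2"
      unfolding gram_eigenvalue_def support_eval_def by (simp add: norm_mult power2_eq_square)
    moreover have "norm (support_eval n T c) \<le> real (card T)"
      unfolding support_eval_def using norm_sum[of "\<lambda>s. (cis (2 * pi / real n) ^ c) ^ s" T] by (simp add: norm_power)
    then have "norm (gram_eigenvalue n T c) \<le> real (card T) ^ 2"
      unfolding gram_eigenvalue_def by (simp add: norm_mult power2_eq_square mult_mono)
    ultimately have "real (card S) ^ 2 \<le> real (card T) ^ 2" using c by simp
    then show ?thesis by (simp add: power2_le_iff_abs_le)
  qed
  show ?thesis using main[OF e] main[OF e[symmetric]] by simp
qed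

lemma root_quotient:
  assumes n: "n > 0" and s: "s < n"
  defines "w \<equiv> cis (2 * pi / real n)"
  obtains d where "w ^ t * inverse (w ^ s) = w ^ d" "t < n \<Longrightarrow> n dvd d \<Longrightarrow> s = t"
proof
  have wn: "w ^ n = 1" and w0: "w \<noteq> 0" unfolding w_def using cis_power_eq_1_iff[OF n, of n] by simp_all
  have "w ^ (t + (n - s)) * w ^ s = w ^ t * w ^ n" using s by (simp flip: power_add)
  then show e: "w ^ t * inverse (w ^ s) = w ^ (t + (n - s))" using wn w0 by (simp add: field_simps)
  assume t: "t < n" "n dvd t + (n - s)"
  then have "w ^ (t + (n - s)) = 1" unfolding w_def using cis_power_eq_1_iff[OF n] by blast
  then have "w ^ t = w ^ s" using e w0 by (simp add: field_simps)
  then show "s = t" using cis_power_inj[OF n, of t s] t(1) s unfolding w_def by (simp add: cong_def)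
qed

text \<open>The quotients are taken in cyclic order so that their product is 1; the diagonal terms
  of the expanded square modulus account for the 3.\<close>

lemma gram_eigenvalue_3:
  assumes w: "w = cis (2 * pi / real n)" and d: "s0 \<noteq> s1" "s1 \<noteq> s2" "s0 \<noteq> s2"
  shows "gram_eigenvalue n {s0, s1, s2} c = 3 + alpha ((w ^ s1 * inverse (w ^ s0)) ^ c) ((w ^ s2 * inverse (w ^ s1)) ^ c) ((w ^ s0 * inverse (w ^ s2)) ^ c)"
proof -
  have w0: "w \<noteq> 0" and cw: "cnj w = inverse w" unfolding w by (simp_all add: cis_cnj cis_inverse)
  have ev: "support_eval n {s0, s1, s2} c = (w ^ s0) ^ c + (w ^ s1) ^ c + (w ^ s2) ^ c"
    unfolding support_eval_def w[symmetric] using d by (simp add: mult.commute flip: power_mult)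
  have nz: "(w ^ s) ^ c \<noteq> 0" for s using w0 by simp
  define a b e where "a = (w ^ s0) ^ c" and "b = (w ^ s1) ^ c" and "e = (w ^ s2) ^ c"
  have nz': "a \<noteq> 0" "b \<noteq> 0" "e \<noteq> 0" unfolding a_def b_def e_def using nz by auto
  have "gram_eigenvalue n {s0, s1, s2} c = (a + b + e) * (inverse a + inverse b + inverse e)"
    unfolding gram_eigenvalue_def ev by (simp add: cw power_inverse a_def b_def e_def)
  also have "\<dots> = 3 + alpha (b * inverse a) (e * inverse b) (a * inverse e)"
    unfolding alpha_def using nz' by (simp add: algebra_simps inverse_mult_distrib)
  finally show ?thesis unfolding a_def b_def e_def by (simp add: power_mult_distrib power_inverse)
qed

lemma mset_pair_eq:
  assumes "{#a, b#} = {#c, d#}"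
  shows "a = c \<and> b = d \<or> a = d \<and> b = c"
proof -
  have "a \<in> set_mset {#c, d#}" unfolding assms[symmetric] by simp
  then consider "a = c" | "a = d" by auto
  then show ?thesis
  proof cases
    case 1
    then show ?thesis using assms by simp
  next
    case 2
    have "{#d, b#} = {#d, c#}" using assms 2 add_mset_commute[of c d "{#}"] by simp
    then show ?thesis using 2 by simp
  qed
qed

text \<open>The first three alternatives are the cyclic matches, the last three the odd ones; the
  third member is determined by the other two.\<close>

lemma mset_triple_eq:
  assumes "{#x1, x2, x3#} = {#y1, y2, y3#}"
  shows "x1 = y1 \<and> x2 = y2 \<or> x1 = y2 \<and> x2 = y3 \<or> x1 = y3 \<and> x2 = y1 \<or>
    x1 = y2 \<and> x2 = y1 \<or> x1 = y1 \<and> x2 = y3 \<or> x1 = y3 \<and> x2 = y2"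
proof -
  have "x1 \<in> set_mset {#y1, y2, y3#}" unfolding assms[symmetric] by simp
  then consider "x1 = y1" | "x1 = y2" | "x1 = y3" by auto
  then show ?thesis
  proof cases
    case 1
    then have "{#x2, x3#} = {#y2, y3#}" using assms by simp
    then show ?thesis using mset_pair_eq 1 by metis
  next
    case 2
    have "{#y1, y2, y3#} = {#y2, y1, y3#}" by (rule add_mset_commute)
    with assms have "{#x1, x2, x3#} = {#y2, y1, y3#}" by (rule trans)
    then have "{#x2, x3#} = {#y1, y3#}" unfolding 2 by (simp only: add_mset_add_mset_same_iff)
    then show ?thesis using mset_pair_eq 2 by metis
  next
    case 3
    have "{#y1, y2, y3#} = {#y1, y3, y2#}" by (simp only: add_mset_commute[of y2 y3])
    also have "\<dots> = {#y3, y1, y2#}" by (rule add_mset_commute)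
    finally have "{#y1, y2, y3#} = {#y3, y1, y2#}" .
    with assms have "{#x1, x2, x3#} = {#y3, y1, y2#}" by (rule trans)
    then have "{#x2, x3#} = {#y1, y2#}" unfolding 3 by (simp only: add_mset_add_mset_same_iff)
    then show ?thesis using mset_pair_eq 3 by metis
  qed
qed

lemma image_three: "f a = x \<Longrightarrow> f b = y \<Longrightarrow> f c = z \<Longrightarrow> {x, y, z} = f ` {a, b, c}"
  by auto

text \<open>A cyclic match of the quotients makes p a multiple of q. An odd match reverses the cycle
  and makes p a multiple of the inverses of q. The witness r is the member of q with which p0 is
  matched.\<close>

lemma triple_from_quotients:
  fixes p0 p1 p2 q0 q1 q2 :: complex
  assumes nz: "p0 \<noteq> 0" "p1 \<noteq> 0" "p2 \<noteq> 0" "q0 \<noteq> 0" "q1 \<noteq> 0" "q2 \<noteq> 0"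
    and e: "{#p1 * inverse p0, p2 * inverse p1, p0 * inverse p2#} = {#q1 * inverse q0, q2 * inverse q1, q0 * inverse q2#}"
  shows "(\<exists>r\<in>{q0, q1, q2}. {p0, p1, p2} = (\<lambda>q. (p0 / r) * q) ` {q0, q1, q2}) \<or>
    (\<exists>r\<in>{q0, q1, q2}. {p0, p1, p2} = (\<lambda>q. (p0 * r) * inverse q) ` {q0, q1, q2})"
proof -
  define X1 X2 X3 where "X1 = p1 * inverse p0" and "X2 = p2 * inverse p1" and "X3 = p0 * inverse p2"
  define Y1 Y2 Y3 where "Y1 = q1 * inverse q0" and "Y2 = q2 * inverse q1" and "Y3 = q0 * inverse q2"
  have p: "p1 = X1 * p0" "p2 = X2 * p1" using nz unfolding X1_def X2_def by simp_all
  have "{#X1, X2, X3#} = {#Y1, Y2, Y3#}" using e unfolding X1_def X2_def X3_def Y1_def Y2_def Y3_def .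
  from mset_triple_eq[OF this] consider "X1 = Y1" "X2 = Y2" | "X1 = Y2" "X2 = Y3" | "X1 = Y3" "X2 = Y1"
    | "X1 = Y2" "X2 = Y1" | "X1 = Y1" "X2 = Y3" | "X1 = Y3" "X2 = Y2"
    by blast
  then show ?thesis
  proof cases
    case 1
    have "p1 = q1 * inverse q0 * p0" "p2 = q2 * inverse q1 * (q1 * inverse q0 * p0)"
      by (simp_all only: p 1 Y1_def Y2_def Y3_def)
    then have "p1 = p0 / q0 * q1" "p2 = p0 / q0 * q2" "p0 = p0 / q0 * q0"
      using nz by (simp_all add: field_simps)
    then have "{p0, p1, p2} = (\<lambda>q. (p0 / q0) * q) ` {q0, q1, q2}" by simp
    then show ?thesis by blast
  next
    case 2
    have "p1 = q2 * inverse q1 * p0" "p2 = q0 * inverse q2 * (q2 * inverse q1 * p0)"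
      by (simp_all only: p 2 Y1_def Y2_def Y3_def)
    then have "p1 = p0 / q1 * q2" "p2 = p0 / q1 * q0" "p0 = p0 / q1 * q1"
      using nz by (simp_all add: field_simps)
    then have "{p0, p1, p2} = (\<lambda>q. (p0 / q1) * q) ` {q0, q1, q2}" by (simp add: insert_commute)
    then show ?thesis by blast
  next
    case 3
    have "p1 = q0 * inverse q2 * p0" "p2 = q1 * inverse q0 * (q0 * inverse q2 * p0)"
      by (simp_all only: p 3 Y1_def Y2_def Y3_def)
    then have "p1 = p0 / q2 * q0" "p2 = p0 / q2 * q1" "p0 = p0 / q2 * q2"
      using nz by (simp_all add: field_simps)
    then have "{p0, p1, p2} = (\<lambda>q. (p0 / q2) * q) ` {q0, q1, q2}" by (simp add: insert_commute)
    then show ?thesis by blast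
  next
    case 4
    have "p1 = q2 * inverse q1 * p0" "p2 = q1 * inverse q0 * (q2 * inverse q1 * p0)"
      by (simp_all only: p 4 Y1_def Y2_def Y3_def)
    then have "{p0, p1, p2} = (\<lambda>q. (p0 * q2) * inverse q) ` {q2, q1, q0}"
      by (intro image_three) (use nz in \<open>simp_all add: mult_ac\<close>)
    also have "{q2, q1, q0} = {q0, q1, q2}" by auto
    finally have "{p0, p1, p2} = (\<lambda>q. (p0 * q2) * inverse q) ` {q0, q1, q2}" .
    then show ?thesis by blast
  next
    case 5
    have "p1 = q1 * inverse q0 * p0" "p2 = q0 * inverse q2 * (q1 * inverse q0 * p0)"
      by (simp_all only: p 5 Y1_def Y2_def Y3_def)
    then have "{p0, p1, p2} = (\<lambda>q. (p0 * q1) * inverse q) ` {q1, q0, q2}"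
      by (intro image_three) (use nz in \<open>simp_all add: mult_ac\<close>)
    also have "{q1, q0, q2} = {q0, q1, q2}" by auto
    finally have "{p0, p1, p2} = (\<lambda>q. (p0 * q1) * inverse q) ` {q0, q1, q2}" .
    then show ?thesis by blast
  next
    case 6
    have "p1 = q0 * inverse q2 * p0" "p2 = q2 * inverse q1 * (q0 * inverse q2 * p0)"
      by (simp_all only: p 6 Y1_def Y2_def Y3_def)
    then have "{p0, p1, p2} = (\<lambda>q. (p0 * q0) * inverse q) ` {q0, q2, q1}"
      by (intro image_three) (use nz in \<open>simp_all add: mult_ac\<close>)
    also have "{q0, q2, q1} = {q0, q1, q2}" by auto
    finally have "{p0, p1, p2} = (\<lambda>q. (p0 * q0) * inverse q) ` {q0, q1, q2}" .
    then show ?thesis by blast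
  qed
qed


text \<open>The eigenvalue 4 has multiplicity gcd d n, where d is the difference of the two
  exponents, and differences with the same gcd agree up to a unit.\<close>

lemma weight_two:
  assumes n: "n > 0" and S: "S \<subseteq> {..<n}" "card S = 2" and T: "T \<subseteq> {..<n}" "card T = 2"
    and e: "image_mset (gram_eigenvalue n S) (mset_set {..<n}) = image_mset (gram_eigenvalue n T) (mset_set {..<n})"
  shows "\<exists>u<n. \<exists>v<n. gcd u n = 1 \<and> S = affine_image n u v T"
proof -
  define w where "w = cis (2 * pi / real n)"
  have wn: "w ^ n = 1" and w0: "w \<noteq> 0" unfolding w_def using cis_power_eq_1_iff[OF n, of n] by simp_all
  have nw: "norm w = 1" unfolding w_def by simp
  have main: "\<exists>s0 s1 d. S = {s0, s1} \<and> w ^ s1 * inverse (w ^ s0) = w ^ d \<and>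
      card {c. c < n \<and> gram_eigenvalue n S c = 4} = gcd d n"
    if S: "S \<subseteq> {..<n}" "card S = 2" for S
  proof -
    obtain s0 s1 where s: "S = {s0, s1}" "s0 \<noteq> s1" using S(2) card_2_iff by metis
    have "s0 < n" using S(1) s by auto
    obtain d where d: "w ^ s1 * inverse (w ^ s0) = w ^ d"
      using root_quotient[OF n \<open>s0 < n\<close>, of s1] unfolding w_def by metis
    have d': "w ^ s1 = w ^ d * w ^ s0" using d w0 by (simp add: field_simps)
    have "gram_eigenvalue n S c = 4 \<longleftrightarrow> n dvd c * d" for c
    proof -
      define a b where "a = (w ^ s0) ^ c" and "b = (w ^ s1) ^ c"
      have nab: "norm a = 1" "norm b = 1" unfolding a_def b_def by (simp_all add: norm_power nw)
      have ev: "support_eval n S c = a + b"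
        unfolding support_eval_def s(1) w_def[symmetric] a_def b_def using s(2) by (simp add: mult.commute flip: power_mult)
      have g: "gram_eigenvalue n S c = of_real (norm (a + b) ^ 2)"
        unfolding gram_eigenvalue_def ev by (simp only: complex_norm_square)
      have "gram_eigenvalue n S c = 4 \<longleftrightarrow> a = b"
      proof
        assume "gram_eigenvalue n S c = 4"
        then have "complex_of_real (norm (a + b) ^ 2) = of_real 4" unfolding g by simp
        then have "norm (a + b) ^ 2 = 4" by (simp only: of_real_eq_iff)
        then have "norm (a + b) ^ 2 = 2 ^ 2" by simp
        then have "norm (a + b) = 2" by (simp only: power2_eq_iff_nonneg norm_ge_zero zero_le_numeral)
        then show "a = b" by (rule norm_sum_two_max[OF nab])
      next
        assume "a = b"
        then have "norm (a + b) = 2" using nab by (simp add: norm_mult flip: mult_2)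
        then show "gram_eigenvalue n S c = 4" unfolding g by simp
      qed
      also have "\<dots> \<longleftrightarrow> (w ^ d) ^ c = 1"
        unfolding a_def b_def d' power_mult_distrib using w0 by simp
      also have "\<dots> \<longleftrightarrow> n dvd d * c" unfolding power_mult[symmetric] w_def by (rule cis_power_eq_1_iff[OF n])
      finally show ?thesis by (simp only: mult.commute)
    qed
    then have "card {c. c < n \<and> gram_eigenvalue n S c = 4} = gcd d n" using card_multiples[OF n, of d] by simp
    then show ?thesis using s(1) d by blast
  qed
  obtain s0 s1 d where s: "S = {s0, s1}" "w ^ s1 * inverse (w ^ s0) = w ^ d"
    "card {c. c < n \<and> gram_eigenvalue n S c = 4} = gcd d n" using main[OF S] by blast
  obtain t0 t1 b where t: "T = {t0, t1}" "w ^ t1 * inverse (w ^ t0) = w ^ b"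
    "card {c. c < n \<and> gram_eigenvalue n T c = 4} = gcd b n" using main[OF T] by blast
  have "gcd d n = gcd b n" using image_mset_filter_card[OF e, of 4] s(3) t(3) by simp
  then obtain u where u: "coprime u n" "[d = u * b] (mod n)" using unit_multiple[OF n] by blast
  have "w ^ d = w ^ (u * b)" by (rule power_cong_mod[OF wn u(2)])
  then have q: "w ^ s1 * inverse (w ^ s0) = (w ^ t1 * inverse (w ^ t0)) ^ u"
    unfolding s(2) t(2) by (simp add: mult.commute flip: power_mult)
  define z where "z = w ^ s0 * inverse ((w ^ t0) ^ u)"
  have z0: "w ^ s0 = z * (w ^ t0) ^ u" unfolding z_def using w0 by simp
  have z1: "w ^ s1 = z * (w ^ t1) ^ u"
  proof -
    have "w ^ s1 = (w ^ s1 * inverse (w ^ s0)) * w ^ s0" using w0 by simp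
    also have "\<dots> = z * (w ^ t1) ^ u" unfolding q z_def by (simp add: power_mult_distrib power_inverse mult_ac)
    finally show ?thesis .
  qed
  have pn: "(w ^ i) ^ n = 1" for i using wn by (metis mult.commute power_mult power_one)
  have "((w ^ t0) ^ u) ^ n = 1" using pn by (metis power_mult)
  then have zn: "z ^ n = 1" unfolding z_def by (simp add: power_mult_distrib power_inverse pn)
  have "(\<lambda>s. w ^ s) ` S = (\<lambda>t. z * (w ^ t) ^ u) ` T" unfolding s(1) t(1) using z0 z1 by simp
  then show ?thesis using affine_image_of_roots[OF n S(1) T(1) u(1) zn] unfolding w_def by blast
qed

text \<open>By \<open>alpha_eq_6_iff\<close> the exponents with \<open>alpha\<close> equal to 6 are
  those that kill the whole triple. They are the multiples of m, so there are n / m of them below n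
  and the spectrum determines m.\<close>

lemma generating_reduction:
  assumes n: "n > 0" and x: "unity_triple n x1 x2 x3"
  obtains m where "m > 0" "n = card {c. c < n \<and> alpha (x1 ^ c) (x2 ^ c) (x3 ^ c) = 6} * m"
    "unity_triple m x1 x2 x3" "generating m x1 x2 x3"
proof -
  define w where "w = cis (2 * pi / real n)"
  have wiff: "w ^ k = 1 \<longleftrightarrow> n dvd k" for k unfolding w_def by (rule cis_power_eq_1_iff[OF n])
  have xn: "x1 ^ n = 1" "x2 ^ n = 1" "x3 ^ n = 1" "x1 * x2 * x3 = 1" using x unfolding unity_triple_def by auto
  obtain d1 where d1: "x1 = w ^ d1" using root_unity_generator[OF n xn(1)] unfolding w_def by metis
  obtain d2 where d2: "x2 = w ^ d2" using root_unity_generator[OF n xn(2)] unfolding w_def by metis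
  have x3: "x3 = inverse (x1 * x2)" using inverse_unique[OF xn(4)] by simp
  define g where "g = gcd (gcd d1 d2) n"
  have g0: "g > 0" using n unfolding g_def by simp
  obtain m where m: "n = g * m" unfolding g_def by (metis dvdE gcd_dvd2)
  have m0: "m > 0" using n m by (cases m) auto
  have pw: "x1 ^ c = 1 \<and> x2 ^ c = 1 \<and> x3 ^ c = 1 \<longleftrightarrow> n dvd c * gcd d1 d2" for c
  proof -
    have "x1 ^ c = 1 \<and> x2 ^ c = 1 \<and> x3 ^ c = 1 \<longleftrightarrow> x1 ^ c = 1 \<and> x2 ^ c = 1"
      unfolding x3 by (auto simp: power_inverse power_mult_distrib)
    also have "\<dots> \<longleftrightarrow> n dvd c * d1 \<and> n dvd c * d2"
      unfolding d1 d2 power_mult[symmetric] wiff by (simp only: mult.commute)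
    also have "\<dots> \<longleftrightarrow> n dvd c * gcd d1 d2" by (simp only: gcd_mult_distrib_nat gcd_greatest_iff)
    finally show ?thesis .
  qed
  have nr: "norm (z ^ c) = 1" if "z ^ n = 1" for z :: complex and c
    using norm_root_unity[OF n that] by (simp add: norm_power)
  have "card {c. c < n \<and> alpha (x1 ^ c) (x2 ^ c) (x3 ^ c) = 6} = g"
    unfolding alpha_eq_6_iff[OF nr[OF xn(1)] nr[OF xn(2)] nr[OF xn(3)]] pw g_def by (rule card_multiples[OF n])
  moreover have "unity_triple m x1 x2 x3"
  proof -
    have "g dvd gcd d1 d2" unfolding g_def by (rule gcd_dvd1)
    then have "n dvd m * gcd d1 d2" unfolding m by (metis mult.commute mult_dvd_mono dvd_refl)
    then show ?thesis using pw[of m] xn(4) unfolding unity_triple_def by blast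
  qed
  moreover have "generating m x1 x2 x3"
    unfolding generating_def pw
  proof (intro allI impI)
    fix t assume "n dvd t * gcd d1 d2"
    then have "n dvd gcd (t * gcd d1 d2) (t * n)" by simp
    then have "n dvd t * g" unfolding g_def by (simp only: gcd_mult_distrib_nat)
    then have "g * m dvd g * t" unfolding m by (simp only: mult.commute)
    then show "m dvd t" using g0 by simp
  qed
  ultimately show ?thesis using m m0 by (intro that[of m]) simp_all
qed

text \<open>The spectrum for m * k repeats that for m exactly k times, so multiplicities can be
  divided by k. They are written as complex sums to make \<open>sum_periodic\<close>
  applicable.\<close>

lemma isospectral_descend:
  assumes x: "unity_triple m x1 x2 x3" and y: "unity_triple m y1 y2 y3" and k: "k > 0"
    and iso: "isospectral (m * k) x1 x2 x3 y1 y2 y3"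
  shows "isospectral m x1 x2 x3 y1 y2 y3"
  unfolding isospectral_def
proof (rule multiset_eqI)
  fix z
  have cnt: "of_nat (count (image_mset h (mset_set {..<l})) z) = (\<Sum>c<l. if h c = z then 1 else 0 :: complex)"
    for h :: "nat \<Rightarrow> complex" and l
  proof -
    have "h -` {z} \<inter> {..<l} = {c \<in> {..<l}. h c = z}" by auto
    then show ?thesis by (simp add: count_image_mset sum.If_cases Int_def)
  qed
  have per: "of_nat (count (image_mset (\<lambda>c. alpha (z1 ^ c) (z2 ^ c) (z3 ^ c)) (mset_set {..<m * k})) z)
      = of_nat k * (of_nat (count (image_mset (\<lambda>c. alpha (z1 ^ c) (z2 ^ c) (z3 ^ c)) (mset_set {..<m})) z) :: complex)"
    if "unity_triple m z1 z2 z3" for z1 z2 z3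
    unfolding cnt by (rule sum_periodic) (use that in \<open>simp add: unity_triple_def power_add\<close>)
  have "of_nat k * (of_nat (count (image_mset (\<lambda>c. alpha (x1 ^ c) (x2 ^ c) (x3 ^ c)) (mset_set {..<m})) z) :: complex)
    = of_nat k * of_nat (count (image_mset (\<lambda>c. alpha (y1 ^ c) (y2 ^ c) (y3 ^ c)) (mset_set {..<m})) z)"
    unfolding per[OF x, symmetric] per[OF y, symmetric] using iso unfolding isospectral_def by simp
  then show "count (image_mset (\<lambda>c. alpha (x1 ^ c) (x2 ^ c) (x3 ^ c)) (mset_set {..<m})) z
    = count (image_mset (\<lambda>c. alpha (y1 ^ c) (y2 ^ c) (y3 ^ c)) (mset_set {..<m})) z"
    using k by simp
qed

lemma lift_unit:
  fixes k m n :: nat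
  assumes n: "n > 0" and k: "coprime k m"
  obtains u where "coprime u n" "[u = k] (mod m)"
proof -
  obtain t where t: "\<And>r. prime r \<Longrightarrow> r dvd k + m * t \<Longrightarrow> r > n" using coprime_lift[OF k, of n] by blast
  have "coprime (k + m * t) n"
  proof (rule ccontr)
    assume "\<not> coprime (k + m * t) n"
    then have "gcd (k + m * t) n \<noteq> 1" using coprime_iff_gcd_eq_1 by blast
    from prime_factor_nat[OF this] obtain r where r: "prime r" "r dvd gcd (k + m * t) n" by blast
    from r(2) have "r dvd k + m * t" "r dvd n" by (simp_all only: gcd_greatest_iff)
    then have "r > n" "r \<le> n" using t[OF r(1)] n dvd_imp_le by blast+
    then show False by simp
  qed
  moreover have "[k + m * t = k] (mod m)" by (simp add: cong_def)
  ultimately show ?thesis by (rule that)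
qed

text \<open>The exponent relating the triples of quotients is a unit only modulo m. It is lifted to
  a unit modulo n before passing from the quotients back to the supports.\<close>

lemma weight_three:
  assumes n: "n > 0" and S: "S \<subseteq> {..<n}" "card S = 3" and T: "T \<subseteq> {..<n}" "card T = 3"
    and e: "image_mset (gram_eigenvalue n S) (mset_set {..<n}) = image_mset (gram_eigenvalue n T) (mset_set {..<n})"
  shows "\<exists>u<n. \<exists>v<n. gcd u n = 1 \<and> S = affine_image n u v T"
proof -
  define w where "w = cis (2 * pi / real n)"
  have wn: "w ^ n = 1" and w0: "w \<noteq> 0" unfolding w_def using cis_power_eq_1_iff[OF n, of n] by simp_all
  have pn: "(w ^ i) ^ n = 1" for i using wn by (metis mult.commute power_mult power_one)
  have quot: "unity_triple n (w ^ s1 * inverse (w ^ s0)) (w ^ s2 * inverse (w ^ s1)) (w ^ s0 * inverse (w ^ s2))" for s0 s1 s2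
  proof -
    have "w ^ s1 * inverse (w ^ s0) * (w ^ s2 * inverse (w ^ s1)) * (w ^ s0 * inverse (w ^ s2)) = 1"
      using w0 by (simp add: field_simps)
    then show ?thesis unfolding unity_triple_def using pn by (simp add: power_mult_distrib power_inverse)
  qed
  have ne: "w ^ t * inverse (w ^ s) \<noteq> 1" if "s \<noteq> t" "s < n" "t < n" for s t
  proof
    assume "w ^ t * inverse (w ^ s) = 1"
    then have "w ^ t = w ^ s" using w0 by (simp add: field_simps)
    then show False using cis_power_inj[OF n, of t s] that unfolding w_def by (simp add: cong_def)
  qed
  obtain s0 s1 s2 where s: "S = {s0, s1, s2}" "s0 \<noteq> s1" "s1 \<noteq> s2" "s0 \<noteq> s2" using S(2) card_3_iff by metis
  obtain t0 t1 t2 where t: "T = {t0, t1, t2}" "t0 \<noteq> t1" "t1 \<noteq> t2" "t0 \<noteq> t2" using T(2) card_3_iff by metis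
  have sn: "s0 < n" "s1 < n" "s2 < n" and tn: "t0 < n" "t1 < n" "t2 < n" using S(1) T(1) s(1) t(1) by auto
  define x1 x2 x3 where "x1 = w ^ s1 * inverse (w ^ s0)" and "x2 = w ^ s2 * inverse (w ^ s1)" and "x3 = w ^ s0 * inverse (w ^ s2)"
  define y1 y2 y3 where "y1 = w ^ t1 * inverse (w ^ t0)" and "y2 = w ^ t2 * inverse (w ^ t1)" and "y3 = w ^ t0 * inverse (w ^ t2)"
  have xn: "unity_triple n x1 x2 x3" and yn: "unity_triple n y1 y2 y3"
    unfolding x1_def x2_def x3_def y1_def y2_def y3_def by (rule quot)+
  have x1': "1 \<notin> {x1, x2, x3}" and y1': "1 \<notin> {y1, y2, y3}"
    unfolding x1_def x2_def x3_def y1_def y2_def y3_def using ne sn tn s t by auto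
  have gx: "gram_eigenvalue n S = (\<lambda>c. 3 + alpha (x1 ^ c) (x2 ^ c) (x3 ^ c))"
    unfolding s(1) x1_def x2_def x3_def using gram_eigenvalue_3[OF w_def s(2-4)] by blast
  have gy: "gram_eigenvalue n T = (\<lambda>c. 3 + alpha (y1 ^ c) (y2 ^ c) (y3 ^ c))"
    unfolding t(1) y1_def y2_def y3_def using gram_eigenvalue_3[OF w_def t(2-4)] by blast
  have "image_mset (\<lambda>z. z - 3) (image_mset (gram_eigenvalue n S) (mset_set {..<n}))
    = image_mset (\<lambda>z. z - 3) (image_mset (gram_eigenvalue n T) (mset_set {..<n}))" unfolding e ..
  then have iso: "isospectral n x1 x2 x3 y1 y2 y3"
    unfolding isospectral_def gx gy by (simp add: image_mset.compositionality comp_def)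
  \<comment> \<open>Equal multiplicities of the eigenvalue 9 give x and y the same modulus
    m.\<close>
  have card_eq: "card {c. c < n \<and> alpha (x1 ^ c) (x2 ^ c) (x3 ^ c) = 6} = card {c. c < n \<and> alpha (y1 ^ c) (y2 ^ c) (y3 ^ c) = 6}"
    by (rule image_mset_filter_card) (use iso in \<open>simp add: isospectral_def\<close>)
  obtain m where m: "m > 0" "n = card {c. c < n \<and> alpha (x1 ^ c) (x2 ^ c) (x3 ^ c) = 6} * m"
    "unity_triple m x1 x2 x3" "generating m x1 x2 x3" using generating_reduction[OF n xn] by blast
  obtain m' where m': "m' > 0" "n = card {c. c < n \<and> alpha (y1 ^ c) (y2 ^ c) (y3 ^ c) = 6} * m'"
    "unity_triple m' y1 y2 y3" "generating m' y1 y2 y3" using generating_reduction[OF n yn] by blast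
  define g where "g = card {c. c < n \<and> alpha (x1 ^ c) (x2 ^ c) (x3 ^ c) = 6}"
  have ng: "n = g * m" "n = g * m'" using m(2) m'(2) card_eq unfolding g_def by simp_all
  then have g0: "g > 0" using n by (cases g) auto
  have mm: "m' = m" using ng g0 by simp
  have "isospectral (m * g) x1 x2 x3 y1 y2 y3" using iso ng(1) by (simp add: mult.commute)
  then have isom: "isospectral m x1 x2 x3 y1 y2 y3"
    using isospectral_descend[OF m(3) _ g0] m'(3) unfolding mm by blast
  have "power_equiv m x1 x2 x3 y1 y2 y3"
  proof (cases "m dvd 30")
    case True
    show ?thesis by (rule power_equiv_of_isospectral_small[OF m(1) True m(3) m'(3)[unfolded mm] x1' y1' isom])
  next
    case False
    show ?thesis
      by (rule power_equiv_of_isospectral_large[OF m(1) False m(3) m'(3)[unfolded mm] m(4) m'(4)[unfolded mm] x1' y1' isom])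
  qed
  then obtain k where k: "coprime k m" "{#x1, x2, x3#} = {#y1 ^ k, y2 ^ k, y3 ^ k#}" unfolding power_equiv_def by blast
  obtain u where u: "coprime u n" "[u = k] (mod m)" using lift_unit[OF n k(1)] by blast
  have yk: "y1 ^ k = y1 ^ u" "y2 ^ k = y2 ^ u" "y3 ^ k = y3 ^ u"
    using m'(3) power_cong_mod[of _ m, OF _ cong_sym[OF u(2)]] unfolding mm unity_triple_def by blast+
  define q where "q t = (w ^ t) ^ u" for t
  have q0: "q t \<noteq> 0" for t unfolding q_def using w0 by simp
  have qn: "q t ^ n = 1" for t unfolding q_def using pn by (metis power_mult)
  have "{#w ^ s1 * inverse (w ^ s0), w ^ s2 * inverse (w ^ s1), w ^ s0 * inverse (w ^ s2)#}
    = {#q t1 * inverse (q t0), q t2 * inverse (q t1), q t0 * inverse (q t2)#}"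
    using k(2) unfolding yk unfolding x1_def x2_def x3_def y1_def y2_def y3_def q_def
    by (simp only: power_mult_distrib power_inverse)
  moreover have "w ^ s \<noteq> 0" for s using w0 by simp
  ultimately consider r where "r \<in> {q t0, q t1, q t2}"
      "{w ^ s0, w ^ s1, w ^ s2} = (\<lambda>z. (w ^ s0 / r) * z) ` {q t0, q t1, q t2}"
    | r where "r \<in> {q t0, q t1, q t2}"
      "{w ^ s0, w ^ s1, w ^ s2} = (\<lambda>z. (w ^ s0 * r) * inverse z) ` {q t0, q t1, q t2}"
    using triple_from_quotients[of "w ^ s0" "w ^ s1" "w ^ s2" "q t0" "q t1" "q t2"] q0 by blast
  then show ?thesis
  proof cases
    case 1
    define z where "z = w ^ s0 / r"
    have zn: "z ^ n = 1" unfolding z_def using 1(1) qn pn q0 by (auto simp: power_divide)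
    have "(\<lambda>s. w ^ s) ` S = (\<lambda>t. z * (w ^ t) ^ u) ` T"
      using 1(2) unfolding s(1) t(1) z_def[symmetric] q_def by simp
    then show ?thesis using affine_image_of_roots[OF n S(1) T(1) u(1) zn] unfolding w_def by blast
  next
    \<comment> \<open>The reversed case: inversion is the power n - 1, and n - 1 is a unit modulo
      n.\<close>
    case 2
    define z where "z = w ^ s0 * r"
    have zn: "z ^ n = 1" unfolding z_def using 2(1) qn pn by (auto simp: power_mult_distrib)
    have inv: "inverse (q t) = (w ^ t) ^ (u * (n - 1))" for t
    proof (rule inverse_unique)
      have "q t * (w ^ t) ^ (u * (n - 1)) = q t ^ Suc (n - 1)" unfolding q_def by (simp add: power_mult)
      then show "q t * (w ^ t) ^ (u * (n - 1)) = 1" using qn[of t] n by simp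
    qed
    have co: "coprime (u * (n - 1)) n" using u(1) n coprime_diff_one_left_nat[of n] by simp
    have "(\<lambda>s. w ^ s) ` S = (\<lambda>t. z * (w ^ t) ^ (u * (n - 1))) ` T"
      using 2(2) unfolding s(1) t(1) z_def[symmetric] inv[symmetric] by simp
    then show ?thesis using affine_image_of_roots[OF n S(1) T(1) co zn] unfolding w_def by blast
  qed
qed

lemma weight_one:
  assumes n: "n > 0" and S: "S \<subseteq> {..<n}" "card S = 1" and T: "T \<subseteq> {..<n}" "card T = 1"
  shows "\<exists>u<n. \<exists>v<n. gcd u n = 1 \<and> S = affine_image n u v T"
proof -
  obtain s t where st: "S = {s}" "T = {t}" using S(2) T(2) card_1_singletonE by metis
  define w where "w = cis (2 * pi / real n)"
  have wn: "w ^ n = 1" and w0: "w \<noteq> 0" unfolding w_def using cis_power_eq_1_iff[OF n, of n] by simp_all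
  have pn: "(w ^ i) ^ n = 1" for i using wn by (metis mult.commute power_mult power_one)
  have "(w ^ s * inverse (w ^ t)) ^ n = 1" by (simp add: power_mult_distrib power_inverse pn)
  moreover have "(\<lambda>s. w ^ s) ` S = (\<lambda>t'. (w ^ s * inverse (w ^ t)) * (w ^ t') ^ 1) ` T" unfolding st using w0 by simp
  ultimately show ?thesis using affine_image_of_roots[OF n S(1) T(1), of 1] unfolding w_def by simp
qed

lemma affine_image_of_gram_eigenvalues:
  assumes n: "n > 0" and S: "S \<subseteq> {..<n}" "card S \<le> 3" and T: "T \<subseteq> {..<n}"
    and e: "image_mset (gram_eigenvalue n S) (mset_set {..<n}) = image_mset (gram_eigenvalue n T) (mset_set {..<n})"
  shows "\<exists>u<n. \<exists>v<n. gcd u n = 1 \<and> S = affine_image n u v T"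
proof -
  have c: "card S = card T" by (rule same_weight[OF n S(1) T e])
  have fin: "finite S" "finite T" using S(1) T finite_subset by blast+
  consider "card S = 0" | "card S = 1" | "card S = 2" | "card S = 3" using S(2) by linarith
  then show ?thesis
  proof cases
    \<comment> \<open>For empty supports the multiplier is \<open>1 mod n\<close>, so that it is
      below n also when n = 1.\<close>
    case 1
    then have "S = {}" "T = {}" using c fin by auto
    moreover have "gcd (1 mod n) n = 1" by (cases "n = 1") auto
    ultimately show ?thesis using n
      by (intro exI[of _ "1 mod n"] conjI exI[of _ 0]) (simp_all add: affine_image_def)
  next
    case 2
    then show ?thesis using weight_one[OF n S(1) _ T] c by simp
  next
    case 3
    then show ?thesis using weight_two[OF n S(1) _ T _ e] c by simp
  next
    case 4
    then show ?thesis using weight_three[OF n S(1) _ T _ e] c by simp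
  qed
qed

theorem theorem1p1:
  fixes n :: nat and A B :: "complex mat"
  assumes "n \<ge> 1"
    and "zero_one_circulant n A" and "zero_one_circulant n B"
    and "circulant_weight A \<le> 3" and "circulant_weight B \<le> 3"
  shows
    "let
       cond1 = (\<exists>u<n. \<exists>v<n. gcd u n = 1 \<and>
                  circulant_support A = affine_image n u v (circulant_support B));
       cond2 = (\<exists>P Q. permutation_mat n P \<and> permutation_mat n Q \<and> A = P * B * Q);
       cond3 = (\<exists>P P'. permutation_mat n P \<and> P' \<in> carrier_mat n n \<and>
                  inverts_mat P P' \<and> inverts_mat P' P \<and>
                  A * transpose_mat A = P * (B * transpose_mat B) * P');
       cond4 = similar_mat (A * transpose_mat A) (B * transpose_mat B)
     in (cond1 \<longleftrightarrow> cond2) \<and> (cond2 \<longleftrightarrow> cond3) \<and> (cond3 \<longleftrightarrow> cond4)"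
proof -
  let ?c1 = "\<exists>u<n. \<exists>v<n. gcd u n = 1 \<and> circulant_support A = affine_image n u v (circulant_support B)"
  let ?c2 = "\<exists>P Q. permutation_mat n P \<and> permutation_mat n Q \<and> A = P * B * Q"
  let ?c3 = "\<exists>P P'. permutation_mat n P \<and> P' \<in> carrier_mat n n \<and> inverts_mat P P' \<and> inverts_mat P' P \<and>
      A * transpose_mat A = P * (B * transpose_mat B) * P'"
  let ?c4 = "similar_mat (A * transpose_mat A) (B * transpose_mat B)"
  have n: "n > 0" using assms(1) by simp
  have car: "A \<in> carrier_mat n n" "B \<in> carrier_mat n n" using assms(2,3) circulant_carrier by auto
  have 12: "?c2" if h: "?c1"
  proof -
    obtain u v where uv: "gcd u n = 1" "circulant_support A = affine_image n u v (circulant_support B)"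
      using h by metis
    show ?thesis by (rule affine_image_mat_equiv[OF assms(2,3,1) uv])
  qed
  have 23: "?c3" if h: "?c2"
  proof -
    obtain P Q where P: "permutation_mat n P" and Q: "permutation_mat n Q" and A: "A = P * B * Q" using h by blast
    have cP: "P \<in> carrier_mat n n" by (rule permutation_mat_carrier[OF P])
    then have "inverts_mat P (transpose_mat P)" "inverts_mat (transpose_mat P) P"
      using permutation_mat_transpose_right[OF P] permutation_mat_transpose_left[OF P] unfolding inverts_mat_def by auto
    moreover have "A * transpose_mat A = P * (B * transpose_mat B) * transpose_mat P"
      unfolding A by (rule mat_equiv_gram_equiv[OF P Q car(2)])
    ultimately show ?thesis using P cP by (intro exI[of _ P] exI[of _ "transpose_mat P"]) simp
  qed
  have 34: "?c4" if h: "?c3"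
  proof -
    obtain P P' where P: "permutation_mat n P" "P' \<in> carrier_mat n n" "inverts_mat P P'" "inverts_mat P' P"
      and e: "A * transpose_mat A = P * (B * transpose_mat B) * P'" using h by blast
    have cP: "P \<in> carrier_mat n n" by (rule permutation_mat_carrier[OF P(1)])
    have "P * P' = 1\<^sub>m n" "P' * P = 1\<^sub>m n" using P cP unfolding inverts_mat_def by auto
    then have "similar_mat_wit (A * transpose_mat A) (B * transpose_mat B) P P'"
      by (rule similar_mat_witI[OF _ _ e]) (use car cP P(2) in auto)
    then show ?thesis unfolding similar_mat_def by blast
  qed
  have 41: "?c1" if "?c4"
  proof (rule affine_image_of_gram_eigenvalues[OF n])
    show "circulant_support A \<subseteq> {..<n}" "circulant_support B \<subseteq> {..<n}"
      using circulant_support_subset assms(2,3) by auto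
    show "card (circulant_support A) \<le> 3" using assms(4) unfolding circulant_weight_def circulant_support_def .
    show "image_mset (gram_eigenvalue n (circulant_support A)) (mset_set {..<n})
      = image_mset (gram_eigenvalue n (circulant_support B)) (mset_set {..<n})"
      by (rule similar_gram_eigenvalues[OF assms(2,3) n that])
  qed
  \<comment> \<open>The four implications form a cycle, so each converse is the composite of the
    other three.\<close>
  have "?c1 \<longleftrightarrow> ?c2" using 12 41[OF 34[OF 23]] by (rule iffI)
  moreover have "?c2 \<longleftrightarrow> ?c3" using 23 12[OF 41[OF 34]] by (rule iffI)
  moreover have "?c3 \<longleftrightarrow> ?c4" using 34 23[OF 12[OF 41]] by (rule iffI)
  ultimately show ?thesis unfolding Let_def by (intro conjI)
qed

end
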